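(* Let $n,m\in\mathbb{N}$, let $p(\cdot)\in\mathcal{P}(\mathbb{R}^n)$ and let $W\in\mathcal{A}_{p(\cdot)}$ be a matrix weight $W:\mathbb{R}^n\to M_m(\mathbb{R})$. Suppose that $\mathcal{F}$ is a subset of $\mathcal{W}^{1,p(\cdot)}(W)$. If (i) $\mathcal{F}$ is bounded, i.e. $\sup_{\vec f\in\mathcal{F}}\|\vec f\|_{\mathcal{W}^{1,p(\cdot)}(W)}<\infty$; (ii) $\mathcal{F}$ is equicontinuous, that is, $\lim_{r\to0^+}\sup_{\vec f\in\mathcal{F}}\sup_{y\in B(0,r)}\|\tau_y\vec f-\vec f\|_{\mathcal{W}^{1,p(\cdot)}(W)}=0$; (iii) $\mathcal{F}$ uniformly vanishes at infinity, that is, $$\lim_{R\to\infty}\sup_{\vec f\in\mathcal{F}}\Big(\|\vec f\chi_{B^c(0,R)}\|_{L^{p(\cdot)}(W)}+\sum_{j=1}^n\|(\partial_j\vec f)\chi_{B^c(0,R)}\|_{L^{p(\cdot)}(W)}\Big)=0;$$ then $\mathcal{F}$ is a precompact set in $\mathcal{W}^{1,p(\cdot)}(W)$.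
   Context: For measurable $p(\cdot):\mathbb{R}^n\to(0,\infty)$ put $p^-=\operatorname{ess\,inf}p$, $p^+=\operatorname{ess\,sup}p$; $\mathcal{P}(\mathbb{R}^n)$ is the set of those $p(\cdot)$ with $p^->1$ and $p^+<\infty$, and $p'(\cdot)$ is the conjugate exponent, $1/p(x)+1/p'(x)=1$. For a scalar measurable $f$, $\|f\|_{L^{p(\cdot)}}=\inf\{\lambda>0:\int_{\mathbb{R}^n}(|f(x)|/\lambda)^{p(x)}\,dx\le1\}$ (infinite if no such $\lambda$ exists). $M_m(\mathbb{R})$ is the set of real $m\times m$ matrices, $|A|_{\mathrm{op}}=\sup_{|\vec z|=1}|A\vec z|$ with the Euclidean norm on $\mathbb{R}^m$. A matrix weight is a function $W:\mathbb{R}^n\to M_m(\mathbb{R})$ with locally integrable entries such that $W(x)$ is nonnegative definite for every $x$ and invertible for almost every $x$. $W\in\mathcal{A}_{p(\cdot)}$ means that $$[W]_{\mathcal{A}_{p(\cdot)}}:=\sup_Q|Q|^{-1}\Big\|\,\big\|\,|W(x)W^{-1}(\cdot)|_{\mathrm{op}}\chi_Q(\cdot)\big\|_{L^{p'(\cdot)}}\chi_Q(x)\Big\|_{L^{p(\cdot)}_x}<\infty,$$ the supremum being over all cubes $Q\subset\mathbb{R}^n$. $L^{p(\cdot)}(W)$ is the space of measurable $\vec f:\mathbb{R}^n\to\mathbb{R}^m$ with $\|\vec f\|_{L^{p(\cdot)}(W)}:=\|\,|W\vec f|\,\|_{L^{p(\cdot)}}<\infty$ (functions equal a.e. are identified).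 $\mathcal{W}^{1,1}_{\mathrm{loc}}(\mathbb{R}^n)$ is the set of $\vec f=(f_1,\dots,f_m)^{\mathrm T}\in L^1_{\mathrm{loc}}(\mathbb{R}^n)$ all of whose components have weak derivatives $\partial_jf_i\in L^1_{\mathrm{loc}}(\mathbb{R}^n)$, $1\le j\le n$, $1\le i\le m$; $\partial_j\vec f=(\partial_jf_1,\dots,\partial_jf_m)^{\mathrm T}$. $\mathcal{W}^{1,p(\cdot)}(W)$ is the set of $\vec f\in\mathcal{W}^{1,1}_{\mathrm{loc}}(\mathbb{R}^n)$ with $\|\vec f\|_{\mathcal{W}^{1,p(\cdot)}(W)}:=\|\vec f\|_{L^{p(\cdot)}(W)}+\sum_{j=1}^n\|\partial_j\vec f\|_{L^{p(\cdot)}(W)}<\infty$. $\tau_y\vec f(x)=\vec f(x-y)$; $B(0,r)$ is the ball of centre $0$ and radius $r$, $B^c(0,R)$ is the complement of $B(0,R)$; $\chi_S$ is the characteristic function of $S$. *)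

theory Defs
  imports "HOL-Analysis.Analysis" "HOL-Probability.Essential_Supremum"
begin

definition essinf :: "'a measure \<Rightarrow> ('a \<Rightarrow> ereal) \<Rightarrow> ereal" where
  "essinf M f = - esssup M (\<lambda>x. - f x)"

definition exponents :: "(real^'n \<Rightarrow> real) set" where
  "exponents = {p. p \<in> borel_measurable lebesgue \<and> (\<forall>x. 0 < p x) \<and>
     essinf lebesgue (\<lambda>x. ereal (p x)) > 1 \<and> esssup lebesgue (\<lambda>x. ereal (p x)) < \<infinity>}"

text \<open>Solution of \<open>1 / p x + 1 / p' x = 1\<close>. For exponents as above, \<open>p x \<le> 1\<close> happens only on a null
  set, where the value is irrelevant.\<close>

definition conj_exponent :: "('a \<Rightarrow> real) \<Rightarrow> 'a \<Rightarrow> real" where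
  "conj_exponent p x = p x / (p x - 1)"

text \<open>Only meant for positive exponents \<open>a\<close>.\<close>

definition epowr :: "ennreal \<Rightarrow> real \<Rightarrow> ennreal" where
  "epowr t a = (if t = \<infinity> then \<infinity> else ennreal (enn2real t powr a))"

text \<open>The Luxemburg norm is taken of the absolute value, with values in \<open>[0, \<infinity>]\<close>: the inner norm in
  the \<open>A\<^sub>p\<close> condition is a function that may take the value \<open>\<infinity>\<close>. Note \<open>Inf {} = \<infinity>\<close>.\<close>

definition lux_norm :: "(real^'n \<Rightarrow> real) \<Rightarrow> (real^'n \<Rightarrow> ennreal) \<Rightarrow> ennreal" where
  "lux_norm p g =
     Inf {ennreal l | l. 0 < l \<and> (\<integral>\<^sup>+x. epowr (g x / ennreal l) (p x) \<partial>lebesgue) \<le> 1}"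

definition locally_integrable :: "(real^'n \<Rightarrow> 'b::euclidean_space) \<Rightarrow> bool" where
  "locally_integrable f \<longleftrightarrow> (\<forall>K. compact K \<longrightarrow> f absolutely_integrable_on K)"

text \<open>Symmetry is not imposed; a symmetric nonnegative definite matrix is a special case.\<close>

definition nonneg_definite :: "real^'m^'m \<Rightarrow> bool" where
  "nonneg_definite A \<longleftrightarrow> (\<forall>z. 0 \<le> (A *v z) \<bullet> z)"

definition matrix_weight :: "(real^'n \<Rightarrow> real^'m^'m) \<Rightarrow> bool" where
  "matrix_weight W \<longleftrightarrow>
     (\<forall>i j. locally_integrable (\<lambda>x. W x $ i $ j)) \<and>
     (\<forall>x. nonneg_definite (W x)) \<and>
     (AE x in lebesgue. invertible (W x))"

definition op_norm :: "real^'m^'m \<Rightarrow> real" where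
  "op_norm A = onorm (\<lambda>z. A *v z)"

definition cubes :: "(real^'n) set set" where
  "cubes = {cbox a (\<chi> i. a $ i + l) | a l. 0 < l}"

definition Ap_const :: "(real^'n \<Rightarrow> real) \<Rightarrow> (real^'n \<Rightarrow> real^'m^'m) \<Rightarrow> ennreal" where
  "Ap_const p W = (SUP Q\<in>cubes. inverse (emeasure lebesgue Q) *
     lux_norm p (\<lambda>x.
       lux_norm (conj_exponent p) (\<lambda>y. ennreal (op_norm (W x ** matrix_inv (W y))) * indicator Q y)
         * indicator Q x))"

definition Lp_norm ::
  "(real^'n \<Rightarrow> real) \<Rightarrow> (real^'n \<Rightarrow> real^'m^'m) \<Rightarrow> (real^'n \<Rightarrow> real^'m) \<Rightarrow> ennreal" where
  "Lp_norm p W f = lux_norm p (\<lambda>x. ennreal (norm (W x *v f x)))"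

definition partial :: "'n \<Rightarrow> (real^'n \<Rightarrow> real) \<Rightarrow> real^'n \<Rightarrow> real" where
  "partial j \<phi> x = frechet_derivative \<phi> (at x) (axis j 1)"

primrec Ck :: "nat \<Rightarrow> (real^'n \<Rightarrow> real) \<Rightarrow> bool" where
  "Ck 0 \<phi> \<longleftrightarrow> continuous_on UNIV \<phi>"
| "Ck (Suc k) \<phi> \<longleftrightarrow> (\<forall>x. \<phi> differentiable at x) \<and> (\<forall>j. Ck k (partial j \<phi>))"

definition test_functions :: "(real^'n \<Rightarrow> real) set" where
  "test_functions = {\<phi>. (\<forall>k. Ck k \<phi>) \<and> compact (closure {x. \<phi> x \<noteq> 0})}"

definition has_weak_partial :: "'n \<Rightarrow> (real^'n \<Rightarrow> real) \<Rightarrow> (real^'n \<Rightarrow> real) \<Rightarrow> bool" where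
  "has_weak_partial j u g \<longleftrightarrow> locally_integrable u \<and> locally_integrable g \<and>
     (\<forall>\<phi>\<in>test_functions.
        (\<integral>x. u x * partial j \<phi> x \<partial>lebesgue) = - (\<integral>x. g x * \<phi> x \<partial>lebesgue))"

text \<open>A representative of the weak derivative, which is determined up to null sets only.\<close>

definition weak_partial :: "'n \<Rightarrow> (real^'n \<Rightarrow> real^'m) \<Rightarrow> real^'n \<Rightarrow> real^'m" where
  "weak_partial j f = (\<lambda>x. \<chi> i. (SOME g. has_weak_partial j (\<lambda>x. f x $ i) g) x)"

definition W11_loc :: "(real^'n \<Rightarrow> real^'m) set" where
  "W11_loc = {f. locally_integrable f \<and> (\<forall>i j. \<exists>g. has_weak_partial j (\<lambda>x. f x $ i) g)}"

definition W1p_norm ::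
  "(real^'n \<Rightarrow> real) \<Rightarrow> (real^'n \<Rightarrow> real^'m^'m) \<Rightarrow> (real^'n \<Rightarrow> real^'m) \<Rightarrow> ennreal" where
  "W1p_norm p W f = Lp_norm p W f + (\<Sum>j\<in>UNIV. Lp_norm p W (weak_partial j f))"

definition W1p ::
  "(real^'n \<Rightarrow> real) \<Rightarrow> (real^'n \<Rightarrow> real^'m^'m) \<Rightarrow> (real^'n \<Rightarrow> real^'m) set" where
  "W1p p W = {f \<in> W11_loc. W1p_norm p W f < \<infinity>}"

definition ae_rel ::
  "(real^'n \<Rightarrow> real) \<Rightarrow> (real^'n \<Rightarrow> real^'m^'m) \<Rightarrow>
   ((real^'n \<Rightarrow> real^'m) \<times> (real^'n \<Rightarrow> real^'m)) set" where
  "ae_rel p W = {(f, g). f \<in> W1p p W \<and> g \<in> W1p p W \<and> (AE x in lebesgue. f x = g x)}"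

text \<open>The Sobolev space as a metric space: its points are the classes of \<open>W1p p W\<close> modulo equality
  almost everywhere, and the distance is the norm of the difference of representatives. The
  conditional is there because \<open>Metric_space\<close> asks for symmetry outside the carrier as well.\<close>

definition W1p_space ::
  "(real^'n \<Rightarrow> real) \<Rightarrow> (real^'n \<Rightarrow> real^'m^'m) \<Rightarrow> (real^'n \<Rightarrow> real^'m) set set" where
  "W1p_space p W = W1p p W // ae_rel p W"

definition W1p_dist ::
  "(real^'n \<Rightarrow> real) \<Rightarrow> (real^'n \<Rightarrow> real^'m^'m) \<Rightarrow>
   (real^'n \<Rightarrow> real^'m) set \<Rightarrow> (real^'n \<Rightarrow> real^'m) set \<Rightarrow> real" where
  "W1p_dist p W A B =
     (if A \<in> W1p_space p W \<and> B \<in> W1p_space p W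
      then enn2real (W1p_norm p W (\<lambda>x. (SOME f. f \<in> A) x - (SOME g. g \<in> B) x)) else 0)"

definition W1p_topology ::
  "(real^'n \<Rightarrow> real) \<Rightarrow> (real^'n \<Rightarrow> real^'m^'m) \<Rightarrow> (real^'n \<Rightarrow> real^'m) set topology" where
  "W1p_topology p W = Metric_space.mtopology (W1p_space p W) (W1p_dist p W)"

definition precompact_in_W1p ::
  "(real^'n \<Rightarrow> real) \<Rightarrow> (real^'n \<Rightarrow> real^'m^'m) \<Rightarrow> (real^'n \<Rightarrow> real^'m) set \<Rightarrow> bool" where
  "precompact_in_W1p p W F \<longleftrightarrow>
     compactin (W1p_topology p W)
       (W1p_topology p W closure_of ((\<lambda>f. ae_rel p W `` {f}) ` F))"

definition translate :: "real^'n \<Rightarrow> (real^'n \<Rightarrow> 'b) \<Rightarrow> real^'n \<Rightarrow> 'b" where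
  "translate y f x = f (x - y)"

end

(*
  The averaged A_p condition at one good point x gives |f| <= C |W f| g on a cube with g in the
  conjugate space, so L^p(W) embeds into L^1_loc; testing it against W y e shows that |W| is locally
  in L^p. The first fact makes the Sobolev space complete: a rapidly Cauchy sequence converges a.e.
  and in L^1_loc, which preserves weak derivatives, and Fatou gives convergence in norm.

  For total boundedness, f is replaced by its averages over the cells of a grid of mesh h. By Jensen
  and Tonelli the error is controlled, uniformly over the family, by the translates of f by vectors in
  [-h,h]^n, at the price of a factor 2^n. By the vanishing condition only finitely many cells matter,
  the averages over them are bounded by the embedding, and nearby averages give nearby functions
  since |W| is locally in L^p. This is applied to f and to each of its weak derivatives.
*)
theory Submission
  imports Defs
begin

subsection \<open>Bump functions and the fundamental lemma\<close>

text \<open>Averages suit a variable exponent and a matrix weight because the error at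
  \<open>x\<close> is controlled by the mean over \<open>y\<close> of the powers |W(x) (f(x) -
  f(y))|^p(x): weight and exponent both stay at \<open>x\<close>, only \<open>f\<close> is shifted,
  and the equicontinuity condition bounds exactly the integrals that Tonelli produces. A cell has
  volume h^n and lies in x + [-h,h]^n, of volume (2h)^n; hence the factor 2^n.

  Three obstacles shape the details. The inner norm of the weight condition is not shown to be
  measurable in \<open>x\<close>, so only monotonicity is applied to it, and the functions paired in
  Hoelder's inequality are built from measurable data. Tonelli is applied to a product of two copies
  of \<open>lborel\<close>, so \<open>f\<close>, \<open>p\<close> and \<open>W\<close> are first
  replaced by Borel versions. Finally, \<open>weak_partial\<close> is a choice among functions equal
  almost everywhere; that it respects differences and translations up to null sets rests on
  uniqueness, hence on the fundamental lemma and on explicit smooth bumps.\<close>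

primrec Ck_real :: "nat \<Rightarrow> (real \<Rightarrow> real) \<Rightarrow> bool" where
  "Ck_real 0 f \<longleftrightarrow> continuous_on UNIV f"
| "Ck_real (Suc k) f \<longleftrightarrow> (\<exists>f'. (\<forall>x. (f has_real_derivative f' x) (at x)) \<and> Ck_real k f')"

lemma Ck_real_SucD: "Ck_real (Suc k) f \<Longrightarrow> Ck_real k f"
proof (induction k arbitrary: f)
  case 0
  then show ?case
    by (auto intro!: continuous_at_imp_continuous_on intro: DERIV_isCont)
next
  case (Suc k)
  then show ?case by (metis Ck_real.simps(2))
qed

lemma Ck_real_add: "Ck_real k f \<Longrightarrow> Ck_real k g \<Longrightarrow> Ck_real k (\<lambda>x. f x + g x)"
proof (induction k arbitrary: f g)
  case (Suc k)
  then obtain f' g' where "\<forall>x. (f has_real_derivative f' x) (at x)" "Ck_real k f'"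
      "\<forall>x. (g has_real_derivative g' x) (at x)" "Ck_real k g'" by auto
  with Suc.IH show ?case
    by (auto intro!: exI[of _ "\<lambda>x. f' x + g' x"] derivative_eq_intros)
qed (auto intro: continuous_intros)

text \<open>The product rule brings back the undifferentiated factors; \<open>Ck_real_SucD\<close>
  supplies them at the lower order for the induction hypothesis.\<close>

lemma Ck_real_mult: "Ck_real k f \<Longrightarrow> Ck_real k g \<Longrightarrow> Ck_real k (\<lambda>x. f x * g x)"
proof (induction k arbitrary: f g)
  case (Suc k)
  then obtain f' g' where *: "\<forall>x. (f has_real_derivative f' x) (at x)" "Ck_real k f'"
      "\<forall>x. (g has_real_derivative g' x) (at x)" "Ck_real k g'" by auto
  have "Ck_real k (\<lambda>x. f' x * g x + f x * g' x)"
    using * Suc.prems[THEN Ck_real_SucD] by (intro Ck_real_add Suc.IH)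
  with * show ?case
    by (auto intro!: exI[of _ "\<lambda>x. f' x * g x + f x * g' x"] derivative_eq_intros)
qed (auto intro: continuous_intros)

lemma Ck_real_const: "Ck_real k (\<lambda>x. c)"
proof (induction k arbitrary: c)
  case (Suc k)
  show ?case by (auto intro!: exI[of _ "\<lambda>x. 0"] Suc)
qed auto

lemma Ck_real_affine: "Ck_real k f \<Longrightarrow> Ck_real k (\<lambda>x. f (a * x + b))"
proof (induction k arbitrary: f)
  case 0
  then show ?case
    by (auto intro!: continuous_on_compose2[of UNIV f] continuous_intros)
next
  case (Suc k)
  then obtain f' where *: "\<And>x. (f has_real_derivative f' x) (at x)" "Ck_real k f'" by auto
  have "Ck_real k (\<lambda>x. f' (a * x + b) * a)"
    using Suc * by (intro Ck_real_mult Ck_real_const) auto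
  moreover have "((\<lambda>x. f (a * x + b)) has_real_derivative f' (a * x + b) * a) (at x)" for x
    by (rule DERIV_chain2[OF *(1)]) (auto intro!: derivative_eq_intros)
  ultimately show ?case
    by (auto intro!: exI[of _ "\<lambda>x. f' (a * x + b) * a"])
qed

text \<open>\<open>flat 0\<close> is the classical smooth function exp(-1/t) continued by 0. The
  powers of 1/t are included because differentiation then stays within the span of the family, as
  \<open>flat_deriv\<close> shows, so that smoothness follows by induction on the order for all
  \<open>j\<close> at once.\<close>

definition flat :: "nat \<Rightarrow> real \<Rightarrow> real" where
  "flat j t = (if t > 0 then inverse t ^ j * exp (- inverse t) else 0)"

text \<open>With s = 1/t this is the limit of s^j / exp s at infinity.\<close>

lemma flat_tendsto_0: "(flat j \<longlongrightarrow> 0) (at_right 0)"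
proof -
  have "((\<lambda>t::real. inverse t ^ j / exp (inverse t)) \<longlongrightarrow> 0) (at_right 0)"
    by (rule filterlim_compose[OF tendsto_power_div_exp_0 filterlim_inverse_at_top_right])
  then show ?thesis
    by (rule Lim_transform_eventually)
       (auto simp: eventually_at_right_field flat_def exp_minus divide_inverse intro!: exI[of _ 1])
qed

lemma flat_deriv: "(flat j has_real_derivative - real j * flat (Suc j) x + flat (j + 2) x) (at x)"
proof (cases x "0::real" rule: linorder_cases)
  case less
  then have "\<forall>\<^sub>F t in nhds x. flat j t = 0"
    using eventually_nhds_in_open[of "{..<0}" x] by (auto elim!: eventually_mono simp: flat_def)
  with less show ?thesis
    by (subst DERIV_cong_ev[OF refl _ refl, where g = "\<lambda>_. 0"]) (auto simp: flat_def)
next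
  case greater
  then have ev: "\<forall>\<^sub>F t in nhds x. flat j t = inverse t ^ j * exp (- inverse t)"
    using eventually_nhds_in_open[of "{0<..}" x] by (auto elim!: eventually_mono simp: flat_def)
  have "((\<lambda>t. inverse t ^ j * exp (- inverse t)) has_real_derivative
      - real j * flat (Suc j) x + flat (j + 2) x) (at x)"
    using greater
    apply (auto intro!: derivative_eq_intros simp: flat_def)
    \<comment> \<open>The power rule leaves the exponent \<open>j - 1\<close> on natural numbers, so
      \<open>j = 0\<close> is treated apart.\<close>
    apply (cases j)
     apply (auto simp: field_simps power2_eq_square)
    done
  then show ?thesis
    using ev by (subst DERIV_cong_ev[OF refl _ refl]) auto
next
  case equal
  have "((\<lambda>t. (flat j t - flat j 0) / (t - 0)) \<longlongrightarrow> 0) (at 0)"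
  proof -
    have l: "((\<lambda>t. (flat j t - flat j 0) / (t - 0)) \<longlongrightarrow> 0) (at_left 0)"
      by (rule Lim_transform_eventually[OF tendsto_const])
        (auto simp: eventually_at_left_field flat_def intro!: exI[of _ "-1"])
    \<comment> \<open>Dividing \<open>flat j t\<close> by a positive \<open>t\<close> gives
      \<open>flat (Suc j) t\<close>, so the right difference quotient tends to 0 by the limit
      already known.\<close>
    have r: "((\<lambda>t. (flat j t - flat j 0) / (t - 0)) \<longlongrightarrow> 0) (at_right 0)"
      by (rule Lim_transform_eventually[OF flat_tendsto_0[of "Suc j"]])
        (auto simp: eventually_at_right_field flat_def field_simps intro!: exI[of _ "1"])
    show ?thesis using l r by (simp add: filterlim_split_at_real)
  qed
  then show ?thesis using equal
    by (simp add: has_field_derivative_iff flat_def)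
qed

lemma Ck_real_flat: "Ck_real k (flat j)"
proof (induction k arbitrary: j)
  case 0
  then show ?case
    by (auto intro!: continuous_at_imp_continuous_on DERIV_isCont[OF flat_deriv])
next
  case (Suc k)
  then show ?case
    by (auto intro!: exI[of _ "\<lambda>x. - real j * flat (Suc j) x + flat (j + 2) x"] flat_deriv
        Ck_real_add Ck_real_mult Ck_real_const simp del: add_2_eq_Suc' mult_minus_left)
qed

text \<open>A partial derivative of a product of one-variable factors only replaces one factor by
  its derivative. The product form is thus kept, and the induction runs over all families
  \<open>H\<close>.\<close>

lemma Ck_prod:
  assumes "\<And>i. Ck_real k (H i)"
  shows "Ck k (\<lambda>x::real^'n. \<Prod>i\<in>UNIV. H i (x $ i))"
  using assms
proof (induction k arbitrary: H)
  case 0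
  then show ?case
    by (auto intro!: continuous_intros intro: continuous_on_compose2[where t = UNIV])
next
  case (Suc k)
  then obtain H' where H': "\<And>i x. (H i has_real_derivative H' i x) (at x)" "\<And>i. Ck_real k (H' i)"
    by (simp del: split_paired_All) metis
  have d: "((\<lambda>x::real^'n. \<Prod>i\<in>UNIV. H i (x $ i)) has_derivative
      (\<lambda>y. \<Sum>i\<in>UNIV. (H' i (x $ i) * y $ i) * (\<Prod>l\<in>UNIV - {i}. H l (x $ l)))) (at x)" for x
  proof (rule has_derivative_prod)
    fix i
    have "((\<lambda>x. x $ i) has_derivative (\<lambda>y. y $ i)) (at x)"
      by (auto intro: bounded_linear_imp_has_derivative bounded_linear_vec_nth)
    from has_derivative_compose[OF this H'(1)[unfolded has_field_derivative_def]]
    show "((\<lambda>x. H i (x $ i)) has_derivative (\<lambda>y. H' i (x $ i) * y $ i)) (at x)" .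
  qed
  have pd: "partial j (\<lambda>x::real^'n. \<Prod>i\<in>UNIV. H i (x $ i))
    = (\<lambda>x. \<Prod>i\<in>UNIV. (if i = j then H' i else H i) (x $ i))" for j
  proof
    fix x
    have "partial j (\<lambda>x::real^'n. \<Prod>i\<in>UNIV. H i (x $ i)) x
      = (\<Sum>i\<in>UNIV. (H' i (x $ i) * axis j 1 $ i) * (\<Prod>l\<in>UNIV - {i}. H l (x $ l)))"
      unfolding partial_def by (subst frechet_derivative_at[OF d, symmetric]) simp
    also have "\<dots> = (\<Sum>i\<in>{j}. (H' i (x $ i) * axis j 1 $ i) * (\<Prod>l\<in>UNIV - {i}. H l (x $ l)))"
      by (rule sum.mono_neutral_right) (auto simp: axis_def)
    also have "\<dots> = H' j (x $ j) * (\<Prod>l\<in>UNIV - {j}. (if l = j then H' l else H l) (x $ l))"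
      by (auto simp: axis_def intro!: prod.cong)
    also have "\<dots> = (\<Prod>i\<in>UNIV. (if i = j then H' i else H i) (x $ i))"
      by (subst prod.remove[of UNIV j]) auto
    finally show "partial j (\<lambda>x::real^'n. \<Prod>i\<in>UNIV. H i (x $ i)) x = \<dots>" .
  qed
  show ?case
    unfolding Ck.simps(2) pd
    using d H'(2) Suc.prems[THEN Ck_real_SucD] by (auto simp: differentiable_def simp del: Ck_real.simps intro!: Suc.IH)
qed


text \<open>For s > 0 a factor exp(-1/(r s)) tends to 1 as \<open>r\<close> grows, and for s \<le> 0
  it is replaced by 0. The bumps therefore approach the indicator of the open box, bounded by 1 and
  supported in the closed box.\<close>

definition bump :: "real \<Rightarrow> real^'n \<Rightarrow> real^'n \<Rightarrow> real^'n \<Rightarrow> real" where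
  "bump r a b x = (\<Prod>i\<in>UNIV. flat 0 (r * (x $ i - a $ i)) * flat 0 (r * (b $ i - x $ i)))"

lemma flat_0_bounds: "0 \<le> flat 0 t" "flat 0 t \<le> 1"
  by (auto simp: flat_def)

lemma bump_bounds: "0 \<le> bump r a b x" "bump r a b x \<le> 1"
  by (auto simp: bump_def flat_0_bounds intro!: prod_nonneg prod_le_1 mult_nonneg_nonneg mult_le_one)

lemma bump_outside:
  assumes "x \<notin> box a b" "r \<ge> 0"
  shows "bump r a b x = 0"
proof -
  obtain i where "\<not> (a $ i < x $ i \<and> x $ i < b $ i)"
    using assms by (auto simp: mem_box_cart)
  then have "flat 0 (r * (x $ i - a $ i)) * flat 0 (r * (b $ i - x $ i)) = 0"
    using assms by (auto simp: flat_def zero_less_mult_iff)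
  then show ?thesis
    unfolding bump_def by (intro prod_zero) auto
qed

lemma bump_test_function:
  assumes "r \<ge> 0"
  shows "bump r a b \<in> test_functions"
proof -
  have "Ck_real k (\<lambda>t. flat 0 (r * (t - a $ i)) * flat 0 (r * (b $ i - t)))" for k i
    using Ck_real_mult[OF Ck_real_affine[OF Ck_real_flat[of k 0], of r "- r * a $ i"]
        Ck_real_affine[OF Ck_real_flat[of k 0], of "-r" "r * b $ i"]]
    by (simp add: algebra_simps)
  then have "Ck k (bump r a b)" for k
    unfolding bump_def by (rule Ck_prod)
  moreover have "{x. bump r a b x \<noteq> 0} \<subseteq> cbox a b"
    using bump_outside[OF _ assms] box_subset_cbox by blast
  ultimately show ?thesis
    by (auto simp: test_functions_def intro: bounded_subset[OF bounded_cbox])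
qed

lemma bump_tendsto_indicator:
  fixes x :: "real^'n"
  shows "(\<lambda>k. bump (real k) a b x) \<longlonglongrightarrow> indicator (box a b) x"
proof (cases "x \<in> box a b")
  case False
  then show ?thesis by (simp add: bump_outside)
next
  case True
  have *: "(\<lambda>k. flat 0 (real k * s)) \<longlonglongrightarrow> 1" if "s > 0" for s
  proof -
    have "(\<lambda>k. exp (- (inverse (real k) * inverse s))) \<longlonglongrightarrow> exp (- (0 * inverse s))"
      by (intro tendsto_intros lim_inverse_n)
    then have "(\<lambda>k. exp (- (inverse (real k) * inverse s))) \<longlonglongrightarrow> 1" by simp
    then show ?thesis
      using that
      by (rule_tac Lim_transform_eventually)
        (auto simp: flat_def eventually_sequentially intro!: exI[of _ 1])
  qed
  have "(\<lambda>k. bump (real k) a b x) \<longlonglongrightarrow> (\<Prod>i\<in>(UNIV::'n set). 1 * 1)"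
    unfolding bump_def using True by (intro tendsto_prod tendsto_mult *) (auto simp: mem_box_cart)
  with True show ?thesis by simp
qed

section \<open>Locally integrable functions and their integrals over boxes\<close>

lemma locally_integrableD:
  assumes "locally_integrable f" "compact K"
  shows "integrable lebesgue (\<lambda>x. indicator K x *\<^sub>R f x)"
  using assms by (simp add: locally_integrable_def set_integrable_def)

lemma locally_integrableI:
  assumes "\<And>K. compact K \<Longrightarrow> integrable lebesgue (\<lambda>x. indicator K x *\<^sub>R f x)"
  shows "locally_integrable f"
  using assms by (simp add: locally_integrable_def set_integrable_def)

lemma continuous_measurable_lebesgue:
  "continuous_on UNIV (f :: 'a::euclidean_space \<Rightarrow> 'b::topological_space) \<Longrightarrow> f \<in> borel_measurable lebesgue"
  by (rule measurable_completion) (simp add: borel_measurable_continuous_onI)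

lemma indicator_cball_tendsto:
  fixes x :: "'a::real_normed_vector" and y :: "'b::real_normed_vector"
  shows "(\<lambda>k. indicator (cball 0 (real k)) x *\<^sub>R y) \<longlonglongrightarrow> y"
proof -
  have "\<forall>\<^sub>F k in sequentially. indicator (cball 0 (real k)) x *\<^sub>R y = y"
    using eventually_ge_at_top[of "nat \<lceil>norm x\<rceil>"]
    by eventually_elim (auto simp: indicator_def; linarith)
  then show ?thesis by (rule tendsto_eventually)
qed

text \<open>Local integrability speaks of compact sets only; measurability on the whole space is
  recovered from the truncations to growing balls.\<close>

lemma locally_integrable_measurable [measurable_dest]:
  assumes "locally_integrable f"
  shows "f \<in> borel_measurable lebesgue"
proof (rule borel_measurable_LIMSEQ_metric)
  show "(\<lambda>x. indicator (cball 0 (real k)) x *\<^sub>R f x) \<in> borel_measurable lebesgue" for k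
    using locally_integrableD[OF assms compact_cball] by (rule borel_measurable_integrable)
qed (rule indicator_cball_tendsto)

lemma integrable_locally_integrable_mult:
  fixes u \<psi> :: "real^'n \<Rightarrow> real"
  assumes "locally_integrable u" "continuous_on UNIV \<psi>" "compact K" "\<And>x. x \<notin> K \<Longrightarrow> \<psi> x = 0"
  shows "integrable lebesgue (\<lambda>x. u x * \<psi> x)"
proof -
  have "bounded (\<psi> ` K)"
    using assms by (intro compact_imp_bounded compact_continuous_image) (auto intro: continuous_on_subset)
  then obtain B where B: "\<And>x. x \<in> K \<Longrightarrow> \<bar>\<psi> x\<bar> \<le> B"
    by (auto simp: bounded_iff)
  have m: "\<psi> \<in> borel_measurable lebesgue"
    using assms(2) by (rule continuous_measurable_lebesgue)
  have i: "integrable lebesgue (\<lambda>x. B * norm (indicator K x *\<^sub>R u x))"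
    using locally_integrableD[OF assms(1,3)] by (intro integrable_mult_right integrable_norm)
  show ?thesis
  proof (rule Bochner_Integration.integrable_bound[OF i])
    show "(\<lambda>x. u x * \<psi> x) \<in> borel_measurable lebesgue"
      using m locally_integrable_measurable[OF assms(1)] by simp
    show "AE x in lebesgue. norm (u x * \<psi> x) \<le> norm (B * norm (indicator K x *\<^sub>R u x))"
    proof (rule AE_I2)
      fix x show "norm (u x * \<psi> x) \<le> norm (B * norm (indicator K x *\<^sub>R u x))"
        using B[of x] assms(4)[of x]
        by (cases "x \<in> K") (auto simp: abs_mult mult.commute[of "\<bar>u x\<bar>"] intro!: mult_right_mono)
    qed
  qed
qed

lemma test_function_continuous: "\<phi> \<in> test_functions \<Longrightarrow> continuous_on UNIV \<phi>"
  by (auto simp: test_functions_def dest: spec[of _ 0])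

text \<open>Open boxes are stable under intersection and generate the Borel sets, so the integral
  vanishes over every Borel set, in particular over the sets where the function is positive and
  where it is negative. A Borel version \<open>g'\<close> is taken first because the induction runs
  over Borel sets.\<close>

lemma AE_0_if_box_integrals_0:
  fixes g :: "real^'n \<Rightarrow> real"
  assumes "integrable lebesgue g" "\<And>a b. (\<integral>x. g x * indicator (box a b) x \<partial>lebesgue) = 0"
  shows "AE x in lebesgue. g x = 0"
proof -
  obtain g' where g': "g' \<in> borel_measurable lborel" "AE x in lborel. g x = g' x"
    using completion_ex_borel_measurable_real[of g lborel] assms(1) by auto
  have "integrable lebesgue g'"
    using assms(1) measurable_completion[OF g'(1)] AE_completion[OF g'(2)]
    by (rule integrable_cong_AE_imp)
  then have int: "integrable lborel g'"
    using integrable_completion g'(1) by blast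
  have bx: "(\<integral>x. indicator (box a b) x *\<^sub>R g' x \<partial>lborel) = 0" for a b
  proof -
    have "(\<integral>x. indicator (box a b) x *\<^sub>R g' x \<partial>lborel) = (\<integral>x. indicator (box a b) x * g' x \<partial>lebesgue)"
      using g' by (subst integral_completion) auto
    also have "\<dots> = (\<integral>x. g x * indicator (box a b) x \<partial>lebesgue)"
      using AE_completion[OF g'(2)] measurable_completion[OF g'(1)] borel_measurable_integrable[OF assms(1)]
      by (intro integral_cong_AE borel_measurable_times borel_measurable_indicator)
        (auto elim!: eventually_mono)
    finally show ?thesis using assms(2) by simp
  qed
  define B :: "nat \<Rightarrow> (real^'n) set" where "B k = box (- (real k *\<^sub>R One)) (real k *\<^sub>R One)" for k
  have B: "\<exists>k0. \<forall>k\<ge>k0. x \<in> B k" for x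
  proof -
    have "x \<in> (\<Union>i. B i)"
      unfolding B_def UN_box_eq_UNIV ..
    then obtain k0 where k0: "x \<in> B k0" by blast
    have "x \<in> B k" if "k0 \<le> k" for k
    proof -
      have "real k0 \<le> real k" using that by simp
      have "x \<bullet> i < real k \<and> - real k < x \<bullet> i" if "i \<in> Basis" for i
        using k0 that \<open>real k0 \<le> real k\<close> by (auto simp: B_def mem_box dest!: bspec[where x = i])
      then show ?thesis by (simp add: B_def mem_box)
    qed
    then show ?thesis by blast
  qed
  \<comment> \<open>Complements in the later induction require the integral over the whole space to
    be 0; it is the limit of the integrals over growing boxes.\<close>
  have "(\<lambda>k. \<integral>x. indicator (B k) x *\<^sub>R g' x \<partial>lborel) \<longlonglongrightarrow> (\<integral>x. g' x \<partial>lborel)"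
  proof (rule integral_dominated_convergence[where w = "\<lambda>x. norm (g' x)"])
    show "AE x in lborel. (\<lambda>k. indicat_real (B k) x *\<^sub>R g' x) \<longlonglongrightarrow> g' x"
    proof (rule AE_I2)
      fix x
      have "\<forall>\<^sub>F k in sequentially. indicat_real (B k) x *\<^sub>R g' x = g' x"
        using B[of x] unfolding eventually_sequentially by (metis indicator_simps(1) scaleR_one)
      then show "(\<lambda>k. indicat_real (B k) x *\<^sub>R g' x) \<longlonglongrightarrow> g' x"
        by (rule tendsto_eventually)
    qed
    show "(\<lambda>x. indicat_real (B k) x *\<^sub>R g' x) \<in> borel_measurable lborel" for k
      using g' by (simp add: B_def)
    show "g' \<in> borel_measurable lborel" by fact
    show "integrable lborel (\<lambda>x. norm (g' x))"
      using int by simp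
    show "AE x in lborel. norm (indicat_real (B k) x *\<^sub>R g' x) \<le> norm (g' x)" for k
      by (auto simp: indicator_def)
  qed
  moreover have "(\<lambda>k. \<integral>x. indicator (B k) x *\<^sub>R g' x \<partial>lborel) = (\<lambda>k. 0)"
    unfolding B_def bx ..
  ultimately have tot: "(\<integral>x. g' x \<partial>lborel) = 0"
    by (simp add: LIMSEQ_const_iff)
  have S: "set_lebesgue_integral lborel A g' = 0" if "A \<in> sets lborel" for A
  proof -
    have A: "A \<in> sigma_sets UNIV (range (\<lambda>(a, b). box a b :: (real^'n) set))"
      using that by (simp add: borel_eq_box)
    have "Int_stable (range (\<lambda>(a, b). box a b :: (real^'n) set))"
      by (auto simp: Int_stable_def box_Int_box)
    from this subset_UNIV[of "range (\<lambda>(a, b). box a b :: (real^'n) set)", folded Pow_UNIV] A show ?thesis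
    proof (induction rule: sigma_sets_induct_disjoint)
      case (basic A)
      then show ?case using bx by (auto simp: set_lebesgue_integral_def)
    next
      case empty
      show ?case by (simp add: set_lebesgue_integral_def)
    next
      case (compl A)
      then have A: "A \<in> sets lborel" by (simp add: borel_eq_box)
      have "(\<integral>x. indicator (UNIV - A) x *\<^sub>R g' x \<partial>lborel) = (\<integral>x. g' x - indicator A x *\<^sub>R g' x \<partial>lborel)"
        by (intro Bochner_Integration.integral_cong) (auto simp: indicator_def)
      also have "\<dots> = 0"
        using compl A tot int by (subst Bochner_Integration.integral_diff)
          (auto simp: set_lebesgue_integral_def intro!: integrable_mult_indicator[of _ _ g', simplified])
      finally show ?case by (simp add: set_lebesgue_integral_def)
    next
      case (union A)
      then have A: "A i \<in> sets lborel" for i by (auto simp: borel_eq_box)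
      have "set_lebesgue_integral lborel (\<Union>i. A i) g' = (\<Sum>i. set_lebesgue_integral lborel (A i) g')"
        using A union(1) int
        by (intro lebesgue_integral_countable_add)
          (auto simp: disjoint_family_on_def set_integrable_def intro!: integrable_mult_indicator[of _ _ g', simplified])
      then show ?case using union by simp
    qed
  qed
  have [measurable]: "g' \<in> borel_measurable borel" using g'(1) by simp
  have "AE x in lborel. indicat_real {x. g' x > 0} x *\<^sub>R g' x = 0"
  proof (subst integral_nonneg_eq_0_iff_AE[symmetric])
    show "integrable lborel (\<lambda>x. indicat_real {x. g' x > 0} x *\<^sub>R g' x)"
      by (intro integrable_mult_indicator int) simp
  qed (use S[of "{x. g' x > 0}"] in \<open>auto simp: indicator_def set_lebesgue_integral_def\<close>)
  moreover have "AE x in lborel. - (indicat_real {x. g' x < 0} x *\<^sub>R g' x) = 0"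
  proof (subst integral_nonneg_eq_0_iff_AE[symmetric])
    show "integrable lborel (\<lambda>x. - (indicat_real {x. g' x < 0} x *\<^sub>R g' x))"
      by (intro integrable_minus integrable_mult_indicator int) simp
  qed (use S[of "{x. g' x < 0}"] in \<open>auto simp: indicator_def set_lebesgue_integral_def\<close>)
  ultimately have "AE x in lborel. g' x = 0"
    by eventually_elim (auto simp: indicator_def split: if_splits)
  with g'(2) have "AE x in lborel. g x = 0" by auto
  then show ?thesis by (rule AE_completion)
qed

lemma AE_UNIV_if_AE_cball:
  assumes "\<And>k::nat. AE x in lebesgue. x \<in> cball 0 (real k) \<longrightarrow> P x"
  shows "AE x in lebesgue. P (x::real^'n)"
proof -
  have "AE x in lebesgue. \<forall>k::nat. x \<in> cball 0 (real k) \<longrightarrow> P x"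
    unfolding AE_all_countable using assms by blast
  then show ?thesis
  proof eventually_elim
    case (elim x)
    have "x \<in> cball 0 (real (nat \<lceil>norm x\<rceil>))" by (simp add: real_nat_ceiling_ge)
    with elim show ?case by blast
  qed
qed

text \<open>Dominated convergence carries the hypothesis from bumps to indicators of boxes. As
  \<open>g\<close> is integrable only locally, the conclusion is drawn on one large box at a
  time.\<close>

lemma fundamental_lemma_variations:
  fixes g :: "real^'n \<Rightarrow> real"
  assumes g: "locally_integrable g" and z: "\<And>\<phi>. \<phi> \<in> test_functions \<Longrightarrow> (\<integral>x. g x * \<phi> x \<partial>lebesgue) = 0"
  shows "AE x in lebesgue. g x = 0"
proof (rule AE_UNIV_if_AE_cball)
  fix N :: nat
  \<comment> \<open>The margin 1 places the closed ball of radius \<open>N\<close> inside the open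
    box from \<open>-c\<close> to \<open>c\<close>.\<close>
  define c :: "real^'n" where "c = (\<chi> i. real N + 1)"
  have bx: "(\<integral>x. g x * indicator (box a b) x \<partial>lebesgue) = 0" for a b
  proof (rule LIMSEQ_unique)
    show "(\<lambda>k. \<integral>x. g x * bump (real k) a b x \<partial>lebesgue) \<longlonglongrightarrow> (\<integral>x. g x * indicator (box a b) x \<partial>lebesgue)"
    proof (rule integral_dominated_convergence[where w = "\<lambda>x. norm (indicator (cbox a b) x *\<^sub>R g x)"])
      show "integrable lebesgue (\<lambda>x. norm (indicator (cbox a b) x *\<^sub>R g x))"
        by (intro integrable_norm locally_integrableD g) auto
      show "(\<lambda>x. g x * bump (real k) a b x) \<in> borel_measurable lebesgue" for k
        by (intro borel_measurable_times locally_integrable_measurable g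
            continuous_measurable_lebesgue test_function_continuous bump_test_function) auto
      show "AE x in lebesgue. (\<lambda>k. g x * bump (real k) a b x) \<longlonglongrightarrow> g x * indicator (box a b) x"
        by (intro AE_I2 tendsto_mult bump_tendsto_indicator tendsto_const)
      show "AE x in lebesgue. norm (g x * bump (real k) a b x) \<le> norm (indicator (cbox a b) x *\<^sub>R g x)" for k
      proof (rule AE_I2)
        fix x show "norm (g x * bump (real k) a b x) \<le> norm (indicator (cbox a b) x *\<^sub>R g x)"
          using bump_bounds[of k a b x] bump_outside[of x a b k] box_subset_cbox[of a b]
          by (cases "x \<in> box a b") (auto simp: abs_mult subset_iff intro!: mult_left_le)
      qed
    qed (intro borel_measurable_times borel_measurable_indicator locally_integrable_measurable[OF g]; simp)
    show "(\<lambda>k. \<integral>x. g x * bump (real k) a b x \<partial>lebesgue) \<longlonglongrightarrow> 0"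
      by (simp add: z bump_test_function)
  qed
  have "AE x in lebesgue. indicator (box (-c) c) x * g x = 0"
  proof (rule AE_0_if_box_integrals_0)
    have "integrable lebesgue (\<lambda>x. indicator (box (-c) c) x *\<^sub>R (indicator (cbox (-c) c) x *\<^sub>R g x))"
      by (intro integrable_mult_indicator locally_integrableD g) auto
    moreover have "(\<lambda>x. indicator (box (-c) c) x *\<^sub>R (indicator (cbox (-c) c) x *\<^sub>R g x))
        = (\<lambda>x. indicator (box (-c) c) x * g x)"
      using box_subset_cbox[of "-c" c] by (fastforce simp: indicator_def)
    ultimately show "integrable lebesgue (\<lambda>x. indicator (box (-c) c) x * g x)"
      by simp
    fix a b
    obtain a' b' where ab: "box (-c) c \<inter> box a b = box a' b'" by (rule that[OF box_Int_box])
    show "(\<integral>x. indicator (box (-c) c) x * g x * indicator (box a b) x \<partial>lebesgue) = 0"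
      using bx[of a' b'] unfolding ab[symmetric] by (simp add: indicator_inter_arith ac_simps)
  qed
  then show "AE x in lebesgue. x \<in> cball 0 (real N) \<longrightarrow> g x = 0"
  proof eventually_elim
    case (elim x)
    have "x \<in> box (-c) c" if "norm x \<le> real N"
    proof -
      have "\<bar>x $ i\<bar> < real N + 1" for i
        using component_le_norm_cart[of x i] that by linarith
      then show ?thesis
        unfolding mem_box_cart c_def by (auto simp: abs_less_iff) (smt (verit))
    qed
    with elim show ?case by (auto simp: indicator_def split: if_splits)
  qed
qed

subsection \<open>Weak derivatives\<close>

lemma partial_outside:
  assumes "\<phi> \<in> test_functions" "x \<notin> closure {x. \<phi> x \<noteq> 0}"
  shows "partial j \<phi> x = 0"
proof -
  let ?U = "- closure {x. \<phi> x \<noteq> 0}"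
  have "(\<phi> has_derivative (\<lambda>_. 0)) (at x)"
  proof (rule has_derivative_transform_within_open)
    show "((\<lambda>_. 0) has_derivative (\<lambda>_. 0)) (at x)" by simp
    show "open ?U" "x \<in> ?U" using assms by auto
    show "0 = \<phi> y" if "y \<in> ?U" for y
      using that closure_subset[of "{x. \<phi> x \<noteq> 0}"] by auto
  qed
  then show ?thesis
    unfolding partial_def by (subst frechet_derivative_at[symmetric]) auto
qed

lemma test_function_support:
  assumes "\<phi> \<in> test_functions"
  obtains K where "compact K" "\<And>x. x \<notin> K \<Longrightarrow> \<phi> x = 0" "\<And>x j. x \<notin> K \<Longrightarrow> partial j \<phi> x = 0"
proof
  show "compact (closure {x. \<phi> x \<noteq> 0})"
    using assms by (simp add: test_functions_def)
  show "\<phi> x = 0" if "x \<notin> closure {x. \<phi> x \<noteq> 0}" for x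
    using that closure_subset[of "{x. \<phi> x \<noteq> 0}"] by auto
qed (rule partial_outside[OF assms])

lemma partial_continuous: "\<phi> \<in> test_functions \<Longrightarrow> continuous_on UNIV (partial j \<phi>)"
  by (auto simp: test_functions_def dest: spec[of _ "Suc 0"])

lemma integrable_mult_test:
  assumes "locally_integrable u" "\<phi> \<in> test_functions"
  shows "integrable lebesgue (\<lambda>x. u x * \<phi> x)" "integrable lebesgue (\<lambda>x. u x * partial j \<phi> x)"
proof -
  obtain K where K: "compact K" "\<And>x. x \<notin> K \<Longrightarrow> \<phi> x = 0" "\<And>x j. x \<notin> K \<Longrightarrow> partial j \<phi> x = 0"
    by (rule test_function_support[OF assms(2)]) blast
  then show "integrable lebesgue (\<lambda>x. u x * \<phi> x)" "integrable lebesgue (\<lambda>x. u x * partial j \<phi> x)"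
    using assms by (auto intro!: integrable_locally_integrable_mult test_function_continuous partial_continuous)
qed

lemma locally_integrable_diff:
  "locally_integrable f \<Longrightarrow> locally_integrable g \<Longrightarrow> locally_integrable (\<lambda>x. f x - g x)"
  by (auto simp: locally_integrable_def)

lemma locally_integrable_nth:
  fixes f :: "real^'n \<Rightarrow> real^'m"
  shows "locally_integrable f \<Longrightarrow> locally_integrable (\<lambda>x. f x $ i)"
  unfolding locally_integrable_def
  using absolutely_integrable_component[where f = f and b = "axis i 1"] by (simp add: inner_axis)

lemma locally_integrable_vec:
  fixes f :: "real^'n \<Rightarrow> real^'m"
  assumes "\<And>i. locally_integrable (\<lambda>x. f x $ i)"
  shows "locally_integrable f"
  unfolding locally_integrable_def
proof safe
  fix K :: "(real^'n) set" assume "compact K"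
  then show "f absolutely_integrable_on K"
    using assms by (subst absolutely_integrable_componentwise_iff)
      (auto simp: Basis_vec_def inner_axis locally_integrable_def)
qed

lemma locally_integrable_AE_cong:
  assumes "locally_integrable f" "AE x in lebesgue. f x = g x"
  shows "locally_integrable g"
proof (rule locally_integrableI)
  fix K :: "(real^'a) set" assume K: "compact K"
  then have Ks: "K \<in> sets lebesgue"
    by (simp add: borel_compact sets_completionI_sets)
  have "g \<in> borel_measurable lebesgue"
    using locally_integrable_measurable[OF assms(1)] assms(2) by (rule borel_measurable_AE)
  then have gm: "(\<lambda>x. indicator K x *\<^sub>R g x) \<in> borel_measurable lebesgue"
    using Ks by (intro borel_measurable_scaleR borel_measurable_indicator)
  show "integrable lebesgue (\<lambda>x. indicator K x *\<^sub>R g x)"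
    by (rule integrable_cong_AE_imp[OF locally_integrableD[OF assms(1) K] gm])
      (use assms(2) in \<open>auto elim: eventually_mono\<close>)
qed

lemma has_weak_partial_AE_cong:
  assumes "has_weak_partial j u g" "AE x in lebesgue. u x = u' x" "AE x in lebesgue. g x = g' x"
  shows "has_weak_partial j u' g'"
proof -
  have l: "locally_integrable u" "locally_integrable g" "locally_integrable u'" "locally_integrable g'"
    using assms locally_integrable_AE_cong by (auto simp: has_weak_partial_def)
  have "(\<integral>x. u' x * partial j \<phi> x \<partial>lebesgue) = - (\<integral>x. g' x * \<phi> x \<partial>lebesgue)" if \<phi>: "\<phi> \<in> test_functions" for \<phi>
  proof -
    have "(\<integral>x. u' x * partial j \<phi> x \<partial>lebesgue) = (\<integral>x. u x * partial j \<phi> x \<partial>lebesgue)"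
      using assms(2) by (intro integral_cong_AE borel_measurable_integrable integrable_mult_test \<phi> l)
        (auto elim: eventually_mono)
    also have "\<dots> = - (\<integral>x. g x * \<phi> x \<partial>lebesgue)"
      using assms(1) \<phi> by (simp add: has_weak_partial_def)
    also have "(\<integral>x. g x * \<phi> x \<partial>lebesgue) = (\<integral>x. g' x * \<phi> x \<partial>lebesgue)"
      using assms(3) by (intro integral_cong_AE borel_measurable_integrable integrable_mult_test \<phi> l)
        (auto elim: eventually_mono)
    finally show ?thesis .
  qed
  with l show ?thesis by (simp add: has_weak_partial_def)
qed

lemma has_weak_partial_diff:
  assumes "has_weak_partial j u g" "has_weak_partial j u' g'"
  shows "has_weak_partial j (\<lambda>x. u x - u' x) (\<lambda>x. g x - g' x)"
  using assms
  by (auto simp: has_weak_partial_def locally_integrable_diff left_diff_distrib integrable_mult_test)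

text \<open>The difference of two candidates is a weak derivative of 0, so it integrates to 0
  against every test function. This makes the choice in \<open>weak_partial\<close> harmless for the
  norms, which ignore null sets.\<close>

lemma has_weak_partial_unique:
  assumes "has_weak_partial j u g" "has_weak_partial j u g'"
  shows "AE x in lebesgue. g x = g' x"
proof -
  have "AE x in lebesgue. g x - g' x = 0"
    using has_weak_partial_diff[OF assms]
    by (intro fundamental_lemma_variations) (auto simp: has_weak_partial_def)
  then show ?thesis by simp
qed

section \<open>Translations of measurable functions and of weak derivatives\<close>

lemma translation_measurable: "(\<lambda>x. x + c) \<in> lebesgue \<rightarrow>\<^sub>M (lebesgue :: (real^'n) measure)"
  and distr_lebesgue_translation: "distr lebesgue lebesgue (\<lambda>x. x + c) = (lebesgue :: (real^'n) measure)"
proof -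
  have T: "(\<lambda>x. c + (\<Sum>j\<in>Basis. (1 * (x \<bullet> j)) *\<^sub>R j)) = (\<lambda>x. x + c)"
    by (simp add: euclidean_representation add.commute)
  show "(\<lambda>x. x + c) \<in> lebesgue \<rightarrow>\<^sub>M (lebesgue :: (real^'n) measure)"
    using lebesgue_affine_measurable[of "\<lambda>_. 1" c] unfolding T by simp
  show "distr lebesgue lebesgue (\<lambda>x. x + c) = (lebesgue :: (real^'n) measure)"
    using lebesgue_affine_euclidean[of "\<lambda>_. 1" c] unfolding T by (simp add: density_1)
qed

lemma AE_translation:
  assumes "AE x in lebesgue. P (x :: real^'n)"
  shows "AE x in lebesgue. P (x + c)"
proof -
  \<comment> \<open>\<open>AE_distr_iff\<close> requires a measurable predicate, hence the passage
    to a null set \<open>N\<close> of \<open>lebesgue\<close>.\<close>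
  obtain N where N: "{x. \<not> P x} \<subseteq> N" "N \<in> null_sets lebesgue"
    using assms by (auto elim!: AE_E simp: null_sets_def)
  have "AE x in lebesgue. x \<notin> N"
    by (rule AE_not_in[OF N(2)])
  then have "AE x in distr lebesgue lebesgue (\<lambda>x. x + c). x \<notin> N"
    by (simp only: distr_lebesgue_translation)
  then have "AE x in lebesgue. x + c \<notin> N"
    using sets.compl_sets[OF null_setsD2[OF N(2)]]
    by (subst (asm) AE_distr_iff[OF translation_measurable]) (auto simp: Collect_neg_eq Compl_eq_Diff_UNIV)
  then show ?thesis
    by eventually_elim (use N in auto)
qed

lemma measurable_translation_lebesgue:
  fixes f :: "real^'n \<Rightarrow> 'b"
  shows "f \<in> measurable lebesgue M \<Longrightarrow> (\<lambda>x. f (x + c)) \<in> measurable lebesgue M"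
  using measurable_comp[OF translation_measurable] by (simp add: comp_def)

lemma integral_translation:
  fixes f :: "real^'n \<Rightarrow> 'b::{banach, second_countable_topology}"
  assumes "f \<in> borel_measurable lebesgue"
  shows "(\<integral>x. f (x + c) \<partial>lebesgue) = (\<integral>x. f x \<partial>lebesgue)"
  using integral_distr[OF translation_measurable[of c] assms] by (simp add: distr_lebesgue_translation)

lemma nn_integral_translation:
  fixes f :: "real^'n \<Rightarrow> ennreal"
  assumes "f \<in> borel_measurable lebesgue"
  shows "(\<integral>\<^sup>+x. f (x + c) \<partial>lebesgue) = (\<integral>\<^sup>+x. f x \<partial>lebesgue)"
  using nn_integral_distr[OF translation_measurable[of c], of f] assms by (simp add: distr_lebesgue_translation)

lemma locally_integrable_translate:
  assumes "locally_integrable f"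
  shows "locally_integrable (translate y f)"
proof (rule locally_integrableI)
  fix K :: "(real^'a) set" assume K: "compact K"
  have c: "compact ((\<lambda>x. - y + x) ` K)"
    using K by (rule compact_translation)
  have "integrable (distr lebesgue lebesgue (\<lambda>x. x + - y)) (\<lambda>x. indicator ((\<lambda>x. - y + x) ` K) x *\<^sub>R f x)"
    using locally_integrableD[OF assms c] by (simp only: distr_lebesgue_translation)
  then have "integrable lebesgue (\<lambda>x. indicator ((\<lambda>x. - y + x) ` K) (x + - y) *\<^sub>R f (x + - y))"
    by (rule integrable_distr[OF translation_measurable])
  moreover have "indicator ((\<lambda>x. - y + x) ` K) (x + - y) = (indicator K x :: real)" for x
    by (auto simp: indicator_def)
  ultimately show "integrable lebesgue (\<lambda>x. indicator K x *\<^sub>R translate y f x)"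
    by (simp add: translate_def)
qed

lemma partial_shift:
  assumes "\<And>x. \<phi> differentiable at x"
  shows "partial j (\<lambda>x. \<phi> (x + y)) = (\<lambda>x. partial j \<phi> (x + y))"
    and "(\<lambda>x. \<phi> (x + y)) differentiable at x"
proof -
  have "((\<lambda>x. \<phi> (x + y)) has_derivative frechet_derivative \<phi> (at (x + y))) (at x)" for x
  proof -
    have "((\<lambda>x. x + y) has_derivative (\<lambda>h. h)) (at x)"
      by (auto intro!: derivative_eq_intros)
    from has_derivative_compose[OF this] assms[of "x + y"] show ?thesis
      by (simp add: frechet_derivative_works)
  qed
  note d = this
  show "partial j (\<lambda>x. \<phi> (x + y)) = (\<lambda>x. partial j \<phi> (x + y))"
    unfolding partial_def frechet_derivative_at[OF d, symmetric] ..
  show "(\<lambda>x. \<phi> (x + y)) differentiable at x"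
    using d by (auto simp: differentiable_def)
qed

lemma Ck_shift: "Ck k \<phi> \<Longrightarrow> Ck k (\<lambda>x. \<phi> (x + y))"
proof (induction k arbitrary: \<phi>)
  case 0
  then show ?case
    by (auto intro!: continuous_on_compose2[of UNIV \<phi>] continuous_intros)
next
  case (Suc k)
  then show ?case by (simp add: partial_shift)
qed

lemma test_function_shift:
  assumes "\<phi> \<in> test_functions"
  shows "(\<lambda>x. \<phi> (x + y)) \<in> test_functions"
proof -
  obtain K where K: "compact K" "\<And>x. x \<notin> K \<Longrightarrow> \<phi> x = 0"
    by (rule test_function_support[OF assms]) blast
  have "{x. \<phi> (x + y) \<noteq> 0} \<subseteq> (\<lambda>x. - y + x) ` K"
    using K(2) by (force intro: image_eqI[where x = "_ + y"])
  moreover have "bounded ((\<lambda>x. - y + x) ` K)"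
    using K(1) by (intro compact_imp_bounded compact_translation)
  ultimately show ?thesis
    using assms by (auto simp: test_functions_def Ck_shift intro: bounded_subset)
qed

text \<open>A change of variables moves the translation onto the test function; test functions are
  stable under shifts, and partial derivatives commute with them.\<close>

lemma has_weak_partial_translate:
  assumes "has_weak_partial j u g"
  shows "has_weak_partial j (translate y u) (translate y g)"
proof -
  have l: "locally_integrable u" "locally_integrable g"
    using assms by (auto simp: has_weak_partial_def)
  have "(\<integral>x. translate y u x * partial j \<phi> x \<partial>lebesgue) = - (\<integral>x. translate y g x * \<phi> x \<partial>lebesgue)"
    if \<phi>: "\<phi> \<in> test_functions" for \<phi>
  proof -
    have d: "\<phi> differentiable at x" for x
      using \<phi> by (auto simp: test_functions_def dest: spec[of _ "Suc 0"])
    note lt = locally_integrable_translate[OF l(1), of y] locally_integrable_translate[OF l(2), of y]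
    have "(\<integral>x. translate y u x * partial j \<phi> x \<partial>lebesgue)
        = (\<integral>x. translate y u (x + y) * partial j \<phi> (x + y) \<partial>lebesgue)"
      using integral_translation[OF borel_measurable_integrable[OF integrable_mult_test(2)[OF lt(1) \<phi>]]] by simp
    also have "\<dots> = (\<integral>x. u x * partial j (\<lambda>x. \<phi> (x + y)) x \<partial>lebesgue)"
      by (simp add: partial_shift d translate_def)
    also have "\<dots> = - (\<integral>x. g x * \<phi> (x + y) \<partial>lebesgue)"
      using assms test_function_shift[OF \<phi>] by (simp add: has_weak_partial_def)
    also have "(\<integral>x. g x * \<phi> (x + y) \<partial>lebesgue) = (\<integral>x. translate y g (x + y) * \<phi> (x + y) \<partial>lebesgue)"
      by (simp add: translate_def)
    also have "\<dots> = (\<integral>x. translate y g x * \<phi> x \<partial>lebesgue)"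
      using integral_translation[OF borel_measurable_integrable[OF integrable_mult_test(1)[OF lt(2) \<phi>]]] .
    finally show ?thesis .
  qed
  then show ?thesis
    using l by (simp add: has_weak_partial_def locally_integrable_translate)
qed

section \<open>Limits in the local L1 sense\<close>

definition L1loc_tendsto :: "(nat \<Rightarrow> real^'n \<Rightarrow> 'b::euclidean_space) \<Rightarrow> (real^'n \<Rightarrow> 'b) \<Rightarrow> bool" where
  "L1loc_tendsto fs f \<longleftrightarrow> (\<forall>K. compact K \<longrightarrow>
     (\<lambda>k. \<integral>\<^sup>+x. ennreal (norm (fs k x - f x)) * indicator K x \<partial>lebesgue) \<longlonglongrightarrow> 0)"

lemma L1loc_tendsto_integral:
  fixes u :: "real^'n \<Rightarrow> real"
  assumes "L1loc_tendsto us u" "\<And>k. locally_integrable (us k)" "locally_integrable u"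
    and \<psi>: "continuous_on UNIV \<psi>" "compact K" "\<And>x. x \<notin> K \<Longrightarrow> \<psi> x = 0"
  shows "(\<lambda>k. \<integral>x. us k x * \<psi> x \<partial>lebesgue) \<longlonglongrightarrow> (\<integral>x. u x * \<psi> x \<partial>lebesgue)"
proof (rule tendsto_L1_int)
  show "integrable lebesgue (\<lambda>x. us k x * \<psi> x)" "integrable lebesgue (\<lambda>x. u x * \<psi> x)" for k
    using assms integrable_locally_integrable_mult by blast+
  have "bounded (\<psi> ` K)"
    using \<psi> by (intro compact_imp_bounded compact_continuous_image) (auto intro: continuous_on_subset)
  then obtain B where B: "\<And>x. x \<in> K \<Longrightarrow> \<bar>\<psi> x\<bar> \<le> B" "B > 0"
    by (auto simp: bounded_pos)
  have Ks: "K \<in> sets lebesgue"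
    using \<psi>(2) by (simp add: borel_compact sets_completionI_sets)
  have m: "us k \<in> borel_measurable lebesgue" "u \<in> borel_measurable lebesgue" for k
    using assms locally_integrable_measurable by blast+
  have le: "(\<integral>\<^sup>+x. ennreal (norm (us k x * \<psi> x - u x * \<psi> x)) \<partial>lebesgue)
    \<le> ennreal B * (\<integral>\<^sup>+x. ennreal (norm (us k x - u x)) * indicator K x \<partial>lebesgue)" for k
  proof -
    have "(\<integral>\<^sup>+x. ennreal (norm (us k x * \<psi> x - u x * \<psi> x)) \<partial>lebesgue)
      \<le> (\<integral>\<^sup>+x. ennreal B * (ennreal (norm (us k x - u x)) * indicator K x) \<partial>lebesgue)"
    proof (rule nn_integral_mono)
      fix x
      have *: "us k x * \<psi> x - u x * \<psi> x = \<psi> x * (us k x - u x)" by (simp add: algebra_simps)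
      show "ennreal (norm (us k x * \<psi> x - u x * \<psi> x)) \<le> ennreal B * (ennreal (norm (us k x - u x)) * indicator K x)"
        using B \<psi>(3)[of x] unfolding *
        by (cases "x \<in> K") (auto simp: abs_mult ennreal_mult[symmetric] intro!: ennreal_leI mult_right_mono)
    qed
    also have "\<dots> = ennreal B * (\<integral>\<^sup>+x. ennreal (norm (us k x - u x)) * indicator K x \<partial>lebesgue)"
      using m Ks by (intro nn_integral_cmult borel_measurable_times_ennreal borel_measurable_indicator) auto
    finally show ?thesis .
  qed
  have "(\<lambda>k. ennreal B * (\<integral>\<^sup>+x. ennreal (norm (us k x - u x)) * indicator K x \<partial>lebesgue)) \<longlonglongrightarrow> ennreal B * 0"
    using assms(1) \<psi>(2) by (intro ennreal_tendsto_cmult) (auto simp: L1loc_tendsto_def)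
  then show "(\<lambda>k. \<integral>\<^sup>+x. ennreal (norm (us k x * \<psi> x - u x * \<psi> x)) \<partial>lebesgue) \<longlonglongrightarrow> 0"
    by (rule_tac tendsto_sandwich[OF _ _ tendsto_const]) (auto simp: le simp del: real_norm_def)
qed

text \<open>The defining identity pairs \<open>u\<close> and \<open>g\<close> with continuous
  functions of compact support, so both of its sides pass to the limit.\<close>

lemma has_weak_partial_limit:
  assumes "\<And>k. has_weak_partial j (us k) (gs k)" "L1loc_tendsto us u" "L1loc_tendsto gs g"
    "locally_integrable u" "locally_integrable g"
  shows "has_weak_partial j u g"
proof -
  have l: "locally_integrable (us k)" "locally_integrable (gs k)" for k
    using assms(1) by (auto simp: has_weak_partial_def)
  have "(\<integral>x. u x * partial j \<phi> x \<partial>lebesgue) = - (\<integral>x. g x * \<phi> x \<partial>lebesgue)"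
    if \<phi>: "\<phi> \<in> test_functions" for \<phi>
  proof (rule LIMSEQ_unique)
    obtain K where K: "compact K" "\<And>x. x \<notin> K \<Longrightarrow> \<phi> x = 0" "\<And>x j. x \<notin> K \<Longrightarrow> partial j \<phi> x = 0"
      by (rule test_function_support[OF \<phi>]) blast
    show "(\<lambda>k. \<integral>x. us k x * partial j \<phi> x \<partial>lebesgue) \<longlonglongrightarrow> (\<integral>x. u x * partial j \<phi> x \<partial>lebesgue)"
      by (rule L1loc_tendsto_integral[OF assms(2) l(1) assms(4) partial_continuous[OF \<phi>] K(1,3)])
    have "(\<lambda>k. - (\<integral>x. gs k x * \<phi> x \<partial>lebesgue)) \<longlonglongrightarrow> - (\<integral>x. g x * \<phi> x \<partial>lebesgue)"
      by (intro tendsto_minus L1loc_tendsto_integral[OF assms(3) l(2) assms(5) test_function_continuous[OF \<phi>] K(1,2)])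
    then show "(\<lambda>k. \<integral>x. us k x * partial j \<phi> x \<partial>lebesgue) \<longlonglongrightarrow> - (\<integral>x. g x * \<phi> x \<partial>lebesgue)"
      using assms(1) \<phi> by (simp add: has_weak_partial_def)
  qed
  with assms show ?thesis by (simp add: has_weak_partial_def)
qed

lemma L1loc_tendsto_nth:
  fixes fs :: "nat \<Rightarrow> real^'n \<Rightarrow> real^'m"
  assumes "L1loc_tendsto fs f"
  shows "L1loc_tendsto (\<lambda>k x. fs k x $ i) (\<lambda>x. f x $ i)"
  unfolding L1loc_tendsto_def
proof safe
  fix K :: "(real^'n) set" assume "compact K"
  then have "(\<lambda>k. \<integral>\<^sup>+x. ennreal (norm (fs k x - f x)) * indicator K x \<partial>lebesgue) \<longlonglongrightarrow> 0"
    using assms by (simp add: L1loc_tendsto_def)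
  moreover have "(\<integral>\<^sup>+x. ennreal (norm (fs k x $ i - f x $ i)) * indicator K x \<partial>lebesgue)
     \<le> (\<integral>\<^sup>+x. ennreal (norm (fs k x - f x)) * indicator K x \<partial>lebesgue)" for k
    using component_le_norm_cart[of "fs k _ - f _" i]
    by (intro nn_integral_mono mult_right_mono ennreal_leI) auto
  ultimately show "(\<lambda>k. \<integral>\<^sup>+x. ennreal (norm (fs k x $ i - f x $ i)) * indicator K x \<partial>lebesgue) \<longlonglongrightarrow> 0"
    by (rule_tac tendsto_sandwich[OF _ _ tendsto_const]) auto
qed

text \<open>A relation beside the chosen function \<open>weak_partial\<close>: for differences,
  translates and limits it suffices to exhibit some weak derivative, and
  \<open>weak_partial_AE_eq\<close> leads back to the chosen one.\<close>

definition has_weak_partial_vec :: "'n \<Rightarrow> (real^'n \<Rightarrow> real^'m) \<Rightarrow> (real^'n \<Rightarrow> real^'m) \<Rightarrow> bool" where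
  "has_weak_partial_vec j f g \<longleftrightarrow> (\<forall>i. has_weak_partial j (\<lambda>x. f x $ i) (\<lambda>x. g x $ i))"

lemma has_weak_partial_vec_locally_integrable:
  "has_weak_partial_vec j f g \<Longrightarrow> locally_integrable f \<and> locally_integrable g"
  by (auto simp: has_weak_partial_vec_def has_weak_partial_def intro!: locally_integrable_vec)

lemma weak_partial_works:
  assumes "has_weak_partial_vec j f g"
  shows "has_weak_partial_vec j f (weak_partial j f)"
  unfolding has_weak_partial_vec_def weak_partial_def
proof
  fix i
  show "has_weak_partial j (\<lambda>x. f x $ i) (\<lambda>x. (\<chi> i. (SOME g. has_weak_partial j (\<lambda>x. f x $ i) g) x) $ i)"
    using someI[of "has_weak_partial j (\<lambda>x. f x $ i)", OF assms[unfolded has_weak_partial_vec_def, rule_format]]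
    by (simp only: vec_lambda_beta)
qed

lemma weak_partial_AE_eq:
  assumes "has_weak_partial_vec j f g"
  shows "AE x in lebesgue. weak_partial j f x = g x"
proof -
  have "AE x in lebesgue. \<forall>i. weak_partial j f x $ i = g x $ i"
    using weak_partial_works[OF assms] assms unfolding has_weak_partial_vec_def
    by (intro AE_all_countable[THEN iffD2] allI has_weak_partial_unique[of j "\<lambda>x. f x $ _"]) auto
  then show ?thesis by eventually_elim (simp add: vec_eq_iff)
qed

lemma W11_locI:
  assumes "locally_integrable f" "\<And>j. has_weak_partial_vec j f (g j)"
  shows "f \<in> W11_loc"
  using assms by (auto simp: W11_loc_def has_weak_partial_vec_def)

lemma W11_locD:
  assumes "f \<in> W11_loc"
  shows "locally_integrable f" "has_weak_partial_vec j f (weak_partial j f)"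
    "locally_integrable (weak_partial j f)"
proof -
  show "locally_integrable f"
    using assms by (simp add: W11_loc_def)
  have "\<exists>g. \<forall>i. has_weak_partial j (\<lambda>x. f x $ i) (g i)"
    using assms unfolding W11_loc_def by (intro choice) blast
  then obtain g where "\<And>i. has_weak_partial j (\<lambda>x. f x $ i) (g i)" by blast
  then have "has_weak_partial_vec j f (\<lambda>x. \<chi> i. g i x)"
    by (simp add: has_weak_partial_vec_def)
  then show v: "has_weak_partial_vec j f (weak_partial j f)"
    by (rule weak_partial_works)
  show "locally_integrable (weak_partial j f)"
    using has_weak_partial_vec_locally_integrable[OF v] ..
qed

lemma has_weak_partial_vec_diff:
  "has_weak_partial_vec j f g \<Longrightarrow> has_weak_partial_vec j f' g' \<Longrightarrow>
    has_weak_partial_vec j (\<lambda>x. f x - f' x) (\<lambda>x. g x - g' x)"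
  by (simp add: has_weak_partial_vec_def has_weak_partial_diff)

lemma has_weak_partial_vec_translate:
  "has_weak_partial_vec j f g \<Longrightarrow> has_weak_partial_vec j (translate y f) (translate y g)"
  unfolding has_weak_partial_vec_def
proof
  fix i assume "\<forall>i. has_weak_partial j (\<lambda>x. f x $ i) (\<lambda>x. g x $ i)"
  then have "has_weak_partial j (translate y (\<lambda>x. f x $ i)) (translate y (\<lambda>x. g x $ i))"
    by (intro has_weak_partial_translate) simp
  then show "has_weak_partial j (\<lambda>x. translate y f x $ i) (\<lambda>x. translate y g x $ i)"
    by (simp add: translate_def[abs_def])
qed

lemma has_weak_partial_vec_limit:
  assumes "\<And>k. has_weak_partial_vec j (fs k) (gs k)" "L1loc_tendsto fs f" "L1loc_tendsto gs g"
    "locally_integrable f" "locally_integrable g"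
  shows "has_weak_partial_vec j f g"
  unfolding has_weak_partial_vec_def
proof
  fix i
  show "has_weak_partial j (\<lambda>x. f x $ i) (\<lambda>x. g x $ i)"
    using assms(1) by (intro has_weak_partial_limit[OF _ L1loc_tendsto_nth[OF assms(2)] L1loc_tendsto_nth[OF assms(3)]]
        locally_integrable_nth assms(4,5)) (simp add: has_weak_partial_vec_def)
qed

subsection \<open>Variable exponent norms\<close>

text \<open>Fatou, Jensen and Tonelli act on this integral, not on the norm; \<open>rnorm_le\<close>
  and \<open>modular_le_1\<close> translate between norm bounds and modulars of at most 1.\<close>

definition modular :: "(real^'n \<Rightarrow> real) \<Rightarrow> (real^'n \<Rightarrow> real) \<Rightarrow> ennreal" where
  "modular p u = (\<integral>\<^sup>+x. ennreal (\<bar>u x\<bar> powr p x) \<partial>lebesgue)"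

abbreviation rnorm :: "(real^'n \<Rightarrow> real) \<Rightarrow> (real^'n \<Rightarrow> real) \<Rightarrow> ennreal" where
  "rnorm p u \<equiv> lux_norm p (\<lambda>x. ennreal \<bar>u x\<bar>)"

lemma exponents_AE_gt_1:
  assumes "p \<in> exponents"
  shows "AE x in lebesgue. 1 < p x"
proof -
  have less: "esssup lebesgue (\<lambda>x. - ereal (p x)) < - 1"
    using assms by (simp add: exponents_def essinf_def ereal_less_uminus_reorder)
  have "AE x in lebesgue. - ereal (p x) \<le> esssup lebesgue (\<lambda>x. - ereal (p x))"
    by (rule esssup_AE)
  then show ?thesis
  proof (elim eventually_mono)
    fix x assume "- ereal (p x) \<le> esssup lebesgue (\<lambda>x. - ereal (p x))"
    then have "- ereal (p x) < - 1"
      using less by (rule le_less_trans)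
    then show "1 < p x" by (simp add: one_ereal_def)
  qed
qed

lemma exponents_measurable [measurable_dest]: "p \<in> exponents \<Longrightarrow> p \<in> borel_measurable lebesgue"
  by (simp add: exponents_def)

lemma epowr_ennreal_div:
  assumes "0 < l"
  shows "epowr (ennreal \<bar>u\<bar> / ennreal l) a = ennreal (\<bar>u / l\<bar> powr a)"
  using assms by (simp add: epowr_def divide_ennreal)

lemma epowr_mono:
  assumes "s \<le> t" "0 \<le> a"
  shows "epowr s a \<le> epowr t a"
proof (cases "t = \<infinity>")
  case False
  then have "s \<noteq> \<infinity>" "enn2real s \<le> enn2real t"
    using assms by (auto simp: top_unique enn2real_mono less_top)
  with False show ?thesis
    using assms by (auto simp: epowr_def intro!: ennreal_leI powr_mono2)
qed (simp add: epowr_def)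

lemma lux_norm_le:
  "0 < l \<Longrightarrow> (\<integral>\<^sup>+x. epowr (g x / ennreal l) (p x) \<partial>lebesgue) \<le> 1 \<Longrightarrow> lux_norm p g \<le> ennreal l"
  unfolding lux_norm_def by (rule Inf_lower) auto

text \<open>The infimum is not assumed to be attained: strictness provides an admissible
  \<open>k\<close> below \<open>l\<close>, and enlarging the scale only decreases the
  integrand.\<close>

lemma lux_norm_less_imp:
  assumes "AE x in lebesgue. 0 \<le> p x" "lux_norm p g < ennreal l"
  shows "(\<integral>\<^sup>+x. epowr (g x / ennreal l) (p x) \<partial>lebesgue) \<le> 1"
proof -
  obtain k where k: "0 < k" "(\<integral>\<^sup>+x. epowr (g x / ennreal k) (p x) \<partial>lebesgue) \<le> 1" "ennreal k < ennreal l"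
    using assms(2) unfolding lux_norm_def Inf_less_iff by auto
  have "(\<integral>\<^sup>+x. epowr (g x / ennreal l) (p x) \<partial>lebesgue) \<le> (\<integral>\<^sup>+x. epowr (g x / ennreal k) (p x) \<partial>lebesgue)"
  proof (rule nn_integral_mono_AE)
    show "AE x in lebesgue. epowr (g x / ennreal l) (p x) \<le> epowr (g x / ennreal k) (p x)"
      using assms(1)
    proof eventually_elim
      case (elim x)
      have "g x / ennreal l \<le> g x / ennreal k"
        using k by (auto simp: divide_ennreal_def inverse_ennreal ennreal_less_iff intro!: mult_left_mono ennreal_leI)
      with elim show ?case by (intro epowr_mono)
    qed
  qed
  with k show ?thesis by simp
qed

lemma rnorm_le: "0 < l \<Longrightarrow> modular p (\<lambda>x. u x / l) \<le> 1 \<Longrightarrow> rnorm p u \<le> ennreal l"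
  by (rule lux_norm_le) (auto simp: epowr_ennreal_div modular_def)

lemma modular_le_1:
  assumes "AE x in lebesgue. 0 \<le> p x" "rnorm p u < ennreal l"
  shows "modular p (\<lambda>x. u x / l) \<le> 1"
proof -
  have "0 < l"
    using assms(2) by (metis ennreal_neg le_less_linear not_less_zero)
  with lux_norm_less_imp[OF assms] show ?thesis
    by (simp add: epowr_ennreal_div modular_def)
qed

lemma modular_mono_AE:
  assumes "AE x in lebesgue. 0 \<le> p x" "AE x in lebesgue. \<bar>u x\<bar> \<le> \<bar>v x\<bar>"
  shows "modular p u \<le> modular p v"
  unfolding modular_def
proof (rule nn_integral_mono_AE)
  show "AE x in lebesgue. ennreal (\<bar>u x\<bar> powr p x) \<le> ennreal (\<bar>v x\<bar> powr p x)"
    using assms by eventually_elim (auto intro!: ennreal_leI powr_mono2)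
qed

lemma lux_norm_mono_AE:
  assumes "AE x in lebesgue. 0 \<le> p x" "AE x in lebesgue. g x \<le> h x"
  shows "lux_norm p g \<le> lux_norm p h"
  unfolding lux_norm_def
proof (rule Inf_mono, clarsimp)
  fix l :: real
  assume l: "0 < l" "(\<integral>\<^sup>+x. epowr (h x / ennreal l) (p x) \<partial>lebesgue) \<le> 1"
  have "(\<integral>\<^sup>+x. epowr (g x / ennreal l) (p x) \<partial>lebesgue) \<le> (\<integral>\<^sup>+x. epowr (h x / ennreal l) (p x) \<partial>lebesgue)"
  proof (rule nn_integral_mono_AE)
    show "AE x in lebesgue. epowr (g x / ennreal l) (p x) \<le> epowr (h x / ennreal l) (p x)"
      using assms by eventually_elim (auto intro!: epowr_mono divide_right_mono_ennreal)
  qed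
  with l have "(\<integral>\<^sup>+x. epowr (g x / ennreal l) (p x) \<partial>lebesgue) \<le> 1" by simp
  with l show "\<exists>a. (\<exists>la. a = ennreal la \<and> 0 < la \<and> (\<integral>\<^sup>+x. epowr (g x / ennreal la) (p x) \<partial>lebesgue) \<le> 1) \<and> a \<le> ennreal l"
    by blast
qed

text \<open>The tangent of the convex function t^q at \<open>b\<close>, obtained from Young's
  inequality for \<open>a / b\<close> and 1. Both the convexity of the modular and Jensen's
  inequality are derived from it.\<close>

lemma powr_tangent:
  fixes a b q :: real
  assumes "0 \<le> a" "0 < b" "1 < q"
  shows "q * b powr (q - 1) * a \<le> a powr q + (q - 1) * b powr q"
proof -
  define r where "r = q / (q - 1)"
  have r: "r > 1" "1 / q + 1 / r = 1"
    using assms by (auto simp: r_def field_simps)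
  have "a / b * 1 \<le> (a / b) powr q / q + 1 powr r / r"
    using assms r by (intro Youngs_inequality) auto
  then have "q * (a / b) \<le> q * ((a / b) powr q / q + (q - 1) / q)"
    using assms by (intro mult_left_mono) (auto simp: r_def)
  also have "\<dots> = (a / b) powr q + (q - 1)"
    using assms by (simp add: distrib_left)
  finally have "q * (a / b) \<le> (a / b) powr q + (q - 1)" .
  then have "b powr q * (q * (a / b)) \<le> b powr q * ((a / b) powr q + (q - 1))"
    by (rule mult_left_mono) simp
  also have "\<dots> = a powr q + (q - 1) * b powr q"
    using assms by (simp add: powr_divide algebra_simps)
  also have "b powr q * (q * (a / b)) = q * b powr (q - 1) * a"
    using assms by (simp add: powr_diff)
  finally show ?thesis .
qed

text \<open>The tangent is taken at the combination itself; averaging the two tangent inequalities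
  turns the left side into q times the power of the combination, from which the remainder q - 1 is
  subtracted.\<close>

lemma powr_convex_combination:
  fixes a b t q :: real
  assumes "0 \<le> a" "0 \<le> b" "0 \<le> t" "t \<le> 1" "1 < q"
  shows "(t * a + (1 - t) * b) powr q \<le> t * a powr q + (1 - t) * b powr q"
proof (cases "t * a + (1 - t) * b = 0")
  case True
  with assms show ?thesis by simp
next
  case False
  define c where "c = t * a + (1 - t) * b"
  have c: "0 < c" using False assms unfolding c_def by (smt (verit) mult_nonneg_nonneg)
  have "q * c powr (q - 1) * c = t * (q * c powr (q - 1) * a) + (1 - t) * (q * c powr (q - 1) * b)"
    by (simp add: c_def algebra_simps)
  also have "\<dots> \<le> t * (a powr q + (q - 1) * c powr q) + (1 - t) * (b powr q + (q - 1) * c powr q)"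
    using assms c by (intro add_mono mult_left_mono powr_tangent) auto
  also have "\<dots> = t * a powr q + (1 - t) * b powr q + (q - 1) * c powr q"
    by (simp add: algebra_simps)
  also have "q * c powr (q - 1) * c = q * c powr q"
    using c by (simp add: powr_diff)
  finally show ?thesis unfolding c_def[symmetric] by (simp add: algebra_simps)
qed

lemma modular_measurable:
  assumes "p \<in> borel_measurable lebesgue" "u \<in> borel_measurable lebesgue"
  shows "(\<lambda>x. ennreal (\<bar>u x\<bar> powr p x)) \<in> borel_measurable lebesgue"
  using assms by measurable

lemma modular_convex:
  assumes [measurable]: "p \<in> borel_measurable lebesgue" "u \<in> borel_measurable lebesgue" "v \<in> borel_measurable lebesgue"
    and p: "AE x in lebesgue. 1 < p x" and t: "0 \<le> t" "t \<le> 1"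
  shows "modular p (\<lambda>x. t * u x + (1 - t) * v x) \<le> ennreal t * modular p u + ennreal (1 - t) * modular p v"
proof -
  have "modular p (\<lambda>x. t * u x + (1 - t) * v x)
    \<le> (\<integral>\<^sup>+x. ennreal t * ennreal (\<bar>u x\<bar> powr p x) + ennreal (1 - t) * ennreal (\<bar>v x\<bar> powr p x) \<partial>lebesgue)"
    unfolding modular_def
  proof (rule nn_integral_mono_AE)
    show "AE x in lebesgue. ennreal (\<bar>t * u x + (1 - t) * v x\<bar> powr p x)
      \<le> ennreal t * ennreal (\<bar>u x\<bar> powr p x) + ennreal (1 - t) * ennreal (\<bar>v x\<bar> powr p x)"
      using p
    proof eventually_elim
      case (elim x)
      have "\<bar>t * u x + (1 - t) * v x\<bar> powr p x \<le> (t * \<bar>u x\<bar> + (1 - t) * \<bar>v x\<bar>) powr p x"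
        using t elim by (intro powr_mono2) (auto simp: abs_mult intro!: order_trans[OF abs_triangle_ineq])
      also have "\<dots> \<le> t * \<bar>u x\<bar> powr p x + (1 - t) * \<bar>v x\<bar> powr p x"
        using t elim by (intro powr_convex_combination) auto
      finally show ?case
        using t by (simp add: ennreal_mult[symmetric] ennreal_plus[symmetric] del: ennreal_plus)
    qed
  qed
  also have "\<dots> = ennreal t * modular p u + ennreal (1 - t) * modular p v"
    unfolding modular_def by (subst nn_integral_add) (auto simp: nn_integral_cmult)
  finally show ?thesis .
qed

text \<open>At scale \<open>l + k\<close> the sum is the convex combination of \<open>u / l\<close>
  and \<open>v / k\<close> with weight \<open>l / (l + k)\<close>, and both of these have modular at
  most 1. The slack \<open>e\<close> makes the scales strictly larger than the norms.\<close>

lemma rnorm_add: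
  assumes m: "p \<in> borel_measurable lebesgue" "u \<in> borel_measurable lebesgue" "v \<in> borel_measurable lebesgue"
    and p: "AE x in lebesgue. 1 < p x"
  shows "rnorm p (\<lambda>x. u x + v x) \<le> rnorm p u + rnorm p v"
proof (rule ennreal_le_epsilon)
  fix e :: real assume fin: "rnorm p u + rnorm p v < top" and e: "0 < e"
  obtain a b where ab: "rnorm p u = ennreal a" "0 \<le> a" "rnorm p v = ennreal b" "0 \<le> b"
    using fin by (metis ennreal_add_eq_top ennreal_cases less_irrefl)
  define l k where "l = a + e / 2" and "k = b + e / 2"
  have lk: "0 < l" "0 < k" using ab e by (auto simp: l_def k_def)
  have p0: "AE x in lebesgue. 0 \<le> p x" using p by (auto elim: eventually_mono)
  have "modular p (\<lambda>x. u x / l) \<le> 1" "modular p (\<lambda>x. v x / k) \<le> 1"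
    using ab e by (auto intro!: modular_le_1 p0 ennreal_lessI simp: l_def k_def)
  moreover have "modular p (\<lambda>x. l / (l + k) * (u x / l) + (1 - l / (l + k)) * (v x / k))
      \<le> ennreal (l / (l + k)) * modular p (\<lambda>x. u x / l) + ennreal (1 - l / (l + k)) * modular p (\<lambda>x. v x / k)"
    using m lk by (intro modular_convex p) (auto simp: field_simps)
  ultimately have "modular p (\<lambda>x. l / (l + k) * (u x / l) + (1 - l / (l + k)) * (v x / k))
     \<le> ennreal (l / (l + k)) * 1 + ennreal (1 - l / (l + k)) * 1"
    by (meson add_mono mult_left_mono order_trans zero_le)
  also have "\<dots> = 1"
  proof -
    have "0 \<le> l / (l + k)" "0 \<le> 1 - l / (l + k)" using lk by auto
    then have "ennreal (l / (l + k)) + ennreal (1 - l / (l + k)) = ennreal (l / (l + k) + (1 - l / (l + k)))"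
      by (rule ennreal_plus[symmetric])
    then show ?thesis by simp
  qed
  also have "(\<lambda>x. l / (l + k) * (u x / l) + (1 - l / (l + k)) * (v x / k)) = (\<lambda>x. (u x + v x) / (l + k))"
  proof
    fix x
    have "1 - l / (l + k) = k / (l + k)" using lk by (simp add: field_simps)
    then show "l / (l + k) * (u x / l) + (1 - l / (l + k)) * (v x / k) = (u x + v x) / (l + k)"
      using lk by (simp add: add_divide_distrib)
  qed
  finally have "rnorm p (\<lambda>x. u x + v x) \<le> ennreal (l + k)"
    using lk by (intro rnorm_le) auto
  also have "ennreal (l + k) = rnorm p u + rnorm p v + ennreal e"
    using ab e by (simp add: l_def k_def ennreal_plus[symmetric] del: ennreal_plus)
  finally show "rnorm p (\<lambda>x. u x + v x) \<le> rnorm p u + rnorm p v + ennreal e" .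
qed

lemma rnorm_cmult_le:
  assumes p: "AE x in lebesgue. 0 \<le> p x" and c: "0 < c"
  shows "rnorm p (\<lambda>x. c * u x) \<le> ennreal c * rnorm p u"
proof (rule ennreal_le_epsilon)
  fix e :: real assume fin: "ennreal c * rnorm p u < top" and e: "0 < e"
  have "rnorm p u < top"
    using fin c by (auto simp: ennreal_mult_less_top)
  then obtain a where a: "rnorm p u = ennreal a" "0 \<le> a"
    by (metis ennreal_cases less_irrefl)
  define l where "l = a + e / c"
  have l: "0 < l" "rnorm p u < ennreal l" using a e c by (auto simp: l_def intro!: ennreal_lessI add_nonneg_pos)
  have "modular p (\<lambda>x. u x / l) \<le> 1"
    using l by (intro modular_le_1 p)
  then have "rnorm p (\<lambda>x. c * u x) \<le> ennreal (c * l)"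
    using c l by (intro rnorm_le) auto
  also have "\<dots> = ennreal c * rnorm p u + ennreal e"
    using a c e by (simp add: l_def ennreal_plus[symmetric] ennreal_mult[symmetric] algebra_simps del: ennreal_plus)
  finally show "rnorm p (\<lambda>x. c * u x) \<le> ennreal c * rnorm p u + ennreal e" .
qed

lemma rnorm_cmult_le_obtain:
  assumes p: "AE x in lebesgue. 0 \<le> p x" and "rnorm p u < top" "0 < e"
  obtains c where "0 < c" "rnorm p (\<lambda>x. c * u x) \<le> ennreal e"
proof -
  obtain a where a: "rnorm p u = ennreal a" "0 \<le> a"
    using assms(2) by (metis ennreal_cases less_irrefl)
  \<comment> \<open>The summand 1 keeps the quotient meaningful when the norm \<open>a\<close> is
    0.\<close>
  have "rnorm p (\<lambda>x. e / (a + 1) * u x) \<le> ennreal (e / (a + 1)) * rnorm p u"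
    using assms a by (intro rnorm_cmult_le p) auto
  also have "\<dots> = ennreal (e / (a + 1) * a)"
    using a assms by (simp add: ennreal_mult[symmetric])
  also have "\<dots> \<le> ennreal e"
    using a assms by (intro ennreal_leI) (simp add: field_simps)
  finally show ?thesis using a assms by (intro that[of "e / (a + 1)"]) auto
qed

lemma modular_Fatou:
  assumes m: "p \<in> borel_measurable lebesgue" "\<And>k. us k \<in> borel_measurable lebesgue"
    and p: "AE x in lebesgue. 0 < p x" and lim: "AE x in lebesgue. (\<lambda>k. us k x) \<longlonglongrightarrow> u x"
    and le: "\<And>k. N \<le> k \<Longrightarrow> modular p (us k) \<le> 1"
  shows "modular p u \<le> 1"
proof -
  have "modular p u = (\<integral>\<^sup>+x. liminf (\<lambda>k. ennreal (\<bar>us k x\<bar> powr p x)) \<partial>lebesgue)"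
    unfolding modular_def
  proof (rule nn_integral_cong_AE)
    show "AE x in lebesgue. ennreal (\<bar>u x\<bar> powr p x) = liminf (\<lambda>k. ennreal (\<bar>us k x\<bar> powr p x))"
      using p lim
    proof eventually_elim
      case (elim x)
      \<comment> \<open>Where the limit is 0, continuity of \<open>powr\<close> in the base comes
        from the positive exponent.\<close>
      have "(\<lambda>k. ennreal (\<bar>us k x\<bar> powr p x)) \<longlonglongrightarrow> ennreal (\<bar>u x\<bar> powr p x)"
        using elim by (intro tendsto_ennrealI tendsto_powr' tendsto_rabs tendsto_const) auto
      then show ?case
        using lim_imp_Liminf[OF trivial_limit_sequentially] by metis
    qed
  qed
  also have "\<dots> \<le> liminf (\<lambda>k. \<integral>\<^sup>+x. ennreal (\<bar>us k x\<bar> powr p x) \<partial>lebesgue)"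
    using m by (intro nn_integral_liminf modular_measurable)
  also have "\<dots> = liminf (\<lambda>k. modular p (us k))"
    by (simp add: modular_def)
  also have "\<dots> \<le> liminf (\<lambda>k. 1)"
    by (rule Liminf_mono) (use le in \<open>auto simp: eventually_sequentially\<close>)
  also have "\<dots> = 1" by (simp add: Liminf_const)
  finally show ?thesis .
qed

text \<open>Young's inequality with both coefficients equal to 1: if b \<le> a^(q-1), the product is
  at most the first term, otherwise at most the second. Two modulars of at most 1 then add up to the
  constant 2 in \<open>modular_Hoelder\<close>.\<close>

lemma mult_le_powr_add_powr_conj:
  fixes a b q :: real
  assumes "0 \<le> a" "0 \<le> b" "1 < q"
  shows "a * b \<le> a powr q + b powr (q / (q - 1))"
proof (cases "a = 0 \<or> b = 0")
  case False
  then have ab: "0 < a" "0 < b" using assms by auto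
  show ?thesis
  proof (cases "b \<le> a powr (q - 1)")
    case True
    then have "a * b \<le> a * a powr (q - 1)" using ab by simp
    also have "\<dots> = a powr q" using ab by (simp add: powr_diff)
    finally show ?thesis by (simp add: add_increasing2)
  next
    case False
    then have "(a powr (q - 1)) powr (1 / (q - 1)) \<le> b powr (1 / (q - 1))"
      using assms by (intro powr_mono2) auto
    then have "a \<le> b powr (1 / (q - 1))"
      using assms ab by (simp add: powr_powr)
    then have "a * b \<le> b powr (1 / (q - 1)) * b powr 1" using ab by simp
    also have "\<dots> = b powr (q / (q - 1))"
      using assms by (subst powr_add[symmetric]) (simp add: field_simps)
    finally show ?thesis by (simp add: add_increasing)
  qed
qed auto

lemma conj_exponent_measurable:
  "p \<in> borel_measurable M \<Longrightarrow> conj_exponent p \<in> borel_measurable M"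
  unfolding conj_exponent_def[abs_def]
  by (intro borel_measurable_divide borel_measurable_diff borel_measurable_const)

lemma conj_exponent_nonneg:
  "AE x in M. 1 < p x \<Longrightarrow> AE x in M. 0 \<le> conj_exponent p x"
  by (auto simp: conj_exponent_def elim!: eventually_mono)

lemma modular_Hoelder:
  assumes m: "p \<in> borel_measurable lebesgue" "u \<in> borel_measurable lebesgue" "v \<in> borel_measurable lebesgue"
    and p: "AE x in lebesgue. 1 < p x"
    and le: "modular p u \<le> 1" "modular (conj_exponent p) v \<le> 1"
  shows "(\<integral>\<^sup>+x. ennreal (\<bar>u x\<bar> * \<bar>v x\<bar>) \<partial>lebesgue) \<le> 2"
proof -
  have "(\<integral>\<^sup>+x. ennreal (\<bar>u x\<bar> * \<bar>v x\<bar>) \<partial>lebesgue)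
    \<le> (\<integral>\<^sup>+x. ennreal (\<bar>u x\<bar> powr p x) + ennreal (\<bar>v x\<bar> powr conj_exponent p x) \<partial>lebesgue)"
  proof (rule nn_integral_mono_AE)
    show "AE x in lebesgue. ennreal (\<bar>u x\<bar> * \<bar>v x\<bar>)
      \<le> ennreal (\<bar>u x\<bar> powr p x) + ennreal (\<bar>v x\<bar> powr conj_exponent p x)"
      using p
      by eventually_elim (auto simp: conj_exponent_def ennreal_plus[symmetric] simp del: ennreal_plus
          intro!: ennreal_leI mult_le_powr_add_powr_conj)
  qed
  also have "\<dots> = modular p u + modular (conj_exponent p) v"
    unfolding modular_def using m conj_exponent_measurable
    by (intro nn_integral_add modular_measurable) auto
  also have "\<dots> \<le> 1 + 1"
    using le by (rule add_mono)
  finally show ?thesis by simp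
qed

text \<open>For a divisor c \<ge> 1 and an exponent above 1 the power c^p(x) is at least
  \<open>c\<close>.\<close>

lemma modular_scale:
  assumes [measurable]: "p \<in> borel_measurable lebesgue" "u \<in> borel_measurable lebesgue"
    and p: "AE x in lebesgue. 1 < p x" and c: "1 \<le> c"
  shows "modular p (\<lambda>x. u x / c) \<le> ennreal (1 / c) * modular p u"
proof -
  have "modular p (\<lambda>x. u x / c) \<le> (\<integral>\<^sup>+x. ennreal (1 / c) * ennreal (\<bar>u x\<bar> powr p x) \<partial>lebesgue)"
    unfolding modular_def
  proof (rule nn_integral_mono_AE)
    show "AE x in lebesgue. ennreal (\<bar>u x / c\<bar> powr p x) \<le> ennreal (1 / c) * ennreal (\<bar>u x\<bar> powr p x)"
      using p
    proof eventually_elim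
      case (elim x)
      have "c powr 1 \<le> c powr p x" using c elim by (intro powr_mono) auto
      then have "\<bar>u x\<bar> powr p x / c powr p x \<le> \<bar>u x\<bar> powr p x / c"
        using c by (intro divide_left_mono) auto
      then show ?case
        using c by (auto simp: ennreal_mult[symmetric] abs_div powr_divide intro!: ennreal_leI)
    qed
  qed
  also have "\<dots> = ennreal (1 / c) * modular p u"
    unfolding modular_def by (simp add: nn_integral_cmult)
  finally show ?thesis .
qed

text \<open>Normalises the indicator of a set of finite measure so that it can be a partner in
  Hoelder's inequality.\<close>

lemma modular_indicator:
  assumes "p \<in> borel_measurable lebesgue" "AE x in lebesgue. 1 < p x"
    and Q: "Q \<in> sets lebesgue" "emeasure lebesgue Q < \<infinity>"
  obtains l where "1 \<le> l" "modular p (\<lambda>x. indicator Q x / l) \<le> 1"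
proof -
  \<comment> \<open>The summand 1 gives the \<open>1 \<le> l\<close> that
    \<open>modular_scale\<close> asks for and makes the quotient of the measure of \<open>Q\<close>
    by \<open>l\<close> at most 1.\<close>
  define l where "l = measure lebesgue Q + 1"
  have "modular p (\<lambda>x. indicator Q x / l) \<le> ennreal (1 / l) * modular p (indicator Q)"
    using assms by (intro modular_scale borel_measurable_indicator) (auto simp: l_def)
  also have "modular p (indicator Q) = (\<integral>\<^sup>+x. indicator Q x \<partial>lebesgue)"
    unfolding modular_def by (intro nn_integral_cong) (auto simp: indicator_def)
  also have "\<dots> = ennreal (measure lebesgue Q)"
    using Q by (simp add: emeasure_eq_ennreal_measure less_top)
  also have "ennreal (1 / l) * \<dots> = ennreal (measure lebesgue Q / l)"
    by (simp add: ennreal_mult[symmetric] l_def)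
  also have "\<dots> \<le> 1"
    by (simp add: l_def divide_le_eq_1 add_nonneg_pos)
  finally show ?thesis by (intro that[of l]) (auto simp: l_def)
qed

subsection \<open>Consequences of the weight condition\<close>

lemma borel_measurable_vec:
  fixes f :: "'a \<Rightarrow> real^'m"
  shows "(\<And>i. (\<lambda>x. f x $ i) \<in> borel_measurable M) \<Longrightarrow> f \<in> borel_measurable M"
  by (subst borel_measurable_euclidean_space) (auto simp: Basis_vec_def inner_axis)

lemma borel_measurable_vec_nth:
  fixes f :: "'a \<Rightarrow> real^'m"
  shows "f \<in> borel_measurable M \<Longrightarrow> (\<lambda>x. f x $ i) \<in> borel_measurable M"
  by (rule borel_measurable_continuous_on[where f = "\<lambda>v. v $ i"]) (auto intro!: continuous_intros)

lemma borel_measurable_matrix_vector: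
  fixes A :: "'a \<Rightarrow> real^'m^'k"
  assumes "\<And>i j. (\<lambda>x. A x $ i $ j) \<in> borel_measurable M" "f \<in> borel_measurable M"
  shows "(\<lambda>x. A x *v f x) \<in> borel_measurable M"
proof (rule borel_measurable_vec)
  fix i
  show "(\<lambda>x. (A x *v f x) $ i) \<in> borel_measurable M"
    unfolding matrix_vector_mult_def vec_lambda_beta
    by (intro borel_measurable_sum borel_measurable_times assms(1) borel_measurable_vec_nth assms(2))
qed

lemma matrix_weight_measurable:
  "matrix_weight W \<Longrightarrow> f \<in> borel_measurable lebesgue \<Longrightarrow> (\<lambda>x. W x *v f x) \<in> borel_measurable lebesgue"
  by (intro borel_measurable_matrix_vector) (auto simp: matrix_weight_def dest: locally_integrable_measurable)

lemma op_norm_mult: "norm (A *v z) \<le> op_norm A * norm z"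
  unfolding op_norm_def by (rule onorm) (rule matrix_vector_mul_bounded_linear)

lemma op_norm_nonneg: "0 \<le> op_norm A"
  unfolding op_norm_def by (rule onorm_pos_le) (rule matrix_vector_mul_bounded_linear)

lemma matrix_inv_mult_left:
  fixes A :: "real^'m^'m"
  assumes "invertible A"
  shows "matrix_inv A *v (A *v z) = z"
proof -
  have "matrix_inv A ** A = mat 1"
    using assms someI_ex[of "\<lambda>B. A ** B = mat 1 \<and> B ** A = mat 1"]
    by (simp add: invertible_def matrix_inv_def)
  then show ?thesis by (simp add: matrix_vector_mul_assoc)
qed

lemma cubes_measure:
  assumes "Q \<in> cubes"
  shows "Q \<in> sets lebesgue" "emeasure lebesgue Q < \<infinity>" "0 < emeasure lebesgue Q" "compact Q"
proof -
  obtain a l where Q: "Q = cbox a (\<chi> i. a $ i + l)" "0 < l"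
    using assms by (auto simp: cubes_def)
  show "Q \<in> sets lebesgue" "compact Q" using Q by auto
  show "emeasure lebesgue Q < \<infinity>"
    unfolding Q using emeasure_lborel_cbox_finite[of a "\<chi> i. a $ i + l"] by simp
  have "a \<bullet> b \<le> (\<chi> i. a $ i + l) \<bullet> b \<and> (\<chi> i. a $ i + l) \<bullet> b - a \<bullet> b = l" if "b \<in> Basis" for b
    using that Q(2) by (auto simp: Basis_vec_def inner_axis)
  then show "0 < emeasure lebesgue Q"
    unfolding Q using Q(2) by (simp add: emeasure_lborel_cbox_eq inner_diff_left prod_pos)
qed

lemma bounded_subset_cube:
  fixes K :: "(real^'n) set"
  assumes "bounded K"
  obtains Q where "Q \<in> cubes" "K \<subseteq> Q"
proof -
  obtain B where B: "0 < B" "\<And>x. x \<in> K \<Longrightarrow> norm x \<le> B"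
    using assms by (auto simp: bounded_pos)
  define Q :: "(real^'n) set" where "Q = cbox (\<chi> i. - B) (\<chi> i. (\<chi> i. - B) $ i + 2 * B)"
  have "Q \<in> cubes" unfolding cubes_def Q_def using B(1) by fastforce
  moreover have "K \<subseteq> Q"
  proof
    fix x assume "x \<in> K"
    then have "\<bar>x $ i\<bar> \<le> B" for i
      using B(2) component_le_norm_cart[of x i] by force
    then show "x \<in> Q" by (auto simp: Q_def mem_box_cart abs_le_iff minus_le_iff)
  qed
  ultimately show ?thesis by (rule that)
qed

lemma less_top_obtain_ennreal:
  assumes "x < top"
  obtains l where "x < ennreal l" "0 < l"
proof (cases x rule: ennreal_cases)
  case (real r)
  then show ?thesis by (intro that[of "r + 1"]) (auto intro!: ennreal_lessI)
qed (use assms in auto)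

lemma less_top_ennrealE:
  assumes "x < top"
  obtains a where "x = ennreal a" "0 \<le> a"
  using assms by (cases x rule: ennreal_cases) auto

locale Ap_weight =
  fixes p :: "real^'n \<Rightarrow> real" and W :: "real^'n \<Rightarrow> real^'m^'m"
  assumes exponents: "p \<in> exponents" and weight: "matrix_weight W" and Ap: "Ap_const p W < \<infinity>"
begin

lemma p_gt_1: "AE x in lebesgue. 1 < p x"
  using exponents by (rule exponents_AE_gt_1)

lemma p_nonneg: "AE x in lebesgue. 0 \<le> p x"
  using p_gt_1 by (auto elim: eventually_mono)

lemma p_measurable: "p \<in> borel_measurable lebesgue"
  using exponents by (rule exponents_measurable)

lemma AE_invertible: "AE x in lebesgue. invertible (W x)"
  using weight by (simp add: matrix_weight_def)

lemma W_measurable: "f \<in> borel_measurable lebesgue \<Longrightarrow> (\<lambda>x. norm (W x *v f x)) \<in> borel_measurable lebesgue"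
  using matrix_weight_measurable[OF weight, of f] by simp

abbreviation inner_norm :: "(real^'n) set \<Rightarrow> real^'n \<Rightarrow> ennreal" where
  "inner_norm Q x \<equiv>
     lux_norm (conj_exponent p) (\<lambda>y. ennreal (op_norm (W x ** matrix_inv (W y))) * indicator Q y)"

lemma outer_norm_finite:
  assumes "Q \<in> cubes"
  shows "lux_norm p (\<lambda>x. inner_norm Q x * indicator Q x) < top"
proof -
  have "inverse (emeasure lebesgue Q) * lux_norm p (\<lambda>x. inner_norm Q x * indicator Q x) \<le> Ap_const p W"
    unfolding Ap_const_def using assms by (rule SUP_upper)
  then have "inverse (emeasure lebesgue Q) * lux_norm p (\<lambda>x. inner_norm Q x * indicator Q x) < top"
    using Ap by (simp add: le_less_trans)
  moreover have "inverse (emeasure lebesgue Q) \<noteq> 0"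
    using cubes_measure[OF assms] by (auto simp: ennreal_inverse_eq_0_iff)
  ultimately show ?thesis by (auto simp: ennreal_mult_less_top)
qed

text \<open>Otherwise the inner norm is infinite almost everywhere on \<open>Q\<close>, a set of
  positive measure, against the finite outer norm. The inner norm need not be measurable in
  \<open>x\<close> for this: it is compared with the measurable function
  \<open>top * indicator Q x\<close> by monotonicity alone.\<close>

lemma inner_norm_finite_point:
  assumes Q: "Q \<in> cubes"
  obtains x where "invertible (W x)" "inner_norm Q x < top"
proof (rule ccontr)
  note * = that
  assume "\<not> thesis"
  then have inf: "inner_norm Q x = top" if "invertible (W x)" for x
    using that * by (meson less_top)
  obtain l where l: "lux_norm p (\<lambda>x. inner_norm Q x * indicator Q x) < ennreal l" "0 < l"
    using outer_norm_finite[OF Q]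
    by (rule less_top_obtain_ennreal) blast
  have "(\<integral>\<^sup>+x. top * indicator Q x \<partial>lebesgue)
    \<le> (\<integral>\<^sup>+x. epowr (inner_norm Q x * indicator Q x / ennreal l) (p x) \<partial>lebesgue)"
  proof (rule nn_integral_mono_AE)
    show "AE x in lebesgue. top * indicator Q x \<le> epowr (inner_norm Q x * indicator Q x / ennreal l) (p x)"
      using AE_invertible
    proof eventually_elim
      case (elim x)
      then show ?case using inf[OF elim] l(2)
        by (auto simp: indicator_def epowr_def ennreal_top_divide)
    qed
  qed
  also have "\<dots> \<le> 1"
    using p_nonneg l(1) by (rule lux_norm_less_imp)
  finally have "top * emeasure lebesgue Q \<le> 1"
    unfolding nn_integral_cmult_indicator[OF cubes_measure(1)[OF Q]] .
  moreover have "emeasure lebesgue Q \<noteq> 0"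
    using cubes_measure(3)[OF Q] by (rule gr_implies_not_zero)
  ultimately show False by (simp add: ennreal_top_mult top_unique del: emeasure_completion)
qed

text \<open>The form in which both consequences of the weight condition use the inner norm: with
  \<open>x\<close> fixed, a function of \<open>y\<close> dominated by \<open>c\<close> times the
  kernel lies in the conjugate space at scale \<open>c * l\<close>.\<close>

lemma modular_conj_bound:
  assumes l: "inner_norm Q x < ennreal l" "0 < c"
    and le: "\<And>y. invertible (W y) \<Longrightarrow> \<bar>v y\<bar> \<le> c * op_norm (W x ** matrix_inv (W y)) * indicator Q y"
  shows "modular (conj_exponent p) (\<lambda>y. v y / (c * l)) \<le> 1"
proof -
  let ?w = "\<lambda>y. op_norm (W x ** matrix_inv (W y)) * indicator Q y"
  have "inner_norm Q x = rnorm (conj_exponent p) ?w"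
    by (rule arg_cong2[where f = lux_norm]) (auto simp: fun_eq_iff indicator_def op_norm_nonneg)
  with l(1) have w: "modular (conj_exponent p) (\<lambda>y. ?w y / l) \<le> 1"
    by (intro modular_le_1 conj_exponent_nonneg p_gt_1) simp
  have l0: "0 < l"
    using l(1) by (metis ennreal_neg le_less_linear not_less_zero)
  have "modular (conj_exponent p) (\<lambda>y. v y / (c * l)) \<le> modular (conj_exponent p) (\<lambda>y. ?w y / l)"
  proof (intro modular_mono_AE conj_exponent_nonneg p_gt_1)
    show "AE y in lebesgue. \<bar>v y / (c * l)\<bar> \<le> \<bar>?w y / l\<bar>"
      using AE_invertible
    proof eventually_elim
      case (elim y)
      have "\<bar>v y / (c * l)\<bar> = \<bar>v y\<bar> / (c * l)" using l0 l(2) by simp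
      also have "\<dots> \<le> c * ?w y / (c * l)"
        using le[OF elim] l0 l(2) by (intro divide_right_mono) (auto simp: mult.assoc)
      also have "\<dots> = \<bar>?w y / l\<bar>" using l0 l(2) by (simp add: op_norm_nonneg abs_mult)
      finally show ?case .
    qed
  qed
  with w show ?thesis by simp
qed

text \<open>With \<open>x\<close> taken from \<open>inner_norm_finite_point\<close>, f(y) =
  W(x)^(-1) (W(x) W(y)^(-1)) W(y) f(y). The first factor is constant, the operator norm of the
  second has finite conjugate norm over \<open>Q\<close>, and the remaining vector has the length
  measured by \<open>Lp_norm p W f\<close>; Hoelder's inequality combines them.\<close>

lemma L1_embedding:
  assumes Q: "Q \<in> cubes"
  obtains C where "0 < C" "\<And>f. f \<in> borel_measurable lebesgue \<Longrightarrow>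
    (\<integral>\<^sup>+y. ennreal (norm (f y)) * indicator Q y \<partial>lebesgue) \<le> ennreal C * Lp_norm p W f"
proof -
  obtain x where x: "invertible (W x)" "inner_norm Q x < top"
    by (rule inner_norm_finite_point[OF Q])
  obtain l where l: "inner_norm Q x < ennreal l" "0 < l"
    using x(2) by (rule less_top_obtain_ennreal) blast
  define c where "c = op_norm (matrix_inv (W x)) + 1"
  have c: "0 < c" using op_norm_nonneg[of "matrix_inv (W x)"] by (simp add: c_def)
  have Qs [measurable]: "Q \<in> sets lebesgue" using cubes_measure[OF Q] by simp
  have "(\<integral>\<^sup>+y. ennreal (norm (f y)) * indicator Q y \<partial>lebesgue) \<le> ennreal (2 * c * l) * Lp_norm p W f"
    if f: "f \<in> borel_measurable lebesgue" for f
  proof (rule ennreal_le_epsilon)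
    fix e :: real assume fin: "ennreal (2 * c * l) * Lp_norm p W f < top" and e: "0 < e"
    define u where "u y = norm (W y *v f y)" for y
    have u: "u \<in> borel_measurable lebesgue" unfolding u_def by (rule W_measurable[OF f])
    have Lu: "Lp_norm p W f = rnorm p u" by (simp add: Lp_norm_def u_def)
    obtain a where a: "Lp_norm p W f = ennreal a" "0 \<le> a"
      using fin c l by (cases "Lp_norm p W f" rule: ennreal_cases) (auto simp: ennreal_mult_top)
    \<comment> \<open>Chosen so that the final factor \<open>k * c * l * 2\<close> equals
      \<open>2 * c * l * a + e\<close>.\<close>
    define k where "k = a + e / (2 * c * l)"
    have k: "0 < k" "rnorm p u < ennreal k"
      using a e c l Lu by (auto simp: k_def intro!: ennreal_lessI add_nonneg_pos)
    have m1: "modular p (\<lambda>y. u y / k) \<le> 1"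
      using p_nonneg k(2) by (rule modular_le_1)
    \<comment> \<open>The quotient that carries \<open>u\<close> back to the norm of
      \<open>f\<close>. It is measurable by construction, whereas measurability of the kernel
      dominating it would concern the inverse matrices.\<close>
    define v where "v y = (if u y = 0 then 0 else norm (f y) / u y) * indicator Q y" for y
    have v: "v \<in> borel_measurable lebesgue"
      unfolding v_def using u f by measurable
    have m2: "modular (conj_exponent p) (\<lambda>y. v y / (c * l)) \<le> 1"
    proof (rule modular_conj_bound[OF l(1) c])
      fix y assume y: "invertible (W y)"
      have "f y = matrix_inv (W x) *v ((W x ** matrix_inv (W y)) *v (W y *v f y))"
        by (simp add: matrix_inv_mult_left[OF x(1)] matrix_inv_mult_left[OF y] flip: matrix_vector_mul_assoc)
      then have "norm (f y) \<le> op_norm (matrix_inv (W x)) * norm ((W x ** matrix_inv (W y)) *v (W y *v f y))"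
        by (metis op_norm_mult)
      also have "\<dots> \<le> c * (op_norm (W x ** matrix_inv (W y)) * norm (W y *v f y))"
        by (intro mult_mono op_norm_mult op_norm_nonneg) (auto simp: c_def intro: add_nonneg_nonneg op_norm_nonneg)
      finally have "norm (f y) \<le> c * op_norm (W x ** matrix_inv (W y)) * u y"
        by (simp add: u_def mult.assoc)
      moreover have "0 \<le> u y" by (simp add: u_def)
      ultimately have "\<bar>if u y = 0 then 0 else norm (f y) / u y\<bar> \<le> c * op_norm (W x ** matrix_inv (W y))"
        using c op_norm_nonneg[of "W x ** matrix_inv (W y)"] by (auto simp: divide_le_eq)
      then show "\<bar>v y\<bar> \<le> c * op_norm (W x ** matrix_inv (W y)) * indicator Q y"
        by (auto simp: v_def indicator_def)
    qed
    have "(\<integral>\<^sup>+y. ennreal (\<bar>u y / k\<bar> * \<bar>v y / (c * l)\<bar>) \<partial>lebesgue) \<le> 2"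
      using u v by (intro modular_Hoelder[OF p_measurable _ _ p_gt_1 m1 m2]) auto
    moreover have "(\<integral>\<^sup>+y. ennreal (norm (f y)) * indicator Q y \<partial>lebesgue)
      = (\<integral>\<^sup>+y. ennreal (k * c * l) * ennreal (\<bar>u y / k\<bar> * \<bar>v y / (c * l)\<bar>) \<partial>lebesgue)"
    proof (rule nn_integral_cong_AE)
      show "AE y in lebesgue. ennreal (norm (f y)) * indicator Q y
        = ennreal (k * c * l) * ennreal (\<bar>u y / k\<bar> * \<bar>v y / (c * l)\<bar>)"
        using AE_invertible
      proof eventually_elim
        case (elim y)
        have "f y = 0" if "u y = 0"
          using that matrix_inv_mult_left[OF elim, of "f y"] by (simp add: u_def)
        then have "u y * (if u y = 0 then 0 else norm (f y) / u y) = norm (f y)" by auto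
        then have "norm (f y) * indicator Q y = k * c * l * (\<bar>u y / k\<bar> * \<bar>v y / (c * l)\<bar>)"
          using k c l by (auto simp: v_def abs_mult indicator_def u_def)
        then show ?case
          using k c l by (auto simp: ennreal_mult[symmetric] indicator_def)
      qed
    qed
    ultimately have "(\<integral>\<^sup>+y. ennreal (norm (f y)) * indicator Q y \<partial>lebesgue) \<le> ennreal (k * c * l) * 2"
      using u v by (simp add: nn_integral_cmult mult_left_mono)
    also have "\<dots> = ennreal (k * c * l * 2)"
      using k c l by (simp add: ennreal_mult)
    also have "k * c * l * 2 = 2 * c * l * a + e"
      using c l by (simp add: k_def field_simps)
    finally show "(\<integral>\<^sup>+y. ennreal (norm (f y)) * indicator Q y \<partial>lebesgue)
      \<le> ennreal (2 * c * l) * Lp_norm p W f + ennreal e"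
      using a c l e by (simp add: ennreal_mult[symmetric] ennreal_plus[symmetric] del: ennreal_plus)
  qed
  with c l show ?thesis by (intro that[of "2 * c * l"]) auto
qed

text \<open>From W(x) e = (W(x) W(y)^(-1)) W(y) e, the kernel of the inner norm is at least |W(x) e|
  / |W(y) e|. The inner norm at \<open>x\<close> is therefore at least a fixed multiple of |W(x) e|,
  and the finite outer norm over \<open>Q\<close> bounds the latter.\<close>

lemma weight_locally_Lp:
  assumes Q: "Q \<in> cubes"
  shows "rnorm p (\<lambda>x. norm (W x *v e) * indicator Q x) < top"
proof (cases "e = 0")
  case True
  have "rnorm p (\<lambda>x. 0) \<le> ennreal 1"
    by (rule rnorm_le) (auto simp: modular_def)
  with True show ?thesis by (auto simp: le_less_trans)
next
  case False
  have Qs [measurable]: "Q \<in> sets lebesgue" using cubes_measure[OF Q] by simp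
  obtain s where s: "1 \<le> s" "modular p (\<lambda>x. indicator Q x / s) \<le> 1"
    by (rule modular_indicator[OF p_measurable p_gt_1 cubes_measure(1,2)[OF Q]])
  define w where "w y = indicator Q y / norm (W y *v e)" for y
  have we [measurable]: "(\<lambda>y. norm (W y *v e)) \<in> borel_measurable lebesgue"
    by (rule W_measurable) simp
  have w [measurable]: "w \<in> borel_measurable lebesgue"
    unfolding w_def by measurable
  have We: "W y *v e \<noteq> 0" if "invertible (W y)" for y
    using matrix_inv_mult_left[OF that, of e] False by auto
  have "(\<integral>\<^sup>+y. ennreal (w y) \<partial>lebesgue) \<noteq> 0"
  proof
    assume "(\<integral>\<^sup>+y. ennreal (w y) \<partial>lebesgue) = 0"
    then have "AE y in lebesgue. w y \<le> 0"
      by (subst (asm) nn_integral_0_iff_AE) (auto simp: ennreal_eq_0_iff)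
    with AE_invertible have "AE y in lebesgue. y \<notin> Q"
      by eventually_elim (use We in \<open>auto simp: w_def indicator_def\<close>)
    then have "emeasure lebesgue Q = 0"
      by (metis AE_iff_null_sets Qs null_setsD1)
    with cubes_measure[OF Q] show False by simp
  qed
  \<comment> \<open>The integral of \<open>w\<close> may be infinite; a finite positive lower bound
    \<open>i\<close> is kept.\<close>
  then obtain i where i: "0 < i" "ennreal i \<le> (\<integral>\<^sup>+y. ennreal (w y) \<partial>lebesgue)"
    by (metis ennreal_zero_less_top ennreal_cases ennreal_0 less_eq_real_def order_refl top_greatest zero_less_one)
  \<comment> \<open>Hoelder's inequality, with the indicator of \<open>Q\<close> at scale
    \<open>s\<close> as partner, costs a factor 2 and gives
    \<open>norm (W x *v e) * i \<le> 2 * s * l\<close> for every \<open>l\<close> above the inner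
    norm.\<close>
  define c where "c = i / (2 * s)"
  have c: "0 < c" using i s by (simp add: c_def)
  have low: "ennreal (c * norm (W x *v e)) \<le> inner_norm Q x" for x
  proof (rule ennreal_le_epsilon)
    fix d :: real assume fin: "inner_norm Q x < top" and d: "0 < d"
    obtain a where a: "inner_norm Q x = ennreal a" "0 \<le> a"
      by (rule less_top_ennrealE[OF fin])
    define l where "l = a + d"
    have l: "inner_norm Q x < ennreal l" "0 < l"
      using a d by (auto simp: l_def intro!: ennreal_lessI)
    have "modular (conj_exponent p) (\<lambda>y. (norm (W x *v e) * w y) / (1 * l)) \<le> 1"
    proof (rule modular_conj_bound[OF l(1)])
      fix y assume y: "invertible (W y)"
      have "W x *v e = (W x ** matrix_inv (W y)) *v (W y *v e)"
        by (simp add: matrix_inv_mult_left[OF y] flip: matrix_vector_mul_assoc)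
      then have "norm (W x *v e) \<le> op_norm (W x ** matrix_inv (W y)) * norm (W y *v e)"
        by (metis op_norm_mult)
      with We[OF y] show "\<bar>norm (W x *v e) * w y\<bar> \<le> 1 * op_norm (W x ** matrix_inv (W y)) * indicator Q y"
        by (auto simp: w_def indicator_def divide_le_eq)
    qed simp
    then have "(\<integral>\<^sup>+y. ennreal (\<bar>indicator Q y / s\<bar> * \<bar>norm (W x *v e) * w y / (1 * l)\<bar>) \<partial>lebesgue) \<le> 2"
      by (intro modular_Hoelder[OF p_measurable _ _ p_gt_1 s(2)]) measurable
    also have "(\<integral>\<^sup>+y. ennreal (\<bar>indicator Q y / s\<bar> * \<bar>norm (W x *v e) * w y / (1 * l)\<bar>) \<partial>lebesgue)
      = (\<integral>\<^sup>+y. ennreal (norm (W x *v e) / (s * l)) * ennreal (w y) \<partial>lebesgue)"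
    proof (rule nn_integral_cong)
      fix y
      have "\<bar>indicator Q y / s\<bar> * \<bar>norm (W x *v e) * w y / (1 * l)\<bar> = norm (W x *v e) / (s * l) * w y"
        using s l by (auto simp: w_def indicator_def abs_mult)
      then show "ennreal (\<bar>indicator Q y / s\<bar> * \<bar>norm (W x *v e) * w y / (1 * l)\<bar>)
        = ennreal (norm (W x *v e) / (s * l)) * ennreal (w y)"
        using s l by (simp add: ennreal_mult[symmetric] w_def)
    qed
    also have "\<dots> = ennreal (norm (W x *v e) / (s * l)) * (\<integral>\<^sup>+y. ennreal (w y) \<partial>lebesgue)"
      by (rule nn_integral_cmult) measurable
    finally have "ennreal (norm (W x *v e) / (s * l)) * ennreal i \<le> 2"
      using i(2) by (meson mult_left_mono order_trans zero_le)
    then have "ennreal (norm (W x *v e) / (s * l) * i) \<le> ennreal 2"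
      using s l i by (subst ennreal_mult) auto
    then have "norm (W x *v e) / (s * l) * i \<le> 2"
      by (subst (asm) ennreal_le_iff) auto
    then have "c * norm (W x *v e) \<le> l"
      using s l by (simp add: c_def field_simps)
    then show "ennreal (c * norm (W x *v e)) \<le> inner_norm Q x + ennreal d"
      using a d by (simp add: l_def ennreal_plus[symmetric] ennreal_leI del: ennreal_plus)
  qed
  have "rnorm p (\<lambda>x. norm (W x *v e) * indicator Q x)
     = rnorm p (\<lambda>x. inverse c * (c * (norm (W x *v e) * indicator Q x)))"
    using c by (simp add: mult.assoc[symmetric])
  also have "\<dots> \<le> ennreal (inverse c) * rnorm p (\<lambda>x. c * (norm (W x *v e) * indicator Q x))"
    using c by (intro rnorm_cmult_le p_nonneg) auto
  also have "\<dots> \<le> ennreal (inverse c) * lux_norm p (\<lambda>x. inner_norm Q x * indicator Q x)"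
  proof (intro mult_left_mono lux_norm_mono_AE p_nonneg AE_I2)
    fix x
    show "ennreal \<bar>c * (norm (W x *v e) * indicator Q x)\<bar> \<le> inner_norm Q x * indicator Q x"
      using low[of x] c by (auto simp: indicator_def abs_mult)
  qed simp
  also have "\<dots> < top"
    using outer_norm_finite[OF Q] by (simp add: ennreal_mult_less_top)
  finally show ?thesis .
qed

section \<open>The weighted norm of vector functions\<close>

lemma Lp_norm_mono_AE:
  assumes "AE x in lebesgue. norm (W x *v f x) \<le> norm (W x *v g x)"
  shows "Lp_norm p W f \<le> Lp_norm p W g"
  unfolding Lp_norm_def using assms by (intro lux_norm_mono_AE p_nonneg) (auto elim: eventually_mono intro: ennreal_leI)

lemma Lp_norm_cong_AE:
  assumes "AE x in lebesgue. f x = g x"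
  shows "Lp_norm p W f = Lp_norm p W g"
  using assms by (intro antisym Lp_norm_mono_AE) (auto elim: eventually_mono)

lemma Lp_norm_triangle:
  assumes "f \<in> borel_measurable lebesgue" "g \<in> borel_measurable lebesgue"
  shows "Lp_norm p W (\<lambda>x. f x + g x) \<le> Lp_norm p W f + Lp_norm p W g"
proof -
  have "Lp_norm p W (\<lambda>x. f x + g x) \<le> rnorm p (\<lambda>x. norm (W x *v f x) + norm (W x *v g x))"
    unfolding Lp_norm_def
    by (intro lux_norm_mono_AE p_nonneg AE_I2 ennreal_leI)
      (auto simp: matrix_vector_right_distrib norm_triangle_ineq intro: order_trans[OF norm_triangle_ineq])
  also have "\<dots> \<le> rnorm p (\<lambda>x. norm (W x *v f x)) + rnorm p (\<lambda>x. norm (W x *v g x))"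
    by (intro rnorm_add p_measurable p_gt_1 W_measurable assms)
  finally show ?thesis by (simp add: Lp_norm_def)
qed

lemma Lp_norm_minus: "Lp_norm p W (\<lambda>x. - f x) = Lp_norm p W f"
proof -
  have "W x *v (- f x) = - (W x *v f x)" for x
    by (metis add.right_inverse add_eq_0_iff matrix_vector_mult_0_right matrix_vector_right_distrib)
  then show ?thesis by (simp add: Lp_norm_def)
qed

lemma Lp_norm_minus_commute: "Lp_norm p W (\<lambda>x. f x - g x) = Lp_norm p W (\<lambda>x. g x - f x)"
  using Lp_norm_minus[of "\<lambda>x. f x - g x"] by simp

text \<open>Definiteness comes from \<open>L1_embedding\<close>: over every cube the integral of the
  length is at most a multiple of 0.\<close>

lemma Lp_norm_eq_0_imp:
  assumes "f \<in> borel_measurable lebesgue" "Lp_norm p W f = 0"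
  shows "AE x in lebesgue. f x = 0"
proof (rule AE_UNIV_if_AE_cball)
  fix k :: nat
  obtain Q where Q: "Q \<in> cubes" "cball (0::real^'n) (real k) \<subseteq> Q"
    using bounded_subset_cube[OF bounded_cball] .
  obtain C where "\<And>f. f \<in> borel_measurable lebesgue \<Longrightarrow>
      (\<integral>\<^sup>+y. ennreal (norm (f y)) * indicator Q y \<partial>lebesgue) \<le> ennreal C * Lp_norm p W f"
    by (rule L1_embedding[OF Q(1)]) blast
  from this[OF assms(1)] have "(\<integral>\<^sup>+y. ennreal (norm (f y)) * indicator Q y \<partial>lebesgue) = 0"
    using assms(2) by simp
  then have "AE y in lebesgue. ennreal (norm (f y)) * indicator Q y = 0"
    using assms(1) cubes_measure[OF Q(1)] by (subst (asm) nn_integral_0_iff_AE) auto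
  then show "AE x in lebesgue. x \<in> cball 0 (real k) \<longrightarrow> f x = 0"
    by eventually_elim (use Q(2) in \<open>auto simp: indicator_def split: if_splits\<close>)
qed

end

subsection \<open>Completeness\<close>

lemma suminf_half_powers: "(\<Sum>l. ennreal (C * (1/2) ^ (l + k))) = ennreal (2 * C * (1/2) ^ k)" if "0 \<le> C"
proof -
  have "(\<lambda>l. C * (1/2) ^ k * (1/2::real) ^ l) sums (C * (1/2) ^ k * (1 / (1 - 1/2)))"
    by (intro sums_mult geometric_sums) auto
  then have "(\<lambda>l. C * (1/2::real) ^ (l + k)) sums (2 * C * (1/2) ^ k)"
    by (simp add: power_add mult_ac)
  then show ?thesis
    using that by (intro suminf_ennreal_eq) auto
qed

lemma W11_loc_measurable:
  "f \<in> W11_loc \<Longrightarrow> f \<in> borel_measurable lebesgue"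
  "f \<in> W11_loc \<Longrightarrow> weak_partial j f \<in> borel_measurable lebesgue"
  by (auto intro: locally_integrable_measurable W11_locD)

lemma W11_loc_diff: "f \<in> W11_loc \<Longrightarrow> g \<in> W11_loc \<Longrightarrow> (\<lambda>x. f x - g x) \<in> W11_loc"
  by (rule W11_locI) (auto intro: locally_integrable_diff W11_locD has_weak_partial_vec_diff)

context Ap_weight
begin

lemma Lp_norm_zero: "Lp_norm p W (\<lambda>x. 0) = 0"
proof -
  have "Lp_norm p W (\<lambda>x. 0) \<le> 0"
  proof (rule ennreal_le_epsilon)
    fix e :: real assume "0 < e"
    then have "Lp_norm p W (\<lambda>x. 0) \<le> ennreal e"
      unfolding Lp_norm_def by (intro lux_norm_le) (auto simp: epowr_def)
    then show "Lp_norm p W (\<lambda>x. 0) \<le> 0 + ennreal e" by simp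
  qed
  then show ?thesis by simp
qed

lemma Lp_complete:
  fixes fs :: "nat \<Rightarrow> real^'n \<Rightarrow> real^'m"
  assumes fs: "\<And>k. locally_integrable (fs k)"
    and le: "\<And>k. Lp_norm p W (\<lambda>x. fs (Suc k) x - fs k x) \<le> ennreal ((1/2) ^ k)"
  obtains f where "locally_integrable f" "L1loc_tendsto fs f"
    "\<And>k. Lp_norm p W (\<lambda>x. fs k x - f x) \<le> ennreal (4 * (1/2) ^ k)"
proof -
  \<comment> \<open>On the null set where the sequence diverges \<open>lim\<close> returns some
    default value; the resulting function is measurable all the same.\<close>
  define f where "f x = lim (\<lambda>k. fs k x)" for x
  define D where "D k x = norm (fs (Suc k) x - fs k x)" for k x
  have m: "fs k \<in> borel_measurable lebesgue" for k
    using fs by (rule locally_integrable_measurable)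
  have fm: "f \<in> borel_measurable lebesgue"
    unfolding f_def by (rule borel_measurable_lim_metric[OF m])
  have Dm: "D k \<in> borel_measurable lebesgue" for k
    unfolding D_def using borel_measurable_diff[OF m m] by measurable
  \<comment> \<open>By the embedding the increments have geometrically small integrals over
    \<open>Q\<close>. All tails are estimated: the full sum yields convergence almost everywhere,
    and the tail from \<open>k\<close> on dominates the distance between \<open>fs k\<close> and the
    limit.\<close>
  have D_tail: "\<exists>C>0. \<forall>k. (\<integral>\<^sup>+x. (\<Sum>l. ennreal (D (l + k) x) * indicator Q x) \<partial>lebesgue) \<le> ennreal (C * (1/2) ^ k)"
    if Q: "Q \<in> cubes" for Q
  proof -
    obtain C where C: "0 < C" "\<And>f. f \<in> borel_measurable lebesgue \<Longrightarrow>
      (\<integral>\<^sup>+y. ennreal (norm (f y)) * indicator Q y \<partial>lebesgue) \<le> ennreal C * Lp_norm p W f"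
      by (rule L1_embedding[OF Q]) blast
    have Dl: "(\<integral>\<^sup>+x. ennreal (D l x) * indicator Q x \<partial>lebesgue) \<le> ennreal (C * (1/2) ^ l)" for l
    proof -
      have "(\<integral>\<^sup>+x. ennreal (D l x) * indicator Q x \<partial>lebesgue) \<le> ennreal C * Lp_norm p W (\<lambda>x. fs (Suc l) x - fs l x)"
        unfolding D_def using m by (intro C(2)) auto
      also have "\<dots> \<le> ennreal C * ennreal ((1/2) ^ l)"
        by (intro mult_left_mono le) auto
      finally show ?thesis using C(1) by (simp add: ennreal_mult)
    qed
    have "(\<integral>\<^sup>+x. (\<Sum>l. ennreal (D (l + k) x) * indicator Q x) \<partial>lebesgue) \<le> ennreal (2 * C * (1/2) ^ k)" for k
    proof -
      have "(\<integral>\<^sup>+x. (\<Sum>l. ennreal (D (l + k) x) * indicator Q x) \<partial>lebesgue)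
        = (\<Sum>l. \<integral>\<^sup>+x. ennreal (D (l + k) x) * indicator Q x \<partial>lebesgue)"
        using Dm cubes_measure(1)[OF Q]
        by (intro nn_integral_suminf borel_measurable_times_ennreal borel_measurable_indicator) auto
      also have "\<dots> \<le> (\<Sum>l. ennreal (C * (1/2) ^ (l + k)))"
        by (intro suminf_le Dl) auto
      also have "\<dots> = ennreal (2 * C * (1/2) ^ k)"
        using C(1) by (intro suminf_half_powers) auto
      finally show ?thesis .
    qed
    with C(1) show ?thesis by (intro exI[of _ "2 * C"]) auto
  qed
  have sum_fin: "AE x in lebesgue. (\<Sum>l. ennreal (D l x)) < top"
  proof (rule AE_UNIV_if_AE_cball)
    fix k :: nat
    obtain Q where Q: "Q \<in> cubes" "cball (0::real^'n) (real k) \<subseteq> Q"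
      using bounded_subset_cube[OF bounded_cball] .
    obtain C where "\<forall>k. (\<integral>\<^sup>+x. (\<Sum>l. ennreal (D (l + k) x) * indicator Q x) \<partial>lebesgue) \<le> ennreal (C * (1/2) ^ k)"
      using D_tail[OF Q(1)] by (elim exE conjE)
    from spec[OF this, of 0] have fin: "(\<integral>\<^sup>+x. (\<Sum>l. ennreal (D l x) * indicator Q x) \<partial>lebesgue) \<noteq> \<infinity>"
      by (auto simp: top_unique)
    have "AE x in lebesgue. (\<Sum>l. ennreal (D l x) * indicator Q x) \<noteq> \<infinity>"
      using Dm cubes_measure(1)[OF Q(1)]
      by (intro nn_integral_PInf_AE[OF _ fin] borel_measurable_suminf_order borel_measurable_times_ennreal borel_measurable_indicator) auto
    then show "AE x in lebesgue. x \<in> cball 0 (real k) \<longrightarrow> (\<Sum>l. ennreal (D l x)) < top"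
    proof eventually_elim
      case (elim x)
      show ?case
      proof
        assume "x \<in> cball 0 (real k)"
        then have "x \<in> Q" using Q(2) by blast
        with elim show "(\<Sum>l. ennreal (D l x)) < top" by (simp add: less_top)
      qed
    qed
  qed
  have conv: "(\<lambda>k. fs k x) \<longlonglongrightarrow> f x \<and> (\<forall>k. ennreal (norm (fs k x - f x)) \<le> (\<Sum>l. ennreal (D (l + k) x)))"
    if "(\<Sum>l. ennreal (D l x)) < top" for x
  proof -
    have s: "summable (\<lambda>l. D l x)"
      using that by (intro summable_suminf_not_top) (auto simp: D_def)
    have "summable (\<lambda>l. fs (Suc l) x - fs l x)"
      by (rule summable_norm_cancel) (use s in \<open>simp add: D_def\<close>)
    then have "convergent (\<lambda>k. fs k x)"
      by (simp add: summable_iff_convergent sum_lessThan_telescope[of "\<lambda>i. fs i x"] convergent_diff_const_right_iff)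
    then have lim: "(\<lambda>k. fs k x) \<longlonglongrightarrow> f x"
      unfolding f_def by (simp add: convergent_LIMSEQ_iff)
    have "ennreal (norm (fs k x - f x)) \<le> (\<Sum>l. ennreal (D (l + k) x))" for k
    proof -
      have s': "summable (\<lambda>l. D (l + k) x)"
        using s by (rule summable_ignore_initial_segment)
      have "(\<lambda>l. fs (Suc (l + k)) x - fs (l + k) x) sums (f x - fs k x)"
        using telescope_sums[of "\<lambda>l. fs (l + k) x" "f x"] LIMSEQ_ignore_initial_segment[OF lim, of k] by simp
      then have "norm (f x - fs k x) = norm (\<Sum>l. fs (Suc (l + k)) x - fs (l + k) x)"
        by (simp add: sums_iff)
      also have "\<dots> \<le> (\<Sum>l. D (l + k) x)"
        unfolding D_def by (rule summable_norm) (use s' in \<open>simp add: D_def\<close>)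
      finally have "norm (fs k x - f x) \<le> (\<Sum>l. D (l + k) x)" by (simp add: norm_minus_commute)
      then have "ennreal (norm (fs k x - f x)) \<le> ennreal (\<Sum>l. D (l + k) x)" by (rule ennreal_leI)
      also have "\<dots> = (\<Sum>l. ennreal (D (l + k) x))"
        using s' by (intro suminf_ennreal2[symmetric]) (auto simp: D_def)
      finally show ?thesis .
    qed
    with lim show ?thesis by blast
  qed
  have L1: "\<exists>C>0. \<forall>k. (\<integral>\<^sup>+x. ennreal (norm (fs k x - f x)) * indicator K x \<partial>lebesgue) \<le> ennreal (C * (1/2) ^ k)"
    if K: "compact K" for K
  proof -
    obtain Q where Q: "Q \<in> cubes" "K \<subseteq> Q"
      using bounded_subset_cube[OF compact_imp_bounded[OF K]] .
    obtain C where C: "0 < C" "\<forall>k. (\<integral>\<^sup>+x. (\<Sum>l. ennreal (D (l + k) x) * indicator Q x) \<partial>lebesgue) \<le> ennreal (C * (1/2) ^ k)"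
      using D_tail[OF Q(1)] by (elim exE conjE)
    have "(\<integral>\<^sup>+x. ennreal (norm (fs k x - f x)) * indicator K x \<partial>lebesgue)
      \<le> (\<integral>\<^sup>+x. (\<Sum>l. ennreal (D (l + k) x) * indicator Q x) \<partial>lebesgue)" for k
    proof (rule nn_integral_mono_AE)
      show "AE x in lebesgue. ennreal (norm (fs k x - f x)) * indicator K x \<le> (\<Sum>l. ennreal (D (l + k) x) * indicator Q x)"
        using sum_fin
      proof eventually_elim
        case (elim x)
        with conv[OF elim] Q(2) show ?case by (auto simp: indicator_def)
      qed
    qed
    then have "(\<integral>\<^sup>+x. ennreal (norm (fs k x - f x)) * indicator K x \<partial>lebesgue) \<le> ennreal (C * (1/2) ^ k)" for k
      using C(2)[rule_format] by (rule order_trans)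
    with C(1) show ?thesis by (intro exI[of _ C] conjI allI)
  qed
  have "L1loc_tendsto fs f"
    unfolding L1loc_tendsto_def
  proof safe
    fix K :: "(real^'n) set" assume "compact K"
    from L1[OF this] obtain C where C: "0 < C" "\<forall>k. (\<integral>\<^sup>+x. ennreal (norm (fs k x - f x)) * indicator K x \<partial>lebesgue) \<le> ennreal (C * (1/2) ^ k)"
      by (elim exE conjE)
    have "(\<lambda>k. ennreal (C * (1/2) ^ k)) \<longlonglongrightarrow> ennreal (C * 0)"
      by (intro tendsto_ennrealI tendsto_mult tendsto_const LIMSEQ_realpow_zero) auto
    then have "(\<lambda>k. ennreal (C * (1/2) ^ k)) \<longlonglongrightarrow> 0" by simp
    then show "(\<lambda>k. \<integral>\<^sup>+x. ennreal (norm (fs k x - f x)) * indicator K x \<partial>lebesgue) \<longlonglongrightarrow> 0"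
      by (rule tendsto_sandwich[OF _ _ tendsto_const, rotated 2]) (auto simp: C(2))
  qed
  moreover have "locally_integrable f"
  proof (rule locally_integrableI)
    fix K :: "(real^'n) set" assume K: "compact K"
    from L1[OF this] obtain C where "\<forall>k. (\<integral>\<^sup>+x. ennreal (norm (fs k x - f x)) * indicator K x \<partial>lebesgue) \<le> ennreal (C * (1/2) ^ k)"
      by (elim exE conjE)
    note C = this[rule_format, of 0]
    have Ks: "K \<in> sets lebesgue"
      using K by (simp add: borel_compact sets_completionI_sets)
    have "integrable lebesgue (\<lambda>x. indicator K x *\<^sub>R (fs 0 x - f x))"
    proof (rule integrableI_bounded)
      show "(\<lambda>x. indicator K x *\<^sub>R (fs 0 x - f x)) \<in> borel_measurable lebesgue"
        using m fm Ks by (intro borel_measurable_scaleR borel_measurable_diff borel_measurable_indicator)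
      have "(\<integral>\<^sup>+x. ennreal (norm (indicator K x *\<^sub>R (fs 0 x - f x))) \<partial>lebesgue)
        = (\<integral>\<^sup>+x. ennreal (norm (fs 0 x - f x)) * indicator K x \<partial>lebesgue)"
        by (intro nn_integral_cong) (auto simp: indicator_def)
      also have "\<dots> < \<infinity>"
        using C by (rule le_less_trans) simp
      finally show "(\<integral>\<^sup>+x. ennreal (norm (indicator K x *\<^sub>R (fs 0 x - f x))) \<partial>lebesgue) < \<infinity>" .
    qed
    from Bochner_Integration.integrable_diff[OF locally_integrableD[OF fs[of 0] K] this]
    show "integrable lebesgue (\<lambda>x. indicator K x *\<^sub>R f x)"
      by (simp add: scaleR_diff_right)
  qed
  moreover have "Lp_norm p W (\<lambda>x. fs k x - f x) \<le> ennreal (4 * (1/2) ^ k)" for k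
  proof -
    \<comment> \<open>The bound is the exact geometric sum of the steps from \<open>k\<close> to
      \<open>k + l\<close>; with the subtracted term the induction closes.\<close>
    have tail: "Lp_norm p W (\<lambda>x. fs (k + l) x - fs k x) \<le> ennreal (2 * (1/2) ^ k - 2 * (1/2) ^ (k + l))" for l
    proof (induction l)
      case 0
      show ?case by (simp add: Lp_norm_zero)
    next
      case (Suc l)
      have "Lp_norm p W (\<lambda>x. fs (k + Suc l) x - fs k x)
        = Lp_norm p W (\<lambda>x. (fs (Suc (k + l)) x - fs (k + l) x) + (fs (k + l) x - fs k x))"
        by simp
      also have "\<dots> \<le> Lp_norm p W (\<lambda>x. fs (Suc (k + l)) x - fs (k + l) x) + Lp_norm p W (\<lambda>x. fs (k + l) x - fs k x)"
        using m by (intro Lp_norm_triangle borel_measurable_diff)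
      also have "\<dots> \<le> ennreal ((1/2) ^ (k + l)) + ennreal (2 * (1/2) ^ k - 2 * (1/2) ^ (k + l))"
        by (intro add_mono le Suc.IH)
      also have "\<dots> = ennreal ((1/2) ^ (k + l) + (2 * (1/2) ^ k - 2 * (1/2) ^ (k + l)))"
        by (intro ennreal_plus[symmetric]) (auto simp: power_decreasing)
      also have "(1/2) ^ (k + l) + (2 * (1/2) ^ k - 2 * (1/2) ^ (k + l)) = 2 * (1/2::real) ^ k - 2 * (1/2) ^ (k + Suc l)"
        by simp
      finally show ?case .
    qed
    \<comment> \<open>The tails stay below 2 * (1/2)^k. A scale twice as large provides the strict
      inequality that \<open>modular_le_1\<close> demands, and Fatou passes the modular bound to the
      limit.\<close>
    have "modular p (\<lambda>x. norm (W x *v (fs k x - f x)) / (4 * (1/2) ^ k)) \<le> 1"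
    proof (rule modular_Fatou[where N = k])
      show "p \<in> borel_measurable lebesgue" by (rule p_measurable)
      show "(\<lambda>x. norm (W x *v (fs k x - fs i x)) / (4 * (1/2) ^ k)) \<in> borel_measurable lebesgue" for i
        using W_measurable[OF borel_measurable_diff[OF m m]] by measurable
      show "AE x in lebesgue. 0 < p x"
        using p_gt_1 by (auto elim: eventually_mono)
      show "AE x in lebesgue. (\<lambda>i. norm (W x *v (fs k x - fs i x)) / (4 * (1/2) ^ k))
          \<longlonglongrightarrow> norm (W x *v (fs k x - f x)) / (4 * (1/2) ^ k)"
        using sum_fin
      proof eventually_elim
        case (elim x)
        from conv[OF elim] have "(\<lambda>k. fs k x) \<longlonglongrightarrow> f x" ..
        then show ?case
          by (intro tendsto_divide tendsto_norm tendsto_const bounded_linear.tendsto[OF matrix_vector_mul_bounded_linear] tendsto_diff) auto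
      qed
      fix i assume "k \<le> i"
      then obtain l where i: "i = k + l" using le_iff_add by blast
      have "Lp_norm p W (\<lambda>x. fs k x - fs i x) \<le> ennreal (2 * (1/2) ^ k - 2 * (1/2) ^ (k + l))"
        unfolding i Lp_norm_minus_commute[of "fs k"] by (rule tail)
      also have "\<dots> < ennreal (4 * (1/2) ^ k)"
        by (rule ennreal_lessI) (auto simp: less_diff_eq diff_less_eq intro: add_pos_pos order_less_trans)
      finally have "rnorm p (\<lambda>x. norm (W x *v (fs k x - fs i x))) < ennreal (4 * (1/2) ^ k)"
        by (simp add: Lp_norm_def)
      then show "modular p (\<lambda>x. norm (W x *v (fs k x - fs i x)) / (4 * (1/2) ^ k)) \<le> 1"
        by (rule modular_le_1[OF p_nonneg])
    qed
    then have "rnorm p (\<lambda>x. norm (W x *v (fs k x - f x))) \<le> ennreal (4 * (1/2) ^ k)"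
      by (intro rnorm_le) auto
    then show ?thesis by (simp add: Lp_norm_def)
  qed
  ultimately show ?thesis using that by blast
qed

section \<open>The Sobolev norm\<close>

lemma W1p_norm_eq:
  assumes "\<And>j. has_weak_partial_vec j f (g j)"
  shows "W1p_norm p W f = Lp_norm p W f + (\<Sum>j\<in>UNIV. Lp_norm p W (g j))"
  unfolding W1p_norm_def
  by (intro arg_cong2[where f = "(+)"] refl sum.cong Lp_norm_cong_AE weak_partial_AE_eq assms)

lemma W1p_norm_diff_eq:
  assumes "f \<in> W11_loc" "g \<in> W11_loc"
  shows "W1p_norm p W (\<lambda>x. f x - g x) = Lp_norm p W (\<lambda>x. f x - g x)
    + (\<Sum>j\<in>UNIV. Lp_norm p W (\<lambda>x. weak_partial j f x - weak_partial j g x))"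
  using assms by (intro W1p_norm_eq has_weak_partial_vec_diff W11_locD)

lemma Lp_norm_triangle_diff:
  assumes "f \<in> borel_measurable lebesgue" "g \<in> borel_measurable lebesgue" "h \<in> borel_measurable lebesgue"
  shows "Lp_norm p W (\<lambda>x. f x - h x) \<le> Lp_norm p W (\<lambda>x. f x - g x) + Lp_norm p W (\<lambda>x. g x - h x)"
  using Lp_norm_triangle[of "\<lambda>x. f x - g x" "\<lambda>x. g x - h x"] assms by simp

lemma W1p_norm_triangle_diff:
  assumes "f \<in> W11_loc" "g \<in> W11_loc" "h \<in> W11_loc"
  shows "W1p_norm p W (\<lambda>x. f x - h x) \<le> W1p_norm p W (\<lambda>x. f x - g x) + W1p_norm p W (\<lambda>x. g x - h x)"
proof -
  have "W1p_norm p W (\<lambda>x. f x - h x) \<le> (Lp_norm p W (\<lambda>x. f x - g x) + Lp_norm p W (\<lambda>x. g x - h x))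
    + (\<Sum>j\<in>UNIV. Lp_norm p W (\<lambda>x. weak_partial j f x - weak_partial j g x)
        + Lp_norm p W (\<lambda>x. weak_partial j g x - weak_partial j h x))"
    unfolding W1p_norm_diff_eq[OF assms(1,3)]
    by (intro add_mono sum_mono Lp_norm_triangle_diff W11_loc_measurable assms)
  also have "\<dots> = W1p_norm p W (\<lambda>x. f x - g x) + W1p_norm p W (\<lambda>x. g x - h x)"
    unfolding W1p_norm_diff_eq[OF assms(1,2)] W1p_norm_diff_eq[OF assms(2,3)] sum.distrib by (simp add: ac_simps)
  finally show ?thesis .
qed

lemma W1p_norm_minus_commute:
  assumes "f \<in> W11_loc" "g \<in> W11_loc"
  shows "W1p_norm p W (\<lambda>x. f x - g x) = W1p_norm p W (\<lambda>x. g x - f x)"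
  unfolding W1p_norm_diff_eq[OF assms] W1p_norm_diff_eq[OF assms(2,1)]
  by (intro arg_cong2[where f = "(+)"] sum.cong Lp_norm_minus_commute refl)

lemma W1p_norm_le_diff:
  assumes "f \<in> W11_loc" "g \<in> W11_loc"
  shows "W1p_norm p W f \<le> W1p_norm p W (\<lambda>x. f x - g x) + W1p_norm p W g"
proof -
  have "W1p_norm p W f \<le> (Lp_norm p W (\<lambda>x. f x - g x) + Lp_norm p W g)
    + (\<Sum>j\<in>UNIV. Lp_norm p W (\<lambda>x. weak_partial j f x - weak_partial j g x) + Lp_norm p W (weak_partial j g))"
    unfolding W1p_norm_def[of p W f]
    using Lp_norm_triangle[of "\<lambda>x. f x - g x" g] assms
      Lp_norm_triangle[of "\<lambda>x. weak_partial j f x - weak_partial j g x" "weak_partial j g" for j]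
    by (intro add_mono sum_mono) (auto simp: W11_loc_measurable borel_measurable_diff)
  also have "\<dots> = W1p_norm p W (\<lambda>x. f x - g x) + W1p_norm p W g"
    unfolding W1p_norm_diff_eq[OF assms] W1p_norm_def[of p W g] sum.distrib by (simp add: ac_simps)
  finally show ?thesis .
qed

lemma W1p_norm_diff_le:
  assumes "f \<in> W11_loc" "g \<in> W11_loc"
  shows "W1p_norm p W (\<lambda>x. f x - g x) \<le> W1p_norm p W f + W1p_norm p W g"
proof -
  have "Lp_norm p W (\<lambda>x. u x - v x) \<le> Lp_norm p W u + Lp_norm p W v"
    if "u \<in> borel_measurable lebesgue" "v \<in> borel_measurable lebesgue" for u v
    using Lp_norm_triangle[of u "\<lambda>x. - v x"] that by (simp add: Lp_norm_minus)
  then have "W1p_norm p W (\<lambda>x. f x - g x) \<le> (Lp_norm p W f + Lp_norm p W g)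
    + (\<Sum>j\<in>UNIV. Lp_norm p W (weak_partial j f) + Lp_norm p W (weak_partial j g))"
    unfolding W1p_norm_diff_eq[OF assms]
    by (intro add_mono sum_mono) (auto simp: W11_loc_measurable assms)
  also have "\<dots> = W1p_norm p W f + W1p_norm p W g"
    unfolding W1p_norm_def sum.distrib by (simp add: ac_simps)
  finally show ?thesis .
qed

lemma W11_loc_AE_cong:
  assumes "f \<in> W11_loc" "AE x in lebesgue. f x = g x"
  shows "g \<in> W11_loc" "W1p_norm p W g = W1p_norm p W f"
proof -
  have v: "has_weak_partial_vec j g (weak_partial j f)" for j
    unfolding has_weak_partial_vec_def
  proof
    fix i
    have a: "AE x in lebesgue. f x $ i = g x $ i"
      using assms(2) by eventually_elim simp
    have "has_weak_partial j (\<lambda>x. f x $ i) (\<lambda>x. weak_partial j f x $ i)"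
      using W11_locD(2)[OF assms(1)] by (simp add: has_weak_partial_vec_def)
    from this a show "has_weak_partial j (\<lambda>x. g x $ i) (\<lambda>x. weak_partial j f x $ i)"
      by (rule has_weak_partial_AE_cong) simp
  qed
  show "g \<in> W11_loc"
    using locally_integrable_AE_cong[OF W11_locD(1)[OF assms(1)] assms(2)] v by (rule W11_locI)
  show "W1p_norm p W g = W1p_norm p W f"
    unfolding W1p_norm_eq[OF v] W1p_norm_def[of p W f] Lp_norm_cong_AE[OF assms(2)] ..
qed


section \<open>Classes modulo null sets as a metric space\<close>

abbreviation ae_class :: "(real^'n \<Rightarrow> real^'m) \<Rightarrow> (real^'n \<Rightarrow> real^'m) set" where
  "ae_class f \<equiv> ae_rel p W `` {f}"

abbreviation rep :: "(real^'n \<Rightarrow> real^'m) set \<Rightarrow> real^'n \<Rightarrow> real^'m" where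
  "rep A \<equiv> SOME f. f \<in> A"

lemma W1pD: "f \<in> W1p p W \<Longrightarrow> f \<in> W11_loc" "f \<in> W1p p W \<Longrightarrow> W1p_norm p W f < top"
  by (auto simp: W1p_def)

lemma equiv_ae_rel: "equiv (W1p p W) (ae_rel p W)"
proof (rule equivI)
  show "ae_rel p W \<subseteq> W1p p W \<times> W1p p W" "refl_on (W1p p W) (ae_rel p W)"
    by (auto simp: ae_rel_def refl_on_def)
  show "sym (ae_rel p W)"
    by (auto simp: ae_rel_def sym_def elim: eventually_mono)
  show "trans (ae_rel p W)"
  proof (rule transI)
    fix f g h assume fgh: "(f, g) \<in> ae_rel p W" "(g, h) \<in> ae_rel p W"
    then have "AE x in lebesgue. f x = g x" "AE x in lebesgue. g x = h x"
      by (auto simp: ae_rel_def)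
    then have "AE x in lebesgue. f x = h x"
      by eventually_elim simp
    with fgh show "(f, h) \<in> ae_rel p W"
      by (simp add: ae_rel_def)
  qed
qed

lemma ae_class_in_space: "f \<in> W1p p W \<Longrightarrow> ae_class f \<in> W1p_space p W"
  unfolding W1p_space_def by (rule quotientI)

lemma rep_ae_class:
  assumes "f \<in> W1p p W"
  shows "rep (ae_class f) \<in> W1p p W" "AE x in lebesgue. f x = rep (ae_class f) x"
proof -
  have "f \<in> ae_class f"
    using equiv_class_self[OF equiv_ae_rel assms] .
  then have "rep (ae_class f) \<in> ae_class f"
    by (rule someI[of "\<lambda>g. g \<in> ae_class f"])
  then show "rep (ae_class f) \<in> W1p p W" "AE x in lebesgue. f x = rep (ae_class f) x"
    by (auto simp: ae_rel_def)
qed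

lemma space_rep:
  assumes "A \<in> W1p_space p W"
  shows "rep A \<in> W1p p W" "ae_class (rep A) = A"
proof -
  obtain f where f: "f \<in> W1p p W" "A = ae_class f"
    using assms unfolding W1p_space_def by (rule quotientE)
  show "rep A \<in> W1p p W"
    unfolding f(2) by (rule rep_ae_class[OF f(1)])
  show "ae_class (rep A) = A"
    unfolding f(2)
    by (rule equiv_class_eq[OF equiv_ae_rel, symmetric])
      (use rep_ae_class[OF f(1)] f(1) in \<open>auto simp: ae_rel_def\<close>)
qed

lemma W1p_diff_finite:
  assumes "f \<in> W1p p W" "g \<in> W1p p W"
  shows "W1p_norm p W (\<lambda>x. f x - g x) < top"
  using W1p_norm_diff_le[of f g] W1pD[OF assms(1)] W1pD[OF assms(2)]
  by (metis ennreal_add_less_top le_less_trans)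

text \<open>Frees the distance from the chosen representatives: they agree with \<open>f\<close> and
  \<open>g\<close> almost everywhere, and the norm ignores null sets.\<close>

lemma W1p_dist_ae_class:
  assumes "f \<in> W1p p W" "g \<in> W1p p W"
  shows "ennreal (W1p_dist p W (ae_class f) (ae_class g)) = W1p_norm p W (\<lambda>x. f x - g x)"
proof -
  have "AE x in lebesgue. f x - g x = rep (ae_class f) x - rep (ae_class g) x"
    using rep_ae_class(2)[OF assms(1)] rep_ae_class(2)[OF assms(2)] by eventually_elim simp
  then have "W1p_norm p W (\<lambda>x. rep (ae_class f) x - rep (ae_class g) x) = W1p_norm p W (\<lambda>x. f x - g x)"
    by (rule W11_loc_AE_cong(2)[OF W11_loc_diff[OF W1pD(1)[OF assms(1)] W1pD(1)[OF assms(2)]]])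
  then show ?thesis
    using W1p_diff_finite[OF assms] assms by (simp add: W1p_dist_def ae_class_in_space)
qed

lemma W1p_dist_nonneg: "0 \<le> W1p_dist p W A B"
  by (simp add: W1p_dist_def)

lemma W1p_norm_zero_imp:
  assumes "f \<in> W11_loc" "W1p_norm p W f = 0"
  shows "AE x in lebesgue. f x = 0"
  using assms by (intro Lp_norm_eq_0_imp W11_loc_measurable) (auto simp: W1p_norm_def)

lemma W1p_norm_0_AE:
  assumes "f \<in> W1p p W" "g \<in> W1p p W"
  shows "W1p_norm p W (\<lambda>x. f x - g x) = 0 \<longleftrightarrow> (AE x in lebesgue. f x = g x)"
proof
  assume "W1p_norm p W (\<lambda>x. f x - g x) = 0"
  then have "AE x in lebesgue. f x - g x = 0"
    using assms by (intro W1p_norm_zero_imp W11_loc_diff W1pD)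
  then show "AE x in lebesgue. f x = g x" by simp
next
  assume eq: "AE x in lebesgue. f x = g x"
  note l = W1pD(1)[OF assms(1)] W1pD(1)[OF assms(2)]
  have "AE x in lebesgue. f x - f x = f x - g x"
    using eq by eventually_elim simp
  from W11_loc_AE_cong(2)[OF W11_loc_diff[OF l(1) l(1)] this]
  have "W1p_norm p W (\<lambda>x. f x - g x) = W1p_norm p W (\<lambda>x. f x - f x)" .
  also have "\<dots> = 0"
    unfolding W1p_norm_diff_eq[OF l(1) l(1)] by (simp add: Lp_norm_zero)
  finally show "W1p_norm p W (\<lambda>x. f x - g x) = 0" .
qed

sublocale W1p: Metric_space "W1p_space p W" "W1p_dist p W"
proof
  fix A B C
  show "0 \<le> W1p_dist p W A B" by (rule W1p_dist_nonneg)
  show "W1p_dist p W A B = W1p_dist p W B A"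
    using space_rep(1)[of A] space_rep(1)[of B]
    by (auto simp: W1p_dist_def W1p_norm_minus_commute[of "rep A" "rep B"] W1pD)
  assume A: "A \<in> W1p_space p W" and B: "B \<in> W1p_space p W"
  note r = space_rep[OF A] space_rep[OF B]
  have d: "ennreal (W1p_dist p W A B) = W1p_norm p W (\<lambda>x. rep A x - rep B x)"
    using W1p_dist_ae_class[OF r(1) r(3)] by (simp only: r)
  show "W1p_dist p W A B = 0 \<longleftrightarrow> A = B"
  proof -
    have "W1p_dist p W A B = 0 \<longleftrightarrow> W1p_norm p W (\<lambda>x. rep A x - rep B x) = 0"
      unfolding d[symmetric] using W1p_dist_nonneg[of A B] by (simp add: ennreal_eq_0_iff)
    also have "\<dots> \<longleftrightarrow> (rep A, rep B) \<in> ae_rel p W"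
      unfolding W1p_norm_0_AE[OF r(1) r(3)] using r by (simp add: ae_rel_def)
    also have "\<dots> \<longleftrightarrow> ae_class (rep A) = ae_class (rep B)"
      using equiv_ae_rel r(1) r(3) by (simp only: eq_equiv_class_iff)
    finally show ?thesis by (simp only: r)
  qed
  assume C: "C \<in> W1p_space p W"
  note rC = space_rep[OF C]
  have "ennreal (W1p_dist p W A C) \<le> ennreal (W1p_dist p W A B) + ennreal (W1p_dist p W B C)"
    using W1p_dist_ae_class[OF r(1) rC(1)] W1p_dist_ae_class[OF r(3) rC(1)] d
      W1p_norm_triangle_diff[of "rep A" "rep B" "rep C"] W1pD(1)[OF r(1)] W1pD(1)[OF r(3)] W1pD(1)[OF rC(1)]
    by (simp only: r rC)
  then show "W1p_dist p W A C \<le> W1p_dist p W A B + W1p_dist p W B C"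
    using W1p_dist_nonneg by (simp add: ennreal_plus[symmetric] del: ennreal_plus)
qed

lemma MCauchy_rapid_subsequence:
  assumes "W1p.MCauchy \<sigma>"
  obtains r :: "nat \<Rightarrow> nat" where "strict_mono r" "\<And>k. W1p_dist p W (\<sigma> (r k)) (\<sigma> (r (Suc k))) < (1/2) ^ k"
proof -
  have "\<forall>k. \<exists>N. \<forall>n n'. N \<le> n \<longrightarrow> N \<le> n' \<longrightarrow> W1p_dist p W (\<sigma> n) (\<sigma> n') < (1/2) ^ k"
    using assms unfolding W1p.MCauchy_def by (simp add: zero_less_power)
  then obtain N where N: "\<And>k n n'. N k \<le> n \<Longrightarrow> N k \<le> n' \<Longrightarrow> W1p_dist p W (\<sigma> n) (\<sigma> n') < (1/2) ^ k"
    by metis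
  \<comment> \<open>The \<open>Suc n\<close> forces strict growth, the other argument of
    \<open>max\<close> passes the next Cauchy threshold.\<close>
  define r where "r = rec_nat (N 0) (\<lambda>k n. max (Suc n) (N (Suc k)))"
  have r0: "r 0 = N 0" and rS: "r (Suc k) = max (Suc (r k)) (N (Suc k))" for k
    by (simp_all add: r_def)
  have "strict_mono r"
    by (auto simp: strict_mono_Suc_iff rS)
  moreover have ge: "N k \<le> r k" for k
    by (cases k) (auto simp: r0 rS)
  moreover have "r k \<le> r (Suc k)" for k by (simp add: rS)
  ultimately show ?thesis
    using that N by (meson order_trans)
qed

lemma W1p_mcomplete: "W1p.mcomplete"
  unfolding W1p.mcomplete_def
proof safe
  fix \<sigma> assume cau: "W1p.MCauchy \<sigma>"
  obtain r where r: "strict_mono r" "\<And>k. W1p_dist p W (\<sigma> (r k)) (\<sigma> (r (Suc k))) < (1/2) ^ k"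
    using MCauchy_rapid_subsequence[OF cau] by blast
  have \<sigma>: "\<sigma> k \<in> W1p_space p W" for k
    using cau by (auto simp: W1p.MCauchy_def)
  define fs where "fs k = rep (\<sigma> (r k))" for k
  have fs: "fs k \<in> W1p p W" "ae_class (fs k) = \<sigma> (r k)" for k
    unfolding fs_def using space_rep[OF \<sigma>] by auto
  note fsl = W1pD(1)[OF fs(1)]
  have n: "W1p_norm p W (\<lambda>x. fs (Suc k) x - fs k x) \<le> ennreal ((1/2) ^ k)" for k
  proof -
    have "W1p_norm p W (\<lambda>x. fs (Suc k) x - fs k x) = W1p_norm p W (\<lambda>x. fs k x - fs (Suc k) x)"
      by (rule W1p_norm_minus_commute[OF fsl fsl])
    also have "\<dots> = ennreal (W1p_dist p W (\<sigma> (r k)) (\<sigma> (r (Suc k))))"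
      using W1p_dist_ae_class[OF fs(1)[of k] fs(1)[of "Suc k"]] by (simp only: fs(2))
    also have "\<dots> \<le> ennreal ((1/2) ^ k)"
      using r(2) by (intro ennreal_leI) (simp add: less_imp_le)
    finally show ?thesis .
  qed
  have n0: "Lp_norm p W (\<lambda>x. fs (Suc k) x - fs k x) \<le> ennreal ((1/2) ^ k)" for k
    by (rule order_trans[OF _ n]) (auto simp: W1p_norm_def)
  have nj: "Lp_norm p W (\<lambda>x. weak_partial j (fs (Suc k)) x - weak_partial j (fs k) x) \<le> ennreal ((1/2) ^ k)" for k j
  proof (rule order_trans[OF _ n])
    have "Lp_norm p W (\<lambda>x. weak_partial j (fs (Suc k)) x - weak_partial j (fs k) x)
      \<le> (\<Sum>j\<in>UNIV. Lp_norm p W (\<lambda>x. weak_partial j (fs (Suc k)) x - weak_partial j (fs k) x))"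
      by (rule member_le_sum) auto
    also have "\<dots> \<le> W1p_norm p W (\<lambda>x. fs (Suc k) x - fs k x)"
      unfolding W1p_norm_diff_eq[OF fsl fsl] by simp
    finally show "Lp_norm p W (\<lambda>x. weak_partial j (fs (Suc k)) x - weak_partial j (fs k) x)
      \<le> W1p_norm p W (\<lambda>x. fs (Suc k) x - fs k x)" .
  qed
  obtain f where f: "locally_integrable f" "L1loc_tendsto fs f"
    "\<And>k. Lp_norm p W (\<lambda>x. fs k x - f x) \<le> ennreal (4 * (1/2) ^ k)"
    by (rule Lp_complete[OF W11_locD(1)[OF fsl] n0]) blast
  have "\<exists>g. locally_integrable g \<and> L1loc_tendsto (\<lambda>k. weak_partial j (fs k)) g \<and>
    (\<forall>k. Lp_norm p W (\<lambda>x. weak_partial j (fs k) x - g x) \<le> ennreal (4 * (1/2) ^ k))" for j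
    by (rule Lp_complete[OF W11_locD(3)[OF fsl] nj[of j]]) (intro exI conjI allI)
  from choice[OF allI, OF this]
  obtain g where "\<forall>j. locally_integrable (g j) \<and> L1loc_tendsto (\<lambda>k. weak_partial j (fs k)) (g j) \<and>
    (\<forall>k. Lp_norm p W (\<lambda>x. weak_partial j (fs k) x - g j x) \<le> ennreal (4 * (1/2) ^ k))" ..
  then have g: "\<And>j. locally_integrable (g j)" "\<And>j. L1loc_tendsto (\<lambda>k. weak_partial j (fs k)) (g j)"
    "\<And>j k. Lp_norm p W (\<lambda>x. weak_partial j (fs k) x - g j x) \<le> ennreal (4 * (1/2) ^ k)"
    by simp_all
  \<comment> \<open>The limits \<open>f\<close> and \<open>g j\<close> were obtained independently
    of each other; convergence in the local L1 sense identifies each \<open>g j\<close> as a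
    derivative of \<open>f\<close>.\<close>
  have fg: "has_weak_partial_vec j f (g j)" for j
    by (rule has_weak_partial_vec_limit[OF W11_locD(2)[OF fsl] f(2) g(2) f(1) g(1)])
  have fl: "f \<in> W11_loc" using f(1) fg by (rule W11_locI)
  \<comment> \<open>\<open>Lp_complete\<close> leaves an error of 4 * (1/2)^k for the function and
    the same for each of the n derivatives.\<close>
  define c where "c = 4 + real CARD('n) * 4"
  have diff: "W1p_norm p W (\<lambda>x. fs k x - f x) \<le> ennreal (c * (1/2) ^ k)" for k
  proof -
    have "W1p_norm p W (\<lambda>x. fs k x - f x) = Lp_norm p W (\<lambda>x. fs k x - f x)
      + (\<Sum>j\<in>UNIV. Lp_norm p W (\<lambda>x. weak_partial j (fs k) x - g j x))"
      by (rule W1p_norm_eq) (intro has_weak_partial_vec_diff W11_locD fsl fg)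
    also have "\<dots> \<le> ennreal (4 * (1/2) ^ k) + (\<Sum>j\<in>(UNIV::'n set). ennreal (4 * (1/2) ^ k))"
      by (intro add_mono sum_mono f(3) g(3))
    also have "\<dots> = ennreal (c * (1/2) ^ k)"
      by (simp add: c_def ennreal_of_nat_eq_real_of_nat ennreal_mult[symmetric] ennreal_plus[symmetric] algebra_simps del: ennreal_plus)
    finally show ?thesis .
  qed
  have "W1p_norm p W f \<le> W1p_norm p W (\<lambda>x. f x - fs 0 x) + W1p_norm p W (fs 0)"
    by (rule W1p_norm_le_diff[OF fl fsl])
  also have "\<dots> < top"
    using diff[of 0] W1pD(2)[OF fs(1)[of 0]]
    unfolding W1p_norm_minus_commute[OF fl fsl] by (simp add: le_less_trans)
  finally have fW: "f \<in> W1p p W" using fl by (simp add: W1p_def)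
  have "limitin W1p.mtopology (\<sigma> \<circ> r) (ae_class f) sequentially"
    unfolding W1p.limit_metric_sequentially
  proof (intro conjI allI impI)
    show "ae_class f \<in> W1p_space p W" using fW by (rule ae_class_in_space)
    fix e :: real assume e: "0 < e"
    have "(\<lambda>k. c * (1/2) ^ k) \<longlonglongrightarrow> c * 0"
      by (intro tendsto_mult tendsto_const LIMSEQ_realpow_zero) auto
    then have "\<forall>\<^sub>F k in sequentially. c * (1/2) ^ k < e"
      using e by (intro order_tendstoD) auto
    then obtain N where N: "\<And>k. N \<le> k \<Longrightarrow> c * (1/2) ^ k < e"
      by (auto simp: eventually_sequentially)
    show "\<exists>N. \<forall>n\<ge>N. (\<sigma> \<circ> r) n \<in> W1p_space p W \<and> W1p_dist p W ((\<sigma> \<circ> r) n) (ae_class f) < e"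
    proof (intro exI allI impI conjI)
      fix n assume "N \<le> n"
      show "(\<sigma> \<circ> r) n \<in> W1p_space p W" using \<sigma> by simp
      have "ennreal (W1p_dist p W (\<sigma> (r n)) (ae_class f)) \<le> ennreal (c * (1/2) ^ n)"
        using diff[of n] W1p_dist_ae_class[OF fs(1) fW, of n] by (simp only: fs(2))
      then have "W1p_dist p W (\<sigma> (r n)) (ae_class f) \<le> c * (1/2) ^ n"
        by (subst (asm) ennreal_le_iff) (auto simp: c_def)
      with N[OF \<open>N \<le> n\<close>] show "W1p_dist p W ((\<sigma> \<circ> r) n) (ae_class f) < e" by simp
    qed
  qed
  from W1p.MCauchy_convergent_subsequence[OF cau r(1) this]
  show "\<exists>A. limitin W1p.mtopology \<sigma> A sequentially" ..
qed

end

subsection \<open>Averages over grid cells\<close>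

text \<open>Jensen's inequality for the power: \<open>powr_tangent\<close> with the mean as base
  point is integrated over \<open>C\<close>, and the linear term integrates to a multiple of the
  mean.\<close>

lemma powr_average_le:
  fixes a :: "'a \<Rightarrow> real" and q \<mu> :: real
  assumes C: "C \<in> sets M" "emeasure M C = ennreal \<mu>" "0 < \<mu>" and q: "1 < q"
    and a: "\<And>y. 0 \<le> a y" "a \<in> borel_measurable M" and int: "integrable M (\<lambda>y. indicator C y * a y)"
  shows "ennreal ((1 / \<mu> * (\<integral>y. indicator C y * a y \<partial>M)) powr q)
    \<le> ennreal (1 / \<mu>) * (\<integral>\<^sup>+y. indicator C y * ennreal (a y powr q) \<partial>M)"
proof -
  define b where "b = 1 / \<mu> * (\<integral>y. indicator C y * a y \<partial>M)"
  define X where "X = (\<integral>\<^sup>+y. indicator C y * ennreal (a y powr q) \<partial>M)"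
  have b0: "0 \<le> b" unfolding b_def using a(1) C(3) by (auto intro!: mult_nonneg_nonneg integral_nonneg_AE)
  have "ennreal (b powr q) \<le> ennreal (1 / \<mu>) * X"
  \<comment> \<open>The tangent needs a positive base point, and only \<open>a\<close> itself is
    integrable on \<open>C\<close>, so the integral \<open>X\<close> of the powers may be
    infinite.\<close>
  proof (cases "b = 0 \<or> X = top")
    case True
    then show ?thesis using q C(3) by (auto simp: ennreal_mult_top)
  next
    case False
    then have b: "0 < b" using b0 by auto
    obtain r where r: "X = ennreal r" "0 \<le> r" using False by (cases X rule: ennreal_cases) auto
    have mC [measurable]: "C \<in> sets M" "a \<in> borel_measurable M" using C a by auto
    have "ennreal (q * b powr (q - 1) * (\<mu> * b)) = (\<integral>\<^sup>+y. ennreal (q * b powr (q - 1) * (indicator C y * a y)) \<partial>M)"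
    proof -
      have "(\<integral>\<^sup>+y. ennreal (q * b powr (q - 1) * (indicator C y * a y)) \<partial>M)
        = ennreal (\<integral>y. q * b powr (q - 1) * (indicator C y * a y) \<partial>M)"
        using int a(1) q by (intro nn_integral_eq_integral) auto
      also have "(\<integral>y. q * b powr (q - 1) * (indicator C y * a y) \<partial>M) = q * b powr (q - 1) * (\<mu> * b)"
        using C(3) by (simp add: b_def)
      finally show ?thesis by simp
    qed
    also have "\<dots> \<le> (\<integral>\<^sup>+y. indicator C y * ennreal (a y powr q) + ennreal ((q - 1) * b powr q) * indicator C y \<partial>M)"
    proof (rule nn_integral_mono)
      fix y
      show "ennreal (q * b powr (q - 1) * (indicator C y * a y))
        \<le> indicator C y * ennreal (a y powr q) + ennreal ((q - 1) * b powr q) * indicator C y"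
        using powr_tangent[OF a(1) b q, of y] q
        by (auto simp: indicator_def ennreal_plus[symmetric] simp del: ennreal_plus intro!: ennreal_leI)
    qed
    also have "\<dots> = X + ennreal ((q - 1) * b powr q) * ennreal \<mu>"
      unfolding X_def by (subst nn_integral_add) (auto simp: nn_integral_cmult_indicator C(2))
    also have "\<dots> = ennreal (r + (q - 1) * b powr q * \<mu>)"
      using r q C(3) by (simp add: ennreal_mult[symmetric] ennreal_plus[symmetric] del: ennreal_plus)
    finally have "q * b powr (q - 1) * (\<mu> * b) \<le> r + (q - 1) * b powr q * \<mu>"
      using r q C(3) by (subst (asm) ennreal_le_iff) auto
    moreover have "q * b powr (q - 1) * (\<mu> * b) = q * \<mu> * b powr q"
      using b by (simp add: powr_diff)
    ultimately have "q * \<mu> * b powr q \<le> r + (q - 1) * b powr q * \<mu>" by simp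
    then have "b powr q * \<mu> \<le> r" by (simp add: algebra_simps)
    then have "b powr q \<le> r / \<mu>"
      using C(3) by (simp add: pos_le_divide_eq)
    then show ?thesis
      using r C(3) by (simp add: ennreal_mult[symmetric] ennreal_leI)
  qed
  then show ?thesis by (simp add: b_def X_def)
qed

text \<open>Prepares Tonelli's theorem: composing with sums of variables and forming products is
  done for Borel functions, and null sets are dealt with afterwards.\<close>

lemma ex_borel_vec:
  fixes f :: "real^'n \<Rightarrow> real^'m"
  assumes "\<And>i. (\<lambda>x. f x $ i) \<in> borel_measurable lebesgue"
  shows "\<exists>f'\<in>borel_measurable borel. AE x in lebesgue. f x = f' x"
proof -
  have "\<forall>i. \<exists>g. g \<in> borel_measurable borel \<and> (AE x in lborel. f x $ i = g x)"
    using completion_ex_borel_measurable_real[OF assms] by auto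
  then obtain g where g: "\<And>i. g i \<in> borel_measurable borel" "\<And>i. AE x in lborel. f x $ i = g i x"
    by metis
  have "(\<lambda>x. \<chi> i. g i x) \<in> borel_measurable borel"
    by (rule borel_measurable_vec) (simp add: g(1))
  moreover have "AE x in lebesgue. f x = (\<chi> i. g i x)"
  proof (rule AE_completion)
    have "AE x in lborel. \<forall>i. f x $ i = g i x"
      unfolding AE_all_countable using g(2) by blast
    then show "AE x in lborel. f x = (\<chi> i. g i x)"
      by eventually_elim (simp add: vec_eq_iff)
  qed
  ultimately show ?thesis by (intro bexI)
qed

text \<open>Half-open cubes of side \<open>h\<close> when \<open>h\<close> is positive. Indexing by
  floors makes it immediate that every point lies in exactly one of them.\<close>

definition grid_cell :: "real \<Rightarrow> ('n \<Rightarrow> int) \<Rightarrow> (real^'n) set" where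
  "grid_cell h k = {y. \<forall>i. \<lfloor>y $ i / h\<rfloor> = k i}"

definition cell_avg :: "real \<Rightarrow> (real^'n \<Rightarrow> real^'m) \<Rightarrow> ('n \<Rightarrow> int) \<Rightarrow> real^'m" where
  "cell_avg h f k = (1 / h ^ CARD('n)) *\<^sub>R (\<integral>y. indicator (grid_cell h k) y *\<^sub>R f y \<partial>lebesgue)"

definition grid_approx :: "real \<Rightarrow> ('n \<Rightarrow> int) set \<Rightarrow> (real^'n \<Rightarrow> real^'m) \<Rightarrow> real^'n \<Rightarrow> real^'m" where
  "grid_approx h I f x = (\<Sum>k\<in>I. indicator (grid_cell h k) x *\<^sub>R cell_avg h f k)"

lemma grid_cell_iff:
  assumes "0 < h"
  shows "y \<in> grid_cell h k \<longleftrightarrow> (\<forall>i. h * real_of_int (k i) \<le> y $ i \<and> y $ i < h * (real_of_int (k i) + 1))"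
  using assms by (simp add: grid_cell_def floor_eq_iff field_simps)

lemma grid_cell_borel:
  assumes "0 < h"
  shows "grid_cell h k \<in> sets borel"
proof -
  have "grid_cell h k = (\<Inter>i. {y. y $ i \<ge> h * real_of_int (k i)} \<inter> {y. y $ i < h * (real_of_int (k i) + 1)})"
    by (auto simp: grid_cell_iff[OF assms])
  also have "\<dots> \<in> sets borel"
    by (intro sets.countable_INT' sets.Int borel_closed borel_open
        closed_halfspace_component_ge_cart open_halfspace_component_lt_cart) auto
  finally show ?thesis .
qed

lemma grid_cell_lebesgue: "0 < h \<Longrightarrow> grid_cell h k \<in> sets lebesgue"
  by (intro sets_completionI_sets) (simp add: grid_cell_borel)

lemma emeasure_vec_box:
  fixes a b :: "real^'n"
  assumes "\<And>i. b $ i - a $ i = s" "0 \<le> s"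
  shows "emeasure lborel (cbox a b) = ennreal (s ^ CARD('n))" "emeasure lborel (box a b) = ennreal (s ^ CARD('n))"
proof -
  have le: "\<forall>i\<in>Basis. a \<bullet> i \<le> b \<bullet> i"
    using assms by (auto simp: Basis_vec_def inner_axis) (metis diff_ge_0_iff_ge)
  have "(\<Prod>i\<in>Basis. (b - a) \<bullet> i) = (\<Prod>i\<in>(Basis :: (real^'n) set). s)"
    using assms by (intro prod.cong) (auto simp: Basis_vec_def inner_axis)
  with le show "emeasure lborel (cbox a b) = ennreal (s ^ CARD('n))" "emeasure lborel (box a b) = ennreal (s ^ CARD('n))"
    by (simp_all add: emeasure_lborel_cbox_eq emeasure_lborel_box_eq)
qed

text \<open>The half-open cell is squeezed between an open and a closed box of equal
  measure.\<close>

lemma emeasure_grid_cell: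
  fixes k :: "'n::finite \<Rightarrow> int"
  assumes "0 < h"
  shows "emeasure lebesgue (grid_cell h k) = ennreal (h ^ CARD('n))"
proof -
  define a b :: "real^'n" where "a = (\<chi> i. h * real_of_int (k i))" and "b = (\<chi> i. h * (real_of_int (k i) + 1))"
  have ab: "b $ i - a $ i = h" for i by (simp add: a_def b_def algebra_simps)
  have sub: "box a b \<subseteq> grid_cell h k" "grid_cell h k \<subseteq> cbox a b"
    by (auto simp: grid_cell_iff[OF assms] mem_box_cart a_def b_def less_imp_le)
  have "emeasure lborel (box a b) \<le> emeasure lborel (grid_cell h k)"
    "emeasure lborel (grid_cell h k) \<le> emeasure lborel (cbox a b)"
    using sub grid_cell_borel[OF assms, of k] by (auto intro!: emeasure_mono)
  then have "emeasure lborel (grid_cell h k) = ennreal (h ^ CARD('n))"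
    using emeasure_vec_box[OF ab] assms by (simp add: antisym)
  then show ?thesis
    using grid_cell_borel[OF assms, of k] by simp
qed

lemma bounded_grid_cell:
  assumes "0 < h"
  shows "bounded (grid_cell h k)"
  by (rule bounded_subset[OF bounded_cbox[of "\<chi> i. h * real_of_int (k i)" "\<chi> i. h * (real_of_int (k i) + 1)"]])
    (auto simp: grid_cell_iff[OF assms] mem_box_cart less_imp_le)

text \<open>Seen from one of its points, a cell occupies part of the cube of side 2h centred there;
  comparing the two volumes is the origin of the factor 2^n.\<close>

lemma grid_cell_diff:
  assumes "0 < h" "x \<in> grid_cell h k" "y \<in> grid_cell h k"
  shows "y - x \<in> cbox (\<chi> i. - h) (\<chi> i. h)"
proof -
  have "- h \<le> y $ i - x $ i \<and> y $ i - x $ i \<le> h" for i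
  proof -
    have "h * real_of_int (k i) \<le> x $ i" "x $ i < h * (real_of_int (k i) + 1)"
      "h * real_of_int (k i) \<le> y $ i" "y $ i < h * (real_of_int (k i) + 1)"
      using assms(2,3) by (auto simp: grid_cell_iff[OF assms(1)])
    then show ?thesis by (simp add: distrib_left)
  qed
  then show ?thesis by (simp add: mem_box_cart)
qed

lemma integrable_grid_cell:
  fixes f :: "real^'n \<Rightarrow> 'b::euclidean_space"
  assumes "locally_integrable f" "0 < h"
  shows "integrable lebesgue (\<lambda>y. indicator (grid_cell h k) y *\<^sub>R f y)"
proof -
  let ?K = "closure (grid_cell h k)"
  have "integrable lebesgue (\<lambda>y. indicator (grid_cell h k) y *\<^sub>R (indicator ?K y *\<^sub>R f y))"
    using bounded_grid_cell[OF assms(2)] assms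
    by (intro integrable_mult_indicator grid_cell_lebesgue locally_integrableD) auto
  moreover have "(\<lambda>y. indicator (grid_cell h k) y *\<^sub>R (indicator ?K y *\<^sub>R f y)) = (\<lambda>y. indicator (grid_cell h k) y *\<^sub>R f y)"
    using closure_subset[of "grid_cell h k"] by (auto simp: fun_eq_iff indicator_def)
  ultimately show ?thesis by simp
qed

lemma grid_approx_eq:
  assumes "finite I" "k \<in> I" "x \<in> grid_cell h k"
  shows "grid_approx h I f x = cell_avg h f k"
proof -
  have "grid_approx h I f x = (\<Sum>k'\<in>I. if k' = k then cell_avg h f k else 0)"
    unfolding grid_approx_def using assms(3)
    by (intro sum.cong refl) (auto simp: indicator_def grid_cell_def)
  then show ?thesis using assms by simp
qed

lemma grid_approx_measurable: "0 < h \<Longrightarrow> grid_approx h I f \<in> borel_measurable lebesgue"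
  unfolding grid_approx_def[abs_def]
  by (intro borel_measurable_sum borel_measurable_scaleR borel_measurable_indicator grid_cell_lebesgue) auto

context Ap_weight
begin

text \<open>For fixed \<open>x\<close> the matrix \<open>W x\<close> is a constant linear map and
  passes through the integral over \<open>y\<close>, so the weight is never evaluated at
  \<open>y\<close>.\<close>

lemma norm_diff_cell_avg_le:
  assumes f: "locally_integrable f" and h: "0 < h"
  shows "integrable lebesgue (\<lambda>y. indicator (grid_cell h k) y * norm (W x *v (f x - f y)))"
    and "norm (W x *v (f x - cell_avg h f k))
      \<le> 1 / h ^ CARD('n) * (\<integral>y. indicator (grid_cell h k) y * norm (W x *v (f x - f y)) \<partial>lebesgue)"
proof -
  let ?C = "grid_cell h k"
  have bl: "bounded_linear (\<lambda>v. W x *v v)" by (rule matrix_vector_mul_bounded_linear)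
  have m: "measure lebesgue ?C = h ^ CARD('n)"
    using emeasure_grid_cell[OF h, of k] h by (simp add: measure_def del: emeasure_completion measure_completion)
  have c: "integrable lebesgue (\<lambda>y. indicator ?C y *\<^sub>R f x)"
    using emeasure_grid_cell[OF h, of k] grid_cell_lebesgue[OF h]
    by (intro integrable_scaleR_left) (auto simp: integrable_indicator_iff simp del: emeasure_completion)
  have i: "integrable lebesgue (\<lambda>y. indicator ?C y *\<^sub>R (f x - f y))"
    using Bochner_Integration.integrable_diff[OF c integrable_grid_cell[OF f h, of k]]
    by (simp add: scaleR_diff_right)
  have e: "norm (W x *v (indicator ?C y *\<^sub>R (f x - f y))) = indicator ?C y * norm (W x *v (f x - f y))" for y
    by (auto simp: indicator_def)
  show "integrable lebesgue (\<lambda>y. indicator ?C y * norm (W x *v (f x - f y)))"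
    using integrable_norm[OF integrable_bounded_linear[OF bl i]] unfolding e .
  have "(\<integral>y. indicator ?C y *\<^sub>R (f x - f y) \<partial>lebesgue)
    = (\<integral>y. indicator ?C y *\<^sub>R f x \<partial>lebesgue) - (\<integral>y. indicator ?C y *\<^sub>R f y \<partial>lebesgue)"
    using Bochner_Integration.integral_diff[OF c integrable_grid_cell[OF f h, of k]]
    by (simp add: scaleR_diff_right)
  also have "(\<integral>y. indicator ?C y *\<^sub>R f x \<partial>lebesgue) = h ^ CARD('n) *\<^sub>R f x"
    using emeasure_grid_cell[OF h, of k] grid_cell_lebesgue[OF h, of k]
    by (subst integral_scaleR_left) (auto simp: integrable_indicator_iff m simp del: emeasure_completion measure_completion)
  finally have "f x - cell_avg h f k = (1 / h ^ CARD('n)) *\<^sub>R (\<integral>y. indicator ?C y *\<^sub>R (f x - f y) \<partial>lebesgue)"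
    using h by (simp add: cell_avg_def scaleR_diff_right)
  then have "norm (W x *v (f x - cell_avg h f k))
    = 1 / h ^ CARD('n) * norm (W x *v (\<integral>y. indicator ?C y *\<^sub>R (f x - f y) \<partial>lebesgue))"
    using h by (simp add: linear_scale[OF bounded_linear.linear[OF bl]])
  also have "W x *v (\<integral>y. indicator ?C y *\<^sub>R (f x - f y) \<partial>lebesgue)
    = (\<integral>y. W x *v (indicator ?C y *\<^sub>R (f x - f y)) \<partial>lebesgue)"
    using integral_bounded_linear[OF bl i] by simp
  also have "1 / h ^ CARD('n) * norm \<dots> \<le> 1 / h ^ CARD('n) * (\<integral>y. norm (W x *v (indicator ?C y *\<^sub>R (f x - f y))) \<partial>lebesgue)"
    using h by (intro mult_left_mono integral_norm_bound) auto
  finally show "norm (W x *v (f x - cell_avg h f k))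
      \<le> 1 / h ^ CARD('n) * (\<integral>y. indicator ?C y * norm (W x *v (f x - f y)) \<partial>lebesgue)"
    unfolding e .
qed

text \<open>The hypothesis bounds one integral over \<open>x\<close> for each shift
  \<open>z\<close>. Integrating over the cube of shifts, of volume (2h)^n, and exchanging the order
  controls the function of \<open>x\<close> that Jensen's inequality produces in
  \<open>modular_grid_approx\<close>.\<close>

lemma double_modular_bound:
  assumes f: "f \<in> borel_measurable lebesgue" and h: "0 < h" and l: "0 < l"
    and hyp: "\<And>z. z \<in> cbox (\<chi> i. - h) (\<chi> i. h) \<Longrightarrow> modular p (\<lambda>x. norm (W x *v (f x - f (x + z))) / l) \<le> 1"
  obtains J where "J \<in> borel_measurable lebesgue" "(\<integral>\<^sup>+x. J x \<partial>lebesgue) \<le> ennreal ((2 * h) ^ CARD('n))"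
    "AE x in lebesgue. J x = (\<integral>\<^sup>+z. indicator (cbox (\<chi> i. - h) (\<chi> i. h)) z
        * ennreal ((norm (W x *v (f x - f (z + x))) / l) powr p x) \<partial>lebesgue)"
proof -
  let ?B = "cbox (\<chi> i. - h) (\<chi> i. h) :: (real^'n) set"
  obtain f' where f': "f' \<in> borel_measurable borel" "AE x in lebesgue. f x = f' x"
    using ex_borel_vec[of f] borel_measurable_vec_nth[OF f] by blast
  obtain p' where p': "p' \<in> borel_measurable borel" "AE x in lebesgue. p x = p' x"
    using completion_ex_borel_measurable_real[OF p_measurable] AE_completion by auto
  have "\<forall>i. \<exists>g. g \<in> borel_measurable borel \<and> (AE x in lebesgue. W x $ i = g x)"
  proof
    fix i
    show "\<exists>g. g \<in> borel_measurable borel \<and> (AE x in lebesgue. W x $ i = g x)"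
      using ex_borel_vec[of "\<lambda>x. W x $ i"] weight locally_integrable_measurable
      unfolding matrix_weight_def by blast
  qed
  then obtain V where V: "\<And>i. V i \<in> borel_measurable borel" "\<And>i. AE x in lebesgue. W x $ i = V i x"
    by metis
  define W' where "W' x = (\<chi> i. V i x)" for x
  have W': "AE x in lebesgue. W x = W' x"
  proof -
    have "AE x in lebesgue. \<forall>i. W x $ i = V i x"
      unfolding AE_all_countable using V(2) by blast
    then show ?thesis by eventually_elim (simp add: vec_eq_iff W'_def)
  qed
  \<comment> \<open>The integrand is formed from the Borel versions to be measurable on the product.
    Agreement with the given \<open>f\<close>, \<open>p\<close> and \<open>W\<close> is checked on
    sections, where translates of null sets are again null.\<close>
  define H where "H = (\<lambda>(x, z). indicator ?B z * ennreal ((norm (W' x *v (f' x - f' (z + x))) / l) powr p' x))"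
  have H: "H \<in> borel_measurable (lborel \<Otimes>\<^sub>M lborel)"
  proof -
    have [measurable]: "f' \<in> borel_measurable borel" "p' \<in> borel_measurable borel" "?B \<in> sets borel"
      using f' p' by auto
    have [measurable]: "(\<lambda>w. W' (fst w) $ i $ j) \<in> borel_measurable (lborel \<Otimes>\<^sub>M lborel)" for i j
    proof -
      have "(\<lambda>x. W' x $ i $ j) \<in> borel_measurable borel"
        using borel_measurable_vec_nth[OF V(1)] by (simp add: W'_def)
      then show ?thesis by measurable
    qed
    have "(\<lambda>w. W' (fst w) *v (f' (fst w) - f' (snd w + fst w))) \<in> borel_measurable (lborel \<Otimes>\<^sub>M lborel)"
      by (rule borel_measurable_matrix_vector) measurable
    then show ?thesis
      unfolding H_def split_beta' by measurable
  qed
  define J where "J x = (\<integral>\<^sup>+z. H (x, z) \<partial>lborel)" for x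
  have "J \<in> borel_measurable lborel"
    unfolding J_def by (rule lborel.borel_measurable_nn_integral_fst[OF H])
  then have Jm: "J \<in> borel_measurable lebesgue" by (rule measurable_completion)
  have Hz: "(\<integral>\<^sup>+x. H (x, z) \<partial>lborel) \<le> indicator ?B z" for z
  proof (cases "z \<in> ?B")
    case False
    then show ?thesis by (simp add: H_def)
  next
    case True
    have "(\<integral>\<^sup>+x. H (x, z) \<partial>lborel) = (\<integral>\<^sup>+x. H (x, z) \<partial>lebesgue)"
      by (simp add: nn_integral_completion)
    also have "\<dots> = modular p (\<lambda>x. norm (W x *v (f x - f (x + z))) / l)"
      unfolding modular_def
    proof (rule nn_integral_cong_AE)
      show "AE x in lebesgue. H (x, z) = ennreal (\<bar>norm (W x *v (f x - f (x + z))) / l\<bar> powr p x)"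
        using f'(2) p'(2) W' AE_translation[OF f'(2), of z]
        by eventually_elim (use True l in \<open>simp add: H_def add.commute\<close>)
    qed
    also have "\<dots> \<le> 1" using True by (rule hyp)
    finally show ?thesis using True by simp
  qed
  have "(\<integral>\<^sup>+x. J x \<partial>lebesgue) = (\<integral>\<^sup>+x. \<integral>\<^sup>+z. H (x, z) \<partial>lborel \<partial>lborel)"
    by (simp add: nn_integral_completion J_def)
  also have "\<dots> = (\<integral>\<^sup>+z. \<integral>\<^sup>+x. H (x, z) \<partial>lborel \<partial>lborel)"
    by (rule lborel_pair.Fubini[OF H, symmetric])
  also have "\<dots> \<le> (\<integral>\<^sup>+z. indicator ?B z \<partial>lborel)"
    by (intro nn_integral_mono Hz)
  also have "\<dots> = emeasure lborel ?B"
    by simp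
  also have "\<dots> = ennreal ((2 * h) ^ CARD('n))"
    using h by (intro emeasure_vec_box) auto
  finally have J2: "(\<integral>\<^sup>+x. J x \<partial>lebesgue) \<le> ennreal ((2 * h) ^ CARD('n))" .
  have "AE x in lebesgue. J x = (\<integral>\<^sup>+z. indicator ?B z * ennreal ((norm (W x *v (f x - f (z + x))) / l) powr p x) \<partial>lebesgue)"
    using f'(2) p'(2) W'
  proof eventually_elim
    case (elim x)
    have "J x = (\<integral>\<^sup>+z. H (x, z) \<partial>lebesgue)"
      by (simp add: nn_integral_completion J_def)
    also have "\<dots> = (\<integral>\<^sup>+z. indicator ?B z * ennreal ((norm (W x *v (f x - f (z + x))) / l) powr p x) \<partial>lebesgue)"
    proof (rule nn_integral_cong_AE)
      show "AE z in lebesgue. H (x, z) = indicator ?B z * ennreal ((norm (W x *v (f x - f (z + x))) / l) powr p x)"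
        using AE_translation[OF f'(2), of x] by eventually_elim (simp add: H_def elim)
    qed
    finally show ?case .
  qed
  with Jm J2 show ?thesis by (rule that)
qed

text \<open>For \<open>x\<close> in a cell, Jensen's inequality with the exponent \<open>p x\<close>
  bounds the power of the error by the mean over the cell of the powers of |W(x) (f(x) - f(y))| / l.
  Enlarging the cell to the cube of side 2h around \<open>x\<close> gives J(x) / h^n. As the
  exponent exceeds 1, the extra divisor 2^n inside the power gains at least 2^n, and the integral of
  \<open>J\<close> is at most (2h)^n.\<close>

lemma modular_grid_approx:
  fixes I :: "('n \<Rightarrow> int) set"
  assumes f: "locally_integrable f" and h: "0 < h" and l: "0 < l" and I: "finite I"
    and hyp: "\<And>z. z \<in> cbox (\<chi> i. - h) (\<chi> i. h) \<Longrightarrow> modular p (\<lambda>x. norm (W x *v (f x - f (x + z))) / l) \<le> 1"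
  shows "modular p (\<lambda>x. indicator (\<Union>k\<in>I. grid_cell h k) x * norm (W x *v (f x - grid_approx h I f x)) / (2 ^ CARD('n) * l)) \<le> 1"
proof -
  let ?n = "CARD('n)" and ?B = "cbox (\<chi> i. - h) (\<chi> i. h) :: (real^'n) set"
  have fm: "f \<in> borel_measurable lebesgue" using f by (rule locally_integrable_measurable)
  obtain J where J: "J \<in> borel_measurable lebesgue" "(\<integral>\<^sup>+x. J x \<partial>lebesgue) \<le> ennreal ((2 * h) ^ ?n)"
    "AE x in lebesgue. J x = (\<integral>\<^sup>+z. indicator ?B z * ennreal ((norm (W x *v (f x - f (z + x))) / l) powr p x) \<partial>lebesgue)"
    by (rule double_modular_bound[OF fm h l hyp]) blast+
  have "modular p (\<lambda>x. indicator (\<Union>k\<in>I. grid_cell h k) x * norm (W x *v (f x - grid_approx h I f x)) / (2 ^ ?n * l))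
    \<le> (\<integral>\<^sup>+x. ennreal (1 / (2 * h) ^ ?n) * J x \<partial>lebesgue)"
    unfolding modular_def
  proof (rule nn_integral_mono_AE)
    show "AE x in lebesgue. ennreal (\<bar>indicator (\<Union>k\<in>I. grid_cell h k) x * norm (W x *v (f x - grid_approx h I f x)) / (2 ^ ?n * l)\<bar> powr p x)
      \<le> ennreal (1 / (2 * h) ^ ?n) * J x"
      using J(3) p_gt_1
    proof eventually_elim
      case (elim x)
      show ?case
      proof (cases "x \<in> (\<Union>k\<in>I. grid_cell h k)")
        case False
        then show ?thesis by simp
      next
        case True
        then obtain k where k: "k \<in> I" "x \<in> grid_cell h k" by blast
        define a where "a y = norm (W x *v (f x - f y)) / l" for y
        have am: "a \<in> borel_measurable lebesgue"
        proof -
          have "(\<lambda>y. W x *v (f x - f y)) \<in> borel_measurable lebesgue"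
            using fm by (intro borel_measurable_matrix_vector borel_measurable_diff) auto
          then show ?thesis unfolding a_def by measurable
        qed
        have a0: "0 \<le> a y" for y using l by (simp add: a_def)
        note na = norm_diff_cell_avg_le[OF f h, where k = k and x = x]
        have ai: "integrable lebesgue (\<lambda>y. indicator (grid_cell h k) y * a y)"
          using integrable_divide[OF na(1), of l] by (simp add: a_def)
        have b: "norm (W x *v (f x - grid_approx h I f x)) / l
          \<le> 1 / h ^ ?n * (\<integral>y. indicator (grid_cell h k) y * a y \<partial>lebesgue)"
          using divide_right_mono[OF na(2), of l] l grid_approx_eq[OF I k, of f] by (simp add: a_def)
        have "(norm (W x *v (f x - grid_approx h I f x)) / (2 ^ ?n * l)) powr p x
          = (norm (W x *v (f x - grid_approx h I f x)) / l) powr p x / (2 ^ ?n) powr p x"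
          using l by (subst powr_divide[symmetric]) (auto simp: mult.commute)
        also have "\<dots> \<le> (norm (W x *v (f x - grid_approx h I f x)) / l) powr p x / 2 ^ ?n"
        proof (rule divide_left_mono)
          have "(2 ^ ?n) powr 1 \<le> (2 ^ ?n :: real) powr p x"
            using elim by (intro powr_mono) auto
          then show "2 ^ ?n \<le> (2 ^ ?n :: real) powr p x" by simp
        qed auto
        also have "\<dots> \<le> (1 / h ^ ?n * (\<integral>y. indicator (grid_cell h k) y * a y \<partial>lebesgue)) powr p x / 2 ^ ?n"
          using elim l b by (intro divide_right_mono powr_mono2) auto
        finally have "ennreal ((norm (W x *v (f x - grid_approx h I f x)) / (2 ^ ?n * l)) powr p x)
          \<le> ennreal (1 / 2 ^ ?n * (1 / h ^ ?n * (\<integral>y. indicator (grid_cell h k) y * a y \<partial>lebesgue)) powr p x)"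
          by (intro ennreal_leI) simp
        also have "\<dots> = ennreal (1 / 2 ^ ?n) * ennreal ((1 / h ^ ?n * (\<integral>y. indicator (grid_cell h k) y * a y \<partial>lebesgue)) powr p x)"
          by (rule ennreal_mult) auto
        also have "\<dots> \<le> ennreal (1 / 2 ^ ?n) * (ennreal (1 / h ^ ?n) * (\<integral>\<^sup>+y. indicator (grid_cell h k) y * ennreal (a y powr p x) \<partial>lebesgue))"
          using h l elim
          by (intro mult_left_mono powr_average_le grid_cell_lebesgue emeasure_grid_cell am ai)
            (auto simp: a0)
        also have "\<dots> = ennreal (1 / (2 * h) ^ ?n) * (\<integral>\<^sup>+y. indicator (grid_cell h k) y * ennreal (a y powr p x) \<partial>lebesgue)"
          using h by (simp add: mult.assoc[symmetric] ennreal_mult[symmetric] power_mult_distrib)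
        also have "(\<integral>\<^sup>+y. indicator (grid_cell h k) y * ennreal (a y powr p x) \<partial>lebesgue)
          \<le> (\<integral>\<^sup>+y. indicator ?B (y - x) * ennreal (a y powr p x) \<partial>lebesgue)"
          using grid_cell_diff[OF h k(2)] by (intro nn_integral_mono mult_right_mono) (auto simp: indicator_def)
        also have "\<dots> = (\<integral>\<^sup>+z. indicator ?B (z + x - x) * ennreal (a (z + x) powr p x) \<partial>lebesgue)"
        proof (rule nn_integral_translation[symmetric])
          have "(\<lambda>y. indicator ?B (y + - x) :: ennreal) \<in> borel_measurable lebesgue"
            by (intro measurable_translation_lebesgue borel_measurable_indicator) simp
          then show "(\<lambda>y. indicator ?B (y - x) * ennreal (a y powr p x)) \<in> borel_measurable lebesgue"
            using am by simp
        qed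
        also have "\<dots> = J x"
          using elim by (simp add: a_def)
        finally show ?thesis using True l by (simp add: mult_left_mono)
      qed
    qed
  qed
  also have "\<dots> = ennreal (1 / (2 * h) ^ ?n) * (\<integral>\<^sup>+x. J x \<partial>lebesgue)"
    using J(1) by (rule nn_integral_cmult)
  also have "\<dots> \<le> ennreal (1 / (2 * h) ^ ?n) * ennreal ((2 * h) ^ ?n)"
    by (intro mult_left_mono J(2)) auto
  also have "\<dots> = 1"
    using h by (simp add: ennreal_mult[symmetric])
  finally show ?thesis .
qed

end

subsection \<open>Total boundedness\<close>

text \<open>The net is delivered as a rounding map, so that the rounded averages of a function can
  serve as its label.\<close>

lemma finite_net_map:
  fixes S :: "('a::heine_borel) set"
  assumes "bounded S" "0 < e"
  obtains N and q :: "'a \<Rightarrow> 'a" where "finite N" "\<And>x. x \<in> S \<Longrightarrow> q x \<in> N \<and> dist x (q x) < e"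
proof -
  have "compact (closure S)" using assms(1) by simp
  then obtain N where N: "finite N" "closure S \<subseteq> (\<Union>x\<in>N. ball x e)"
    using assms(2) by (metis compact_eq_totally_bounded)
  have "\<exists>y\<in>N. dist x y < e" if "x \<in> S" for x
  proof -
    have "x \<in> (\<Union>x\<in>N. ball x e)" using that N(2) closure_subset by blast
    then show ?thesis by (auto simp: dist_commute)
  qed
  then have "\<forall>x. \<exists>y. x \<in> S \<longrightarrow> y \<in> N \<and> dist x y < e" by blast
  then obtain q where "\<forall>x. x \<in> S \<longrightarrow> q x \<in> N \<and> dist x (q x) < e"
    by (rule choice[THEN exE])
  then show ?thesis using that N(1) by blast
qed

text \<open>The cube \<open>Q\<close> is the common domain on which the averages and the weight are
  estimated later.\<close>

lemma finite_grid:
  assumes h: "0 < h"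
  obtains I :: "('n::finite \<Rightarrow> int) set" and Q where "finite I" "ball 0 R \<subseteq> (\<Union>k\<in>I. grid_cell h k)"
    "Q \<in> cubes" "(\<Union>k\<in>I. grid_cell h k) \<subseteq> Q"
proof -
  define N where "N = \<lceil>R / h\<rceil>"
  define I where "I = (UNIV :: 'n set) \<rightarrow>\<^sub>E {- N - 1..N}"
  have I: "finite I" unfolding I_def by (intro finite_PiE) auto
  have R: "ball 0 R \<subseteq> (\<Union>k\<in>I. grid_cell h k)"
  proof
    fix x :: "real^'n" assume "x \<in> ball 0 R"
    then have "norm x < R" by simp
    have "\<lfloor>x $ i / h\<rfloor> \<in> {- N - 1..N}" for i
    proof -
      have "\<bar>x $ i\<bar> < R" using component_le_norm_cart[of x i] \<open>norm x < R\<close> by linarith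
      then have "\<bar>x $ i / h\<bar> \<le> R / h" using h by (simp add: divide_right_mono)
      also have "R / h \<le> real_of_int N" by (simp add: N_def)
      finally have "x $ i / h \<le> real_of_int N" "- real_of_int N \<le> x $ i / h"
        by (simp_all only: abs_le_iff minus_le_iff)
      then show ?thesis
        by (auto simp: le_floor_iff floor_le_iff)
    qed
    then have "(\<lambda>i. \<lfloor>x $ i / h\<rfloor>) \<in> I" by (simp add: I_def PiE_UNIV_domain)
    then show "x \<in> (\<Union>k\<in>I. grid_cell h k)" by (force simp: grid_cell_def)
  qed
  have "bounded (\<Union>k\<in>I. grid_cell h k)"
    using I by (intro bounded_UN ballI bounded_grid_cell h)
  then obtain Q where "Q \<in> cubes" "(\<Union>k\<in>I. grid_cell h k) \<subseteq> Q"
    by (rule bounded_subset_cube)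
  with I R show ?thesis by (rule that)
qed

context Ap_weight
begin

lemma rnorm_sum:
  assumes "\<And>j. j \<in> A \<Longrightarrow> u j \<in> borel_measurable lebesgue"
  shows "rnorm p (\<lambda>x. \<Sum>j\<in>A. u j x) \<le> (\<Sum>j\<in>A. rnorm p (u j))"
  using assms
proof (induction A rule: infinite_finite_induct)
  case (insert j A)
  have "rnorm p (\<lambda>x. u j x + (\<Sum>j\<in>A. u j x)) \<le> rnorm p (u j) + rnorm p (\<lambda>x. \<Sum>j\<in>A. u j x)"
    using insert.prems by (intro rnorm_add p_measurable p_gt_1 borel_measurable_sum) auto
  also have "\<dots> \<le> rnorm p (u j) + (\<Sum>j\<in>A. rnorm p (u j))"
    using insert by (intro add_left_mono) auto
  finally show ?case using insert.hyps by simp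
qed (use Lp_norm_zero in \<open>auto simp: Lp_norm_def\<close>)

text \<open>\<open>weight_locally_Lp\<close> concerns one fixed vector at a time. The sum over the
  coordinate vectors dominates the action of \<open>W x\<close> on every vector and is still a
  finite sum of functions of finite norm.\<close>

lemma weight_envelope:
  assumes Q: "Q \<in> cubes"
  obtains B where "B \<in> borel_measurable lebesgue" "rnorm p B < top" "\<And>x. 0 \<le> B x"
    "\<And>x v. x \<in> Q \<Longrightarrow> norm (W x *v v) \<le> norm v * B x"
proof -
  define B where "B x = (\<Sum>j\<in>UNIV. norm (W x *v axis j 1) * indicator Q x)" for x
  have m: "(\<lambda>x. norm (W x *v axis j 1) * indicator Q x) \<in> borel_measurable lebesgue" for j
    using W_measurable[of "\<lambda>_. axis j 1"] cubes_measure(1)[OF Q] by (intro borel_measurable_times borel_measurable_indicator) auto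
  have "B \<in> borel_measurable lebesgue"
    unfolding B_def using m by (rule borel_measurable_sum)
  moreover have "rnorm p B \<le> (\<Sum>j\<in>UNIV. rnorm p (\<lambda>x. norm (W x *v axis j 1) * indicator Q x))"
    unfolding B_def using m by (rule rnorm_sum)
  then have "rnorm p B < top"
    by (rule le_less_trans) (subst ennreal_sum_less_top, simp, intro ballI weight_locally_Lp Q)
  moreover have "0 \<le> B x" for x by (auto simp: B_def intro: sum_nonneg)
  moreover have "norm (W x *v v) \<le> norm v * B x" if "x \<in> Q" for x v
  proof -
    have "v = (\<Sum>j\<in>UNIV. v $ j *\<^sub>R axis j 1)"
      using basis_expansion[of v] by (simp add: scalar_mult_eq_scaleR)
    then have "W x *v v = (\<Sum>j\<in>UNIV. v $ j *\<^sub>R (W x *v axis j 1))"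
      by (metis (no_types, lifting) linear_sum linear_scale matrix_vector_mul_linear sum.cong)
    then have "norm (W x *v v) \<le> (\<Sum>j\<in>UNIV. norm (v $ j *\<^sub>R (W x *v axis j 1)))"
      by (simp only: norm_sum)
    also have "\<dots> \<le> (\<Sum>j\<in>UNIV. norm v * norm (W x *v axis j 1))"
      using component_le_norm_cart[of v] by (intro sum_mono) (auto intro: mult_right_mono)
    also have "\<dots> = norm v * B x"
      using that by (simp add: B_def sum_distrib_left)
    finally show ?thesis .
  qed
  ultimately show ?thesis by (rule that)
qed

text \<open>The constant depends on \<open>h\<close> and \<open>Q\<close> but neither on
  \<open>f\<close> nor on \<open>k\<close>, so the averages of a bounded family stay in one
  ball.\<close>

lemma cell_avg_bound:
  assumes Q: "Q \<in> cubes" and h: "0 < h"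
  obtains C where "0 < C" "\<And>f k. locally_integrable f \<Longrightarrow> grid_cell h k \<subseteq> Q \<Longrightarrow>
    ennreal (norm (cell_avg h f k)) \<le> ennreal C * Lp_norm p W f"
proof -
  obtain C where C: "0 < C" "\<And>f. f \<in> borel_measurable lebesgue \<Longrightarrow>
    (\<integral>\<^sup>+y. ennreal (norm (f y)) * indicator Q y \<partial>lebesgue) \<le> ennreal C * Lp_norm p W f"
    by (rule L1_embedding[OF Q]) blast
  define c where "c = 1 / h ^ CARD('n)"
  have c: "0 < c" using h by (simp add: c_def)
  have "ennreal (norm (cell_avg h f k)) \<le> ennreal (c * C) * Lp_norm p W f"
    if f: "locally_integrable f" and k: "grid_cell h k \<subseteq> Q" for f k
  proof -
    have "ennreal (norm (\<integral>y. indicator (grid_cell h k) y *\<^sub>R f y \<partial>lebesgue))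
      \<le> (\<integral>\<^sup>+y. ennreal (norm (indicator (grid_cell h k) y *\<^sub>R f y)) \<partial>lebesgue)"
      by (rule integral_norm_bound_ennreal[OF integrable_grid_cell[OF f h]])
    also have "\<dots> \<le> (\<integral>\<^sup>+y. ennreal (norm (f y)) * indicator Q y \<partial>lebesgue)"
      using k by (intro nn_integral_mono) (auto simp: indicator_def)
    also have "\<dots> \<le> ennreal C * Lp_norm p W f"
      by (rule C(2)[OF locally_integrable_measurable[OF f]])
    finally have "ennreal c * ennreal (norm (\<integral>y. indicator (grid_cell h k) y *\<^sub>R f y \<partial>lebesgue))
      \<le> ennreal c * (ennreal C * Lp_norm p W f)"
      by (rule mult_left_mono) simp
    then show ?thesis
      using c C(1) by (simp add: cell_avg_def c_def[symmetric] ennreal_mult mult.assoc)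
  qed
  with c C(1) show ?thesis by (intro that[of "c * C"]) auto
qed

text \<open>With \<open>K\<close> the union of the grid cells indexed by \<open>I\<close>, the difference \<open>f - g\<close> is split into
  the parts outside \<open>K\<close>, the distances to the cell averages and the difference of the averages.\<close>

lemma Lp_norm_diff_le_grid:
  fixes I :: "('n \<Rightarrow> int) set"
  assumes fg: "locally_integrable f" "locally_integrable g" and h: "0 < h" and I: "finite I"
    and R: "ball 0 R \<subseteq> (\<Union>k\<in>I. grid_cell h k)" and Q: "Q \<in> cubes" "(\<Union>k\<in>I. grid_cell h k) \<subseteq> Q"
    and B: "B \<in> borel_measurable lebesgue" "\<And>x. 0 \<le> B x" "\<And>x v. x \<in> Q \<Longrightarrow> norm (W x *v v) \<le> norm v * B x"
    and c: "0 \<le> c" "\<And>k. k \<in> I \<Longrightarrow> norm (cell_avg h f k - cell_avg h g k) \<le> c"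
  shows "Lp_norm p W (\<lambda>x. f x - g x) \<le>
    Lp_norm p W (\<lambda>x. indicator (- ball 0 R) x *\<^sub>R f x) + Lp_norm p W (\<lambda>x. indicator (- ball 0 R) x *\<^sub>R g x)
    + rnorm p (\<lambda>x. indicator (\<Union>k\<in>I. grid_cell h k) x * norm (W x *v (f x - grid_approx h I f x)))
    + rnorm p (\<lambda>x. indicator (\<Union>k\<in>I. grid_cell h k) x * norm (W x *v (g x - grid_approx h I g x)))
    + rnorm p (\<lambda>x. c * B x)"
proof -
  let ?K = "\<Union>k\<in>I. grid_cell h k"
  define o1 where "o1 u x = norm (W x *v (indicator (- ball 0 R) x *\<^sub>R u x))" for u :: "real^'n \<Rightarrow> real^'m" and x
  define d where "d u x = indicator ?K x * norm (W x *v (u x - grid_approx h I u x))" for u :: "real^'n \<Rightarrow> real^'m" and x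
  have Ks: "?K \<in> sets lebesgue"
    using I by (intro sets.finite_UN grid_cell_lebesgue h)
  have om: "o1 u \<in> borel_measurable lebesgue" if "locally_integrable u" for u
    unfolding o1_def using locally_integrable_measurable[OF that]
    by (intro W_measurable borel_measurable_scaleR borel_measurable_indicator) auto
  have dm: "d u \<in> borel_measurable lebesgue" if "locally_integrable u" for u
    unfolding d_def using locally_integrable_measurable[OF that] Ks h
    by (intro borel_measurable_times borel_measurable_indicator W_measurable borel_measurable_diff grid_approx_measurable)
  have cB: "(\<lambda>x. c * B x) \<in> borel_measurable lebesgue" using B(1) by simp
  \<comment> \<open>Outside the grid the first two terms suffice, inside it the last three. The
    regions overlap between the ball and the rim of the grid, which is harmless for nonnegative
    terms.\<close>
  have pt: "norm (W x *v (f x - g x)) \<le> o1 f x + o1 g x + d f x + d g x + c * B x" for x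
  proof (cases "x \<in> ?K")
    case False
    then have "x \<notin> ball 0 R" using R by blast
    then have "o1 u x = norm (W x *v u x)" for u by (simp add: o1_def)
    moreover have "norm (W x *v (f x - g x)) \<le> norm (W x *v f x) + norm (W x *v g x)"
      by (simp add: matrix_vector_mult_diff_distrib norm_triangle_ineq4)
    moreover have "0 \<le> d f x" "0 \<le> d g x" "0 \<le> c * B x"
      using B(2) c(1) by (auto simp: d_def)
    ultimately show ?thesis by simp
  next
    case True
    then obtain k where k: "k \<in> I" "x \<in> grid_cell h k" by blast
    have "W x *v (f x - g x) = W x *v (f x - grid_approx h I f x) - W x *v (g x - grid_approx h I g x)
        + W x *v (grid_approx h I f x - grid_approx h I g x)"
      by (simp add: matrix_vector_mult_diff_distrib)
    then have "norm (W x *v (f x - g x)) \<le> norm (W x *v (f x - grid_approx h I f x))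
        + norm (W x *v (g x - grid_approx h I g x)) + norm (W x *v (grid_approx h I f x - grid_approx h I g x))"
      by (simp only:) (intro order_trans[OF norm_triangle_ineq] add_right_mono norm_triangle_ineq4)
    also have "norm (W x *v (grid_approx h I f x - grid_approx h I g x)) \<le> norm (grid_approx h I f x - grid_approx h I g x) * B x"
      using True Q(2) by (intro B(3)) auto
    also have "\<dots> \<le> c * B x"
      using c(2)[OF k(1)] B(2)[of x] by (intro mult_right_mono) (auto simp: grid_approx_eq[OF I k, of f] grid_approx_eq[OF I k, of g])
    finally have "norm (W x *v (f x - g x)) \<le> d f x + d g x + c * B x"
      using True by (simp add: d_def)
    moreover have "0 \<le> o1 f x" "0 \<le> o1 g x"
      by (simp_all add: o1_def)
    ultimately show ?thesis by linarith
  qed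
  have "Lp_norm p W (\<lambda>x. f x - g x) \<le> rnorm p (\<lambda>x. o1 f x + o1 g x + d f x + d g x + c * B x)"
    unfolding Lp_norm_def
    by (intro lux_norm_mono_AE p_nonneg AE_I2 ennreal_leI) (rule order_trans[OF pt abs_ge_self])
  also have "\<dots> \<le> rnorm p (\<lambda>x. o1 f x + o1 g x + d f x + d g x) + rnorm p (\<lambda>x. c * B x)"
    using om dm cB fg by (intro rnorm_add p_measurable p_gt_1 borel_measurable_add)
  also have "rnorm p (\<lambda>x. o1 f x + o1 g x + d f x + d g x) \<le> rnorm p (\<lambda>x. o1 f x + o1 g x + d f x) + rnorm p (d g)"
    using om dm fg by (intro rnorm_add p_measurable p_gt_1 borel_measurable_add)
  also have "rnorm p (\<lambda>x. o1 f x + o1 g x + d f x) \<le> rnorm p (\<lambda>x. o1 f x + o1 g x) + rnorm p (d f)"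
    using om dm fg by (intro rnorm_add p_measurable p_gt_1 borel_measurable_add)
  also have "rnorm p (\<lambda>x. o1 f x + o1 g x) \<le> rnorm p (o1 f) + rnorm p (o1 g)"
    using om fg by (intro rnorm_add p_measurable p_gt_1)
  finally show ?thesis
    by (simp add: o1_def[abs_def] d_def[abs_def] Lp_norm_def add_right_mono)
qed

text \<open>Total boundedness is phrased as a finite labelling: functions with equal labels are
  close. In this form the labels for the functions and for their derivatives can be joined later,
  and the index \<open>f\<close> lets \<open>u\<close> be the identity or a weak derivative. The
  label consists of the rounded cell averages.\<close>

lemma Kolmogorov_Riesz:
  fixes u :: "'f \<Rightarrow> real^'n \<Rightarrow> real^'m"
  assumes loc: "\<And>f. f \<in> F \<Longrightarrow> locally_integrable (u f)"
    and bounded: "\<And>f. f \<in> F \<Longrightarrow> Lp_norm p W (u f) \<le> ennreal M"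
    and equicontinuous: "\<And>e. 0 < e \<Longrightarrow>
      \<exists>r>0. \<forall>f\<in>F. \<forall>y\<in>ball 0 r. Lp_norm p W (\<lambda>x. u f (x - y) - u f x) \<le> ennreal e"
    and vanishing: "\<And>e. 0 < e \<Longrightarrow>
      \<exists>R. \<forall>f\<in>F. Lp_norm p W (\<lambda>x. indicator (- ball 0 R) x *\<^sub>R u f x) \<le> ennreal e"
    and e: "0 < e"
  obtains \<kappa> :: "'f \<Rightarrow> ('n \<Rightarrow> int) \<Rightarrow> real^'m" where "finite (\<kappa> ` F)"
    "\<And>f g. f \<in> F \<Longrightarrow> g \<in> F \<Longrightarrow> \<kappa> f = \<kappa> g \<Longrightarrow> Lp_norm p W (\<lambda>x. u f x - u g x) \<le> ennreal e"
proof -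
  let ?n = "CARD('n)"
  \<comment> \<open>\<open>Lp_norm_diff_le_grid\<close> has five terms.\<close>
  define d where "d = e / 5"
  have d: "0 < d" using e by (simp add: d_def)
  obtain R where R: "\<And>f. f \<in> F \<Longrightarrow> Lp_norm p W (\<lambda>x. indicator (- ball 0 R) x *\<^sub>R u f x) \<le> ennreal d"
    using vanishing[OF d] by blast
  \<comment> \<open>Compensates the factor 2^n of \<open>modular_grid_approx\<close>. Below, half of
    it is used for the translates because \<open>modular_le_1\<close> needs a strict
    inequality.\<close>
  define l where "l = d / 2 ^ ?n"
  have l: "0 < l" using d by (simp add: l_def)
  obtain r where r: "0 < r" "\<And>f y. f \<in> F \<Longrightarrow> y \<in> ball 0 r \<Longrightarrow> Lp_norm p W (\<lambda>x. u f (x - y) - u f x) \<le> ennreal (l / 2)"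
    using equicontinuous[of "l / 2"] l by auto
  \<comment> \<open>A vector with coordinates bounded by \<open>h\<close> has length at most n h = r
    / 2, by comparison with the sum of its coordinates in absolute value.\<close>
  define h where "h = r / (2 * real ?n)"
  have h: "0 < h" using r(1) by (simp add: h_def)
  have small: "- z \<in> ball 0 r" if z: "z \<in> cbox (\<chi> i. - h) (\<chi> i. h)" for z :: "real^'n"
  proof -
    have "\<bar>z $ i\<bar> \<le> h" for i using z by (auto simp: mem_box_cart abs_le_iff minus_le_iff)
    then have "(\<Sum>i\<in>UNIV. \<bar>z $ i\<bar>) \<le> (\<Sum>i\<in>(UNIV :: 'n set). h)" by (intro sum_mono)
    then have "norm z \<le> real ?n * h" using norm_le_l1_cart[of z] by simp
    also have "\<dots> < r" using r(1) by (simp add: h_def)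
    finally show ?thesis by simp
  qed
  obtain I :: "('n \<Rightarrow> int) set" and Q where I: "finite I" "ball 0 R \<subseteq> (\<Union>k\<in>I. grid_cell h k)"
    and Q: "Q \<in> cubes" "(\<Union>k\<in>I. grid_cell h k) \<subseteq> Q"
    by (rule finite_grid[OF h, of R]) blast
  have approx: "rnorm p (\<lambda>x. indicator (\<Union>k\<in>I. grid_cell h k) x * norm (W x *v (u f x - grid_approx h I (u f) x))) \<le> ennreal d"
    if f: "f \<in> F" for f
  proof -
    have "modular p (\<lambda>x. norm (W x *v (u f x - u f (x + z))) / l) \<le> 1"
      if z: "z \<in> cbox (\<chi> i. - h) (\<chi> i. h)" for z
    proof (rule modular_le_1[OF p_nonneg])
      have "rnorm p (\<lambda>x. norm (W x *v (u f x - u f (x + z)))) = Lp_norm p W (\<lambda>x. u f (x - (- z)) - u f x)"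
        unfolding Lp_norm_minus_commute[of "\<lambda>x. u f (x - (- z))"] by (simp add: Lp_norm_def)
      also have "\<dots> \<le> ennreal (l / 2)" by (rule r(2)[OF f small[OF z]])
      also have "\<dots> < ennreal l" using l by (intro ennreal_lessI) auto
      finally show "rnorm p (\<lambda>x. norm (W x *v (u f x - u f (x + z)))) < ennreal l" .
    qed
    from modular_grid_approx[OF loc[OF f] h l I(1) this]
    show ?thesis using d by (intro rnorm_le) (auto simp: l_def)
  qed
  obtain B where B: "B \<in> borel_measurable lebesgue" "rnorm p B < top" "\<And>x. 0 \<le> B x"
    "\<And>x v. x \<in> Q \<Longrightarrow> norm (W x *v v) \<le> norm v * B x"
    by (rule weight_envelope[OF Q(1)]) blast
  \<comment> \<open>The admissible distance between averages: differences up to \<open>c\<close>,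
    multiplied by the envelope \<open>B\<close>, have norm at most \<open>d\<close>. Rounding within
    \<open>c / 2\<close> achieves it.\<close>
  obtain c where c: "0 < c" "rnorm p (\<lambda>x. c * B x) \<le> ennreal d"
    by (rule rnorm_cmult_le_obtain[OF p_nonneg B(2) d]) blast
  obtain C where C: "0 < C" "\<And>f k. locally_integrable f \<Longrightarrow> grid_cell h k \<subseteq> Q \<Longrightarrow>
    ennreal (norm (cell_avg h f k)) \<le> ennreal C * Lp_norm p W f"
    by (rule cell_avg_bound[OF Q(1) h]) blast
  \<comment> \<open>\<open>M\<close> is an arbitrary real and \<open>ennreal M\<close> is 0 for
    negative values; the absolute value makes the radius nonnegative.\<close>
  have avg: "cell_avg h (u f) k \<in> cball 0 (C * \<bar>M\<bar>)" if "f \<in> F" "k \<in> I" for f k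
  proof -
    have "ennreal (norm (cell_avg h (u f) k)) \<le> ennreal C * Lp_norm p W (u f)"
      using that Q(2) by (intro C(2) loc) auto
    also have "\<dots> \<le> ennreal C * ennreal \<bar>M\<bar>"
      using bounded[OF that(1)] by (intro mult_left_mono) (auto intro: order_trans ennreal_leI)
    also have "\<dots> = ennreal (C * \<bar>M\<bar>)"
      using C(1) by (simp add: ennreal_mult)
    finally show ?thesis using C(1) by (subst (asm) ennreal_le_iff) auto
  qed
  obtain N and q :: "real^'m \<Rightarrow> real^'m" where q: "finite N"
    "\<And>v. v \<in> cball 0 (C * \<bar>M\<bar>) \<Longrightarrow> q v \<in> N \<and> dist v (q v) < c / 2"
    by (rule finite_net_map[OF bounded_cball[of 0 "C * \<bar>M\<bar>"] half_gt_zero[OF c(1)]]) blast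
  \<comment> \<open>The value 0 outside \<open>I\<close> leaves only finitely many possible
    functions, since \<open>I\<close> and the net \<open>N\<close> are finite.\<close>
  define \<kappa> where "\<kappa> f k = (if k \<in> I then q (cell_avg h (u f) k) else 0)" for f k
  have "\<kappa> ` F \<subseteq> {\<phi>. \<forall>k. (k \<in> I \<longrightarrow> \<phi> k \<in> N) \<and> (k \<notin> I \<longrightarrow> \<phi> k = 0)}"
    using q(2)[OF avg] by (auto simp: \<kappa>_def)
  then have fin: "finite (\<kappa> ` F)"
    by (rule finite_subset) (rule finite_set_of_finite_funs[OF I(1) q(1)])
  have "Lp_norm p W (\<lambda>x. u f x - u g x) \<le> ennreal e" if fg: "f \<in> F" "g \<in> F" "\<kappa> f = \<kappa> g" for f g
  proof -
    have "norm (cell_avg h (u f) k - cell_avg h (u g) k) \<le> c" if k: "k \<in> I" for k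
    proof -
      have "q (cell_avg h (u f) k) = q (cell_avg h (u g) k)"
        using fun_cong[OF fg(3), of k] k by (simp add: \<kappa>_def)
      then have "dist (cell_avg h (u f) k) (cell_avg h (u g) k) < c / 2 + c / 2"
        using q(2)[OF avg[OF fg(1) k]] q(2)[OF avg[OF fg(2) k]]
          dist_triangle2[of "cell_avg h (u f) k" "cell_avg h (u g) k" "q (cell_avg h (u f) k)"] by simp
      then show ?thesis by (simp add: dist_norm)
    qed
    from Lp_norm_diff_le_grid[OF loc[OF fg(1)] loc[OF fg(2)] h I Q B(1,3,4) less_imp_le[OF c(1)] this]
    have "Lp_norm p W (\<lambda>x. u f x - u g x) \<le> ennreal d + ennreal d + ennreal d + ennreal d + ennreal d"
      by (rule order_trans) ((assumption | intro add_mono R approx fg c(2))+)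
    also have "\<dots> = ennreal e"
      using d by (simp add: ennreal_plus[symmetric] d_def del: ennreal_plus)
    finally show ?thesis .
  qed
  with fin show ?thesis by (rule that)
qed

end

theorem theorem6p1:
  fixes p :: "real^'n \<Rightarrow> real"
    and W :: "real^'n \<Rightarrow> real^'m^'m"
    and F :: "(real^'n \<Rightarrow> real^'m) set"
  assumes "p \<in> exponents"
    and "matrix_weight W"
    and "Ap_const p W < \<infinity>"
    and "F \<subseteq> W1p p W"
    and bounded: "(SUP f\<in>F. W1p_norm p W f) < \<infinity>"
    and equicontinuous:
      "((\<lambda>r::real. SUP f\<in>F. SUP y\<in>ball 0 r. W1p_norm p W (\<lambda>x. translate y f x - f x)) \<longlongrightarrow> 0)
         (at_right 0)"
    and vanishing:
      "((\<lambda>R::real. SUP f\<in>F.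
           Lp_norm p W (\<lambda>x. indicator (- ball 0 R) x *\<^sub>R f x)
           + (\<Sum>j\<in>UNIV. Lp_norm p W (\<lambda>x. indicator (- ball 0 R) x *\<^sub>R weak_partial j f x))) \<longlongrightarrow> 0)
         at_top"
  shows "precompact_in_W1p p W F"
proof -
  interpret Ap_weight p W
    using assms(1-3) by unfold_locales
  have Fl: "f \<in> W11_loc" "f \<in> W1p p W" if "f \<in> F" for f
    using that assms(4) by (auto simp: W1p_def)
  have member: "v j \<le> (\<Sum>j\<in>UNIV. v j)" for v :: "'n \<Rightarrow> ennreal" and j
    by (rule member_le_sum) auto
  obtain M where M: "(SUP f\<in>F. W1p_norm p W f) < ennreal M"
    using bounded by (auto elim: less_top_obtain_ennreal)
  have bd: "Lp_norm p W f \<le> ennreal M" "Lp_norm p W (weak_partial j f) \<le> ennreal M" if f: "f \<in> F" for f j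
  proof -
    have "W1p_norm p W f \<le> ennreal M"
      using SUP_upper[OF f, of "W1p_norm p W"] M by (meson le_less_trans less_imp_le)
    then have s: "Lp_norm p W f + (\<Sum>j\<in>UNIV. Lp_norm p W (weak_partial j f)) \<le> ennreal M"
      by (simp add: W1p_norm_def)
    show "Lp_norm p W f \<le> ennreal M"
      by (rule order_trans[OF _ s]) simp
    show "Lp_norm p W (weak_partial j f) \<le> ennreal M"
      by (rule order_trans[OF member order_trans[OF _ s]]) simp
  qed
  have eq: "\<exists>r>0. \<forall>f\<in>F. \<forall>y\<in>ball 0 r. Lp_norm p W (\<lambda>x. f (x - y) - f x) \<le> ennreal e
      \<and> (\<forall>j. Lp_norm p W (\<lambda>x. weak_partial j f (x - y) - weak_partial j f x) \<le> ennreal e)" if e: "0 < e" for e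
  proof -
    have "\<forall>\<^sub>F r in at_right 0. (SUP f\<in>F. SUP y\<in>ball 0 r. W1p_norm p W (\<lambda>x. translate y f x - f x)) < ennreal e"
      using equicontinuous e by (intro order_tendstoD) auto
    then obtain b where b: "0 < b" "\<And>r. 0 < r \<Longrightarrow> r < b \<Longrightarrow>
        (SUP f\<in>F. SUP y\<in>ball 0 r. W1p_norm p W (\<lambda>x. translate y f x - f x)) < ennreal e"
      unfolding eventually_at_right_field by auto
    have "Lp_norm p W (\<lambda>x. f (x - y) - f x) \<le> ennreal e
      \<and> (\<forall>j. Lp_norm p W (\<lambda>x. weak_partial j f (x - y) - weak_partial j f x) \<le> ennreal e)"
      if f: "f \<in> F" and y: "y \<in> ball 0 (b / 2)" for f y
    proof -
      have "W1p_norm p W (\<lambda>x. translate y f x - f x) \<le> (SUP f\<in>F. SUP y\<in>ball 0 (b / 2). W1p_norm p W (\<lambda>x. translate y f x - f x))"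
        by (rule SUP_upper2[OF f]) (rule SUP_upper[OF y])
      also have "\<dots> \<le> ennreal e"
        using b(2)[of "b / 2"] b(1) by simp
      finally have "W1p_norm p W (\<lambda>x. translate y f x - f x) \<le> ennreal e" .
      \<comment> \<open>The hypothesis uses the weak derivatives chosen for the difference; almost
        everywhere these are the differences between translated and original derivatives.\<close>
      moreover have "W1p_norm p W (\<lambda>x. translate y f x - f x) = Lp_norm p W (\<lambda>x. translate y f x - f x)
        + (\<Sum>j\<in>UNIV. Lp_norm p W (\<lambda>x. translate y (weak_partial j f) x - weak_partial j f x))"
        by (rule W1p_norm_eq)
          (intro has_weak_partial_vec_diff has_weak_partial_vec_translate W11_locD Fl f)
      ultimately have s: "Lp_norm p W (\<lambda>x. f (x - y) - f x)
        + (\<Sum>j\<in>UNIV. Lp_norm p W (\<lambda>x. weak_partial j f (x - y) - weak_partial j f x)) \<le> ennreal e"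
        by (simp add: translate_def)
      show ?thesis
      proof (intro conjI allI)
        show "Lp_norm p W (\<lambda>x. f (x - y) - f x) \<le> ennreal e"
          by (rule order_trans[OF _ s]) simp
        show "Lp_norm p W (\<lambda>x. weak_partial j f (x - y) - weak_partial j f x) \<le> ennreal e" for j
          by (rule order_trans[OF member order_trans[OF _ s]]) simp
      qed
    qed
    with b(1) show ?thesis by (intro exI[of _ "b / 2"]) auto
  qed
  have van: "\<exists>R. \<forall>f\<in>F. Lp_norm p W (\<lambda>x. indicator (- ball 0 R) x *\<^sub>R f x) \<le> ennreal e
      \<and> (\<forall>j. Lp_norm p W (\<lambda>x. indicator (- ball 0 R) x *\<^sub>R weak_partial j f x) \<le> ennreal e)" if e: "0 < e" for e
  proof -
    let ?v = "\<lambda>R f. Lp_norm p W (\<lambda>x. indicator (- ball 0 R) x *\<^sub>R f x)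
           + (\<Sum>j\<in>UNIV. Lp_norm p W (\<lambda>x. indicator (- ball 0 R) x *\<^sub>R weak_partial j f x))"
    have "\<forall>\<^sub>F R in at_top. (SUP f\<in>F. ?v R f) < ennreal e"
      using vanishing e by (intro order_tendstoD) auto
    then obtain R where R: "(SUP f\<in>F. ?v R f) < ennreal e"
      by (auto simp: eventually_at_top_linorder)
    have s: "?v R f \<le> ennreal e" if "f \<in> F" for f
      using SUP_upper[OF that, of "?v R"] R by (meson le_less_trans less_imp_le)
    show ?thesis
    proof (intro exI[of _ R] ballI conjI allI)
      fix f j assume f: "f \<in> F"
      show "Lp_norm p W (\<lambda>x. indicator (- ball 0 R) x *\<^sub>R f x) \<le> ennreal e"
        by (rule order_trans[OF _ s[OF f]]) simp
      show "Lp_norm p W (\<lambda>x. indicator (- ball 0 R) x *\<^sub>R weak_partial j f x) \<le> ennreal e"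
        by (rule order_trans[OF member order_trans[OF _ s[OF f]]]) simp
    qed
  qed
  have "W1p.mtotally_bounded (ae_class ` F)"
    unfolding W1p.mtotally_bounded_def
  proof (intro allI impI)
    fix \<epsilon> :: real assume \<epsilon>: "0 < \<epsilon>"
    \<comment> \<open>The n + 1 terms of the Sobolev norm then add up to at most \<epsilon> / 2,
      which leaves room for the strict inequality.\<close>
    define e where "e = \<epsilon> / (2 * (real CARD('n) + 1))"
    have e: "0 < e" using \<epsilon> by (simp add: e_def)
    obtain \<kappa> :: "(real^'n \<Rightarrow> real^'m) \<Rightarrow> ('n \<Rightarrow> int) \<Rightarrow> real^'m" where \<kappa>: "finite (\<kappa> ` F)"
      "\<And>f g. f \<in> F \<Longrightarrow> g \<in> F \<Longrightarrow> \<kappa> f = \<kappa> g \<Longrightarrow> Lp_norm p W (\<lambda>x. f x - g x) \<le> ennreal e"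
    proof (rule Kolmogorov_Riesz[of F "\<lambda>f. f" M e])
      show "locally_integrable f" if "f \<in> F" for f using W11_locD(1)[OF Fl(1)[OF that]] .
      show "\<exists>r>0. \<forall>f\<in>F. \<forall>y\<in>ball 0 r. Lp_norm p W (\<lambda>x. f (x - y) - f x) \<le> ennreal e" if "0 < e" for e
        using eq[OF that] by blast
      show "\<exists>R. \<forall>f\<in>F. Lp_norm p W (\<lambda>x. indicator (- ball 0 R) x *\<^sub>R f x) \<le> ennreal e" if "0 < e" for e
        using van[OF that] by blast
    qed (use bd(1) e in auto)
    have "\<exists>\<kappa> :: (real^'n \<Rightarrow> real^'m) \<Rightarrow> ('n \<Rightarrow> int) \<Rightarrow> real^'m. finite (\<kappa> ` F) \<and>
      (\<forall>f\<in>F. \<forall>g\<in>F. \<kappa> f = \<kappa> g \<longrightarrow> Lp_norm p W (\<lambda>x. weak_partial j f x - weak_partial j g x) \<le> ennreal e)" for j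
    proof (rule Kolmogorov_Riesz[of F "weak_partial j" M e])
      show "locally_integrable (weak_partial j f)" if "f \<in> F" for f using W11_locD(3)[OF Fl(1)[OF that]] .
      show "\<exists>r>0. \<forall>f\<in>F. \<forall>y\<in>ball 0 r. Lp_norm p W (\<lambda>x. weak_partial j f (x - y) - weak_partial j f x) \<le> ennreal e" if "0 < e" for e
        using eq[OF that] by blast
      show "\<exists>R. \<forall>f\<in>F. Lp_norm p W (\<lambda>x. indicator (- ball 0 R) x *\<^sub>R weak_partial j f x) \<le> ennreal e" if "0 < e" for e
        using van[OF that] by blast
    qed (use bd(2) e in auto)
    from choice[OF allI, OF this] obtain \<kappa>' :: "'n \<Rightarrow> (real^'n \<Rightarrow> real^'m) \<Rightarrow> ('n \<Rightarrow> int) \<Rightarrow> real^'m"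
      where \<kappa>': "\<forall>j. finite (\<kappa>' j ` F) \<and> (\<forall>f\<in>F. \<forall>g\<in>F. \<kappa>' j f = \<kappa>' j g \<longrightarrow>
        Lp_norm p W (\<lambda>x. weak_partial j f x - weak_partial j g x) \<le> ennreal e)" ..
    \<comment> \<open>The joint label still takes finitely many values, and equality of labels makes
      the functions and all their derivatives close at once.\<close>
    define K where "K f = (\<kappa> f, \<lambda>j. \<kappa>' j f)" for f
    have "K ` F \<subseteq> \<kappa> ` F \<times> (PiE UNIV (\<lambda>j. \<kappa>' j ` F))"
      by (auto simp: K_def)
    moreover have "finite (\<kappa> ` F \<times> (PiE UNIV (\<lambda>j. \<kappa>' j ` F)))"
      using \<kappa>(1) \<kappa>' by (intro finite_cartesian_product finite_PiE) auto
    ultimately have finK: "finite (K ` F)" by (rule finite_subset)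
    have close: "W1p_dist p W (ae_class f) (ae_class g) < \<epsilon>" if fg: "f \<in> F" "g \<in> F" "K f = K g" for f g
    proof -
      have k: "\<kappa> f = \<kappa> g" "\<And>j. \<kappa>' j f = \<kappa>' j g"
        using fg(3) by (auto simp: K_def fun_eq_iff)
      have "ennreal (W1p_dist p W (ae_class f) (ae_class g)) = W1p_norm p W (\<lambda>x. f x - g x)"
        by (rule W1p_dist_ae_class[OF Fl(2)[OF fg(1)] Fl(2)[OF fg(2)]])
      also have "\<dots> \<le> ennreal e + (\<Sum>j\<in>(UNIV :: 'n set). ennreal e)"
        unfolding W1p_norm_diff_eq[OF Fl(1)[OF fg(1)] Fl(1)[OF fg(2)]]
        using \<kappa>(2)[OF fg(1,2) k(1)] \<kappa>' fg(1,2) k(2) by (intro add_mono sum_mono) auto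
      also have "\<dots> = ennreal (e + real CARD('n) * e)"
        using e by (simp add: ennreal_of_nat_eq_real_of_nat ennreal_mult[symmetric] ennreal_plus[symmetric] del: ennreal_plus)
      also have "e + real CARD('n) * e = \<epsilon> / 2"
      proof -
        have "e * (2 * (real CARD('n) + 1)) = \<epsilon>"
          using add_nonneg_pos[of "real CARD('n)" 1] by (simp add: e_def)
        then show ?thesis by (simp add: algebra_simps)
      qed
      finally have "W1p_dist p W (ae_class f) (ae_class g) \<le> \<epsilon> / 2"
        using \<epsilon> by (subst (asm) ennreal_le_iff) auto
      with \<epsilon> show ?thesis by simp
    qed
    \<comment> \<open>One member of \<open>F\<close> per label serves as centre, because total
      boundedness asks for centres within the set itself.\<close>
    define s where "s v = (SOME f. f \<in> F \<and> K f = v)" for v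
    have s: "s (K f) \<in> F \<and> K (s (K f)) = K f" if "f \<in> F" for f
      unfolding s_def using that by (intro someI[of "\<lambda>g. g \<in> F \<and> K g = K f" f]) simp
    show "\<exists>T. finite T \<and> T \<subseteq> ae_class ` F \<and> ae_class ` F \<subseteq> (\<Union>A\<in>T. W1p.mball A \<epsilon>)"
    proof (intro exI conjI)
      show "finite ((\<lambda>f. ae_class (s (K f))) ` F)"
        using finite_imageI[OF finK, of "\<lambda>v. ae_class (s v)"] by (simp add: image_image)
      show "(\<lambda>f. ae_class (s (K f))) ` F \<subseteq> ae_class ` F"
        using s by blast
      show "ae_class ` F \<subseteq> (\<Union>A\<in>(\<lambda>f. ae_class (s (K f))) ` F. W1p.mball A \<epsilon>)"
      proof
        fix A assume "A \<in> ae_class ` F"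
        then obtain f where f: "f \<in> F" "A = ae_class f" by blast
        have "A \<in> W1p.mball (ae_class (s (K f))) \<epsilon>"
          unfolding W1p.in_mball f(2)
          using s[OF f(1)] f(1) by (intro conjI ae_class_in_space Fl close) auto
        with f(1) show "A \<in> (\<Union>A\<in>(\<lambda>f. ae_class (s (K f))) ` F. W1p.mball A \<epsilon>)" by blast
      qed
    qed
  qed
  \<comment> \<open>Completeness turns total boundedness into compactness of the closure.\<close>
  then have "compactin W1p.mtopology (W1p.mtopology closure_of (ae_class ` F))"
    using W1p.mtotally_bounded_eq_compact_closure_of[OF W1p_mcomplete] by blast
  then show ?thesis
    by (simp add: precompact_in_W1p_def W1p_topology_def)
qed

end
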